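(* Let $G$ be an infinite compact abelian group. 1. Let $\mathcal{F}$ be a filter on $\widehat{G}$. Then the set $H$ of all $\alpha\in G$ for which $\mathcal{F}-\lim_\chi\chi(\alpha)$ exists is a subgroup of $G$, and the mapping $f:H\to\mathbb{T}$, $\alpha\mapsto\mathcal{F}-\lim_\chi\chi(\alpha)$, is a group homomorphism. In particular, if $(\chi_n)_{n=1}^\infty$ is a sequence in $\widehat{G}$, the set $H$ of all $\alpha\in G$ for which $\lim_{n\to\infty}\chi_n(\alpha)$ exists is a subgroup, and the mapping $f:H\to\mathbb{T}$, $\alpha\mapsto\lim_{n\to\infty}\chi_n(\alpha)$, is a group homomorphism. 2. Conversely, let $H$ be a subgroup of $G$ and let $f:H\to\mathbb{T}$ be a (not necessarily continuous) homomorphism. Then there exists a filter $\mathcal{F}$ on $\widehat{G}$ such that $\mathcal{F}-\lim_\chi\chi(\alpha)=f(\alpha)$ for all $\alpha\in H$, and $\mathcal{F}-\lim_\chi\chi(\beta)$ does not exist whenever $\beta\in G\setminus H$. 3. If furthermore (with $H\le G$ and $f:H\to\mathbb{T}$ a homomorphism as in part 2) $H$ is countable, then there exists a sequence $(\chi_n)_{n=1}^\infty$ in $\widehat{G}$ such that $\chi_n(\alpha)\to f(\alpha)$ for all $\alpha\in H$. 4. If (with $H\le G$ and $f:H\to\mathbb{T}$ a homomorphism as in part 2) $G$ is metrizable and $H$ is countable, then there exists a sequence $(\chi_n')_{n=1}^\infty$ in $\widehat{G}$ such that $\chi_n'(\alpha)\to f(\alpha)$ for all $\alpha\in H$, and $(\chi_n'(\beta))_{n=1}^\infty$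 does not converge if $\beta\in G\setminus H$.
   Context: $\mathbb{T}=\mathbb{R}/\mathbb{Z}$, written additively with its usual topology. $\widehat{G}$ is the group of all continuous homomorphisms $\chi: G\to\mathbb{T}$. Subgroups need not be closed. Filters are proper (they do not contain the empty set). Filter limits: if $\mathcal{F}$ is a filter on a set $S$, $g:S\to X$ is a map to a topological space and $y\in X$, then $\mathcal{F}-\lim_s g(s)=y$ means that $\{s\in S: g(s)\in U\}\in\mathcal{F}$ for every neighborhood $U$ of $y$; the limit exists if there is such a $y$. *)

theory Defs
  imports "HOL-Analysis.Analysis"
begin

text \<open>The circle group R/Z, written additively, with the quotient topology.\<close>

quotient_type circle = real / "\<lambda>x y. x - y \<in> \<int>" morphisms rep_circle to_circle
proof (rule equivpI)
  show "reflp (\<lambda>x y::real. x - y \<in> \<int>)"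
    by (simp add: reflp_def)
  show "symp (\<lambda>x y::real. x - y \<in> \<int>)"
    unfolding symp_def by (metis Ints_minus minus_diff_eq)
  show "transp (\<lambda>x y::real. x - y \<in> \<int>)"
    unfolding transp_def by (metis Ints_add diff_add_cancel add_diff_eq)
qed

lemma to_circle_eq_iff: "to_circle x = to_circle y \<longleftrightarrow> x - y \<in> \<int>"
  by (rule circle.abs_eq_iff)

instantiation circle :: ab_group_add
begin

lift_definition zero_circle :: circle is 0 .

lift_definition plus_circle :: "circle \<Rightarrow> circle \<Rightarrow> circle" is "(+)"
  by (metis Ints_add add_diff_add)

lift_definition uminus_circle :: "circle \<Rightarrow> circle" is uminus
  by (metis Ints_minus minus_diff_commute minus_diff_minus)

lift_definition minus_circle :: "circle \<Rightarrow> circle \<Rightarrow> circle" is "(-)"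
  by (metis Ints_diff diff_diff_eq2 diff_diff_eq add_diff_eq diff_add_eq)

instance
  by standard (transfer; simp)+

end

instantiation circle :: topological_space
begin

definition open_circle :: "circle set \<Rightarrow> bool"
  where "open_circle U \<longleftrightarrow> open (to_circle -` U)"

instance
proof
  show "open (UNIV :: circle set)"
    by (simp add: open_circle_def)
  show "open (S \<inter> T)" if "open S" "open T" for S T :: "circle set"
    using that by (auto simp: open_circle_def vimage_Int)
  show "open (\<Union>K)" if "\<forall>S\<in>K. open S" for K :: "circle set set"
    using that by (auto simp: open_circle_def vimage_Union)
qed

end

lemma to_circle_surj: "\<exists>x. c = to_circle x"
  by (metis Quotient_abs_rep Quotient_circle)

lemma open_to_circle_image:
  assumes "open A"
  shows "open (to_circle ` A)"
proof -
  have "to_circle -` to_circle ` A = (\<Union>n::int. (+) (of_int n) ` A)"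
  proof (intro set_eqI iffI)
    fix x assume "x \<in> to_circle -` to_circle ` A"
    then obtain a where a: "a \<in> A" "x - a \<in> \<int>"
      by (auto simp: to_circle_eq_iff)
    then obtain n where "x - a = of_int n"
      by (auto elim: Ints_cases)
    then have "x = of_int n + a" by simp
    with a show "x \<in> (\<Union>n::int. (+) (of_int n) ` A)" by blast
  next
    fix x assume "x \<in> (\<Union>n::int. (+) (of_int n) ` A)"
    then obtain n :: int and a where "a \<in> A" "x = of_int n + a" by blast
    then have "to_circle x = to_circle a" by (simp add: to_circle_eq_iff)
    with \<open>a \<in> A\<close> show "x \<in> to_circle -` to_circle ` A" by blast
  qed
  moreover have "open (\<Union>n::int. (+) (of_int n) ` A)"
    using assms by (intro open_UN ballI open_translation)
  ultimately show ?thesis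
    by (simp add: open_circle_def)
qed

instance circle :: t2_space
proof
  fix c d :: circle
  assume "c \<noteq> d"
  obtain x y where xy: "c = to_circle x" "d = to_circle y"
    using to_circle_surj by meson
  define e where "e t = (cos (2 * pi * t), sin (2 * pi * t))" for t :: real
  have e_eq: "e s = e t \<longleftrightarrow> to_circle s = to_circle t" for s t
  proof -
    have "e s = e t \<longleftrightarrow> (\<exists>n::int. 2 * pi * s = 2 * pi * t + 2 * pi * n)"
      using sin_cos_eq_iff[of "2 * pi * s" "2 * pi * t"] by (auto simp: e_def)
    also have "\<dots> \<longleftrightarrow> (\<exists>n::int. s - t = n)"
    proof -
      have "2 * pi * s = 2 * pi * t + 2 * pi * n \<longleftrightarrow> s - t = n" for n :: real
      proof -
        have "2 * pi * s = 2 * pi * t + 2 * pi * n \<longleftrightarrow> (2 * pi) * s = (2 * pi) * (t + n)"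
          by (simp only: distrib_left)
        also have "\<dots> \<longleftrightarrow> s = t + n"
          by (subst mult_cancel_left) simp
        finally show ?thesis by auto
      qed
      then show ?thesis by simp
    qed
    also have "\<dots> \<longleftrightarrow> to_circle s = to_circle t"
      by (auto simp: to_circle_eq_iff elim: Ints_cases)
    finally show ?thesis .
  qed
  have "e x \<noteq> e y"
    using \<open>c \<noteq> d\<close> xy e_eq by simp
  then obtain U V where UV: "open U" "open V" "e x \<in> U" "e y \<in> V" "U \<inter> V = {}"
    by (meson hausdorff)
  have "continuous_on UNIV e"
    unfolding e_def by (intro continuous_intros)
  then have opn: "open (e -` W)" if "open W" for W
    using that by (simp add: open_vimage)
  have "open (to_circle ` (e -` U))" "open (to_circle ` (e -` V))"
    using UV opn by (auto intro: open_to_circle_image)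
  moreover have "c \<in> to_circle ` (e -` U)" "d \<in> to_circle ` (e -` V)"
    using UV xy by auto
  moreover have "to_circle ` (e -` U) \<inter> to_circle ` (e -` V) = {}"
    using UV(5) e_eq by (auto, metis disjoint_iff)
  ultimately show "\<exists>U V. open U \<and> open V \<and> c \<in> U \<and> d \<in> V \<and> U \<inter> V = {}"
    by blast
qed

lemma eventually_nhds_to_circle:
  assumes "eventually P (nhds (to_circle x))"
  shows "eventually (\<lambda>t. P (to_circle t)) (nhds x)"
proof -
  obtain U where U: "open U" "to_circle x \<in> U" "\<forall>c\<in>U. P c"
    using assms by (auto simp: eventually_nhds)
  then show ?thesis
    unfolding eventually_nhds by (intro exI[of _ "to_circle -` U"]) (simp add: open_circle_def)
qed

lemma nhds_to_circle: "nhds (to_circle x) = filtermap to_circle (nhds x)"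
proof (rule filter_eqI, unfold eventually_filtermap, rule iffI)
  fix P
  show "eventually (\<lambda>t. P (to_circle t)) (nhds x)" if "eventually P (nhds (to_circle x))"
    using that by (rule eventually_nhds_to_circle)
  assume "eventually (\<lambda>t. P (to_circle t)) (nhds x)"
  then obtain A where "open A" "x \<in> A" "\<forall>t\<in>A. P (to_circle t)"
    by (auto simp: eventually_nhds)
  then show "eventually P (nhds (to_circle x))"
    unfolding eventually_nhds by (intro exI[of _ "to_circle ` A"]) (auto intro: open_to_circle_image)
qed

instance circle :: topological_ab_group_add
proof
  fix c d :: circle
  obtain x y where xy: "c = to_circle x" "d = to_circle y"
    using to_circle_surj by meson
  have "filterlim (\<lambda>p. to_circle (fst p + snd p)) (nhds (to_circle (x + y))) (nhds x \<times>\<^sub>F nhds y)"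
    using tendsto_add_Pair[of x y]
    by (rule filterlim_compose[rotated]) (simp add: nhds_to_circle filterlim_def)
  then show "filterlim (\<lambda>p. fst p + snd p) (nhds (c + d)) (nhds c \<times>\<^sub>F nhds d)"
    unfolding xy nhds_to_circle prod_filtermap1 prod_filtermap2 filtermap_filtermap
    by (simp add: filterlim_filtermap nhds_to_circle plus_circle.abs_eq case_prod_unfold)
  have "filterlim (\<lambda>t. to_circle (- t)) (nhds (to_circle (- x))) (nhds x)"
    using tendsto_uminus_nhds[of x]
    by (rule filterlim_compose[rotated]) (simp add: nhds_to_circle filterlim_def)
  then show "filterlim uminus (nhds (- c)) (nhds c)"
    unfolding xy nhds_to_circle
    by (simp add: filterlim_filtermap nhds_to_circle uminus_circle.abs_eq)
qed

definition is_subgroup :: "'a::ab_group_add set \<Rightarrow> bool"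
  where "is_subgroup H \<longleftrightarrow>
    0 \<in> H \<and> (\<forall>x\<in>H. \<forall>y\<in>H. x + y \<in> H) \<and> (\<forall>x\<in>H. - x \<in> H)"

definition hom_on :: "'a::ab_group_add set \<Rightarrow> ('a \<Rightarrow> 'b::ab_group_add) \<Rightarrow> bool"
  where "hom_on H f \<longleftrightarrow> (\<forall>x\<in>H. \<forall>y\<in>H. f (x + y) = f x + f y)"

definition dual :: "('a::topological_ab_group_add \<Rightarrow> circle) set"
  where "dual = {\<phi>. continuous_on UNIV \<phi> \<and> hom_on UNIV \<phi>}"

text \<open>The proper filters on a set \<open>S\<close> correspond to the filters on the ambient type that are
  different from \<^term>\<open>bot\<close> (the filter containing the empty set) and contain \<open>S\<close>.\<close>

definition proper_filter_on :: "'a set \<Rightarrow> 'a filter \<Rightarrow> bool"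
  where "proper_filter_on S F \<longleftrightarrow> F \<noteq> bot \<and> eventually (\<lambda>x. x \<in> S) F"

end

theory Submission
  imports Defs
begin

text \<open>Part 2 takes the filter generated by the traces on the dual of the neighbourhoods (for
  pointwise convergence) of all extensions of \<open>f\<close> to the whole group. It is proper because the
  dual is dense among all homomorphisms, and since the circle is divisible, each point
  outside \<open>H\<close> separates two of the extensions. Density follows, by Bohr's proof of Kronecker's
  theorem, from the fact that characters separate points.

  Characters are found by maximizing \<open>\<parallel>\<phi> + g\<parallel>\<^sub>2\<close> over the continuous normalized positive definite
  functions \<open>\<phi>\<close>, where the norm comes from the invariant mean of continuous functions. Such a
  \<open>\<phi>\<close> is a convex combination of the functions
  \<open>\<phi> \<pm> (c \<phi>(\<cdot> + a) + cnj c \<phi>(\<cdot> - a)) / 2\<close>, so at a maximum strict convexity makes all of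
  them proportional to \<open>\<phi>\<close>, which says that \<open>\<phi>\<close> is multiplicative.

  For part 4, let \<open>F\<close> be a finite subset of \<open>H\<close>. The points at which all characters that are
  small on \<open>F\<close> take values close to 0 form a finite subset of \<open>H\<close>, and by compactness finitely
  many of these characters suffice to confine such points to a prescribed neighbourhood of that set.
  Concatenating these finite families gives a sequence that converges to 0 exactly on \<open>H\<close>. Adding it
  to every other term of the sequence of part 3 destroys convergence outside \<open>H\<close>.\<close>

subsection \<open>The exponential on the circle\<close>

text \<open>The hard point is to produce a nontrivial continuous character from compactness alone.
  Maximizing a strictly convex functional drives a state to an extreme point, and the extreme states
  are the characters. The obstacle is that the states need not be compact: a pointwise limit of
  continuous positive definite functions may be discontinuous. This is why \<open>\<phi> + g\<close>
  is used rather than \<open>\<phi>\<close>. If some state has inner product at least 2 with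
  \<open>g\<close>, every nearly maximal state has inner product at least 1 with \<open>g\<close>,
  and its near-eigenfunction property under shifts then passes the uniform continuity of
  \<open>g\<close> on to it, with a modulus common to all such states. The same lower bound keeps
  the maximizer from being orthogonal to \<open>g\<close>, and \<open>g\<close> is chosen so that
  characters trivial at the given point are orthogonal to it.

  Distances in the circle are chord lengths. A nonzero element has a multiple at chord distance at
  least 1 from 0, so a homomorphism whose values all stay below 1 vanishes. The tolerances 1/4 and
  3/4 near the end are measured against this 1.\<close>

lift_definition circle_exp :: "circle \<Rightarrow> complex" is "\<lambda>t. cis (2 * pi * t)"
proof -
  fix s t :: real
  assume "s - t \<in> \<int>"
  then obtain n :: int where "s = t + n"
    by (metis Ints_cases add.commute diff_add_cancel)
  then show "cis (2 * pi * s) = cis (2 * pi * t)"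
    by (simp add: distrib_left cis_mult[symmetric] cis_multiple_2pi)
qed

lemma circle_exp_0 [simp]: "circle_exp 0 = 1"
  by transfer simp

lemma circle_exp_add: "circle_exp (c + d) = circle_exp c * circle_exp d"
  by transfer (simp add: cis_mult distrib_left)

lemma circle_exp_minus: "circle_exp (- c) = cnj (circle_exp c)"
  by transfer (simp add: cis_cnj)

lemma circle_exp_diff: "circle_exp (c - d) = circle_exp c * cnj (circle_exp d)"
  by (metis circle_exp_add circle_exp_minus diff_conv_add_uminus)

lemma norm_circle_exp [simp]: "norm (circle_exp c) = 1"
  by transfer simp

lemma circle_exp_sum: "circle_exp (\<Sum>i\<in>I. f i) = (\<Prod>i\<in>I. circle_exp (f i))"
  by (induction I rule: infinite_finite_induct) (auto simp: circle_exp_add)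

lemma circle_exp_inj: "circle_exp c = circle_exp d \<longleftrightarrow> c = d"
proof
  assume *: "circle_exp c = circle_exp d"
  obtain s t where st: "c = to_circle s" "d = to_circle t"
    using to_circle_surj by meson
  have "cis (2 * pi * s) = cis (2 * pi * t)"
    using * by (simp add: st circle_exp.abs_eq)
  then have "sin (2 * pi * s) = sin (2 * pi * t) \<and> cos (2 * pi * s) = cos (2 * pi * t)"
    by (simp add: complex_eq_iff)
  then obtain n :: int where "2 * pi * s = 2 * pi * t + 2 * pi * n"
    using sin_cos_eq_iff by metis
  then have "(2 * pi) * s = (2 * pi) * (t + n)"
    by (simp add: distrib_left)
  then have "s - t = n"
    by (subst (asm) mult_cancel_left) auto
  then show "c = d"
    by (simp add: st to_circle_eq_iff)
qed simp

lemma circle_exp_surj: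
  assumes "norm z = 1"
  obtains c where "circle_exp c = z"
proof
  have "cis (Arg z) = z"
    using assms cis_Arg[of z] by (cases "z = 0") (auto simp: sgn_div_norm)
  then show "circle_exp (to_circle (Arg z / (2 * pi))) = z"
    by (simp add: circle_exp.abs_eq)
qed

lemma continuous_on_to_circle: "continuous_on A to_circle"
  by (rule continuous_on_subset[of UNIV])
     (auto simp: continuous_on_open_vimage open_circle_def)

lemma compact_UNIV_circle: "compact (UNIV :: circle set)"
proof -
  have "c \<in> to_circle ` {0..1}" for c
  proof -
    obtain s where s: "c = to_circle s"
      using to_circle_surj by blast
    have "to_circle s = to_circle (frac s)"
      by (simp add: to_circle_eq_iff frac_def)
    moreover have "frac s \<in> {0..1}"
      using frac_lt_1[of s] by (simp add: less_imp_le)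
    ultimately show ?thesis
      using s by blast
  qed
  then have "UNIV = to_circle ` {0..1}"
    by blast
  then show ?thesis
    by (metis compact_Icc compact_continuous_image continuous_on_to_circle)
qed

lemma continuous_circle_exp: "continuous_on UNIV circle_exp"
proof -
  have "continuous_on UNIV (circle_exp \<circ> to_circle)"
    by (simp add: o_def circle_exp.abs_eq) (intro continuous_intros)
  then have "open ((\<lambda>t. circle_exp (to_circle t)) -` U)" if "open U" for U
    using that by (simp add: continuous_on_open_vimage o_def)
  then show ?thesis
    by (simp add: continuous_on_open_vimage open_circle_def vimage_comp o_def)
qed

lemma tendsto_circle_exp: "(f \<longlongrightarrow> c) F \<Longrightarrow> ((\<lambda>x. circle_exp (f x)) \<longlongrightarrow> circle_exp c) F"
  using continuous_circle_exp by (rule continuous_on_tendsto_compose) auto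

lemma circle_exp_inverse_exists: "\<exists>g. homeomorphism UNIV (range circle_exp) circle_exp g"
  by (rule homeomorphism_compact)
     (auto simp: compact_UNIV_circle continuous_circle_exp circle_exp_inj inj_on_def)

text \<open>The circle carries the quotient topology of the reals; since it is compact and
  \<open>circle_exp\<close> is injective, this is also the topology pulled back from the complex
  plane. Later limits are decided by complex estimates through this equivalence.\<close>

lemma tendsto_circle_exp_iff:
  "((\<lambda>x. circle_exp (f x)) \<longlongrightarrow> circle_exp c) F \<longleftrightarrow> (f \<longlongrightarrow> c) F"
proof
  obtain g where g: "homeomorphism UNIV (range circle_exp) circle_exp g"
    using circle_exp_inverse_exists by blast
  then have gf: "g (circle_exp c) = c" for c
    by (simp add: homeomorphism_def)
  assume *: "((\<lambda>x. circle_exp (f x)) \<longlongrightarrow> circle_exp c) F"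
  have "continuous_on (range circle_exp) g"
    using g by (simp add: homeomorphism_def)
  then have "((\<lambda>x. g (circle_exp (f x))) \<longlongrightarrow> g (circle_exp c)) F"
    using * by (rule continuous_on_tendsto_compose) auto
  then show "(f \<longlongrightarrow> c) F"
    by (simp add: gf)
qed (rule tendsto_circle_exp)

lemma continuous_on_circle_exp_iff:
  "continuous_on A (\<lambda>x. circle_exp (f x)) \<longleftrightarrow> continuous_on A f"
  by (simp add: continuous_on_def tendsto_circle_exp_iff)

text \<open>The open right half circle contains no nontrivial subgroup: while the powers stay there,
  each squaring at least doubles the defect \<open>1 - Re z\<close>, by
  \<open>1 - Re (w\<^sup>2) = 2 * (1 - Re w) * (1 + Re w)\<close>, whereas the defect must stay
  below 1.\<close>

lemma power_Re_nonpos: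
  assumes "norm z = 1" "z \<noteq> 1"
  obtains j :: nat where "Re (z ^ j) \<le> 0"
proof -
  have "\<exists>j. Re (z ^ j) \<le> 0"
  proof (rule ccontr)
    assume "\<not> ?thesis"
    then have pos: "Re (z ^ j) > 0" for j
      by (meson not_le)
    have grow: "1 - Re (z ^ (2 ^ n)) \<ge> 2 ^ n * (1 - Re z)" for n
    proof (induction n)
      case (Suc n)
      define w where "w = z ^ (2 ^ n)"
      have "norm w = 1"
        by (simp add: w_def norm_power assms)
      then have "(Re w)\<^sup>2 + (Im w)\<^sup>2 = 1"
        by (simp add: norm_complex_def)
      then have "1 - Re (w\<^sup>2) = 2 * (1 - Re w) * (1 + Re w)"
        by (simp add: power2_eq_square algebra_simps)
      moreover have "0 \<le> 1 - Re w"
        using \<open>norm w = 1\<close> complex_Re_le_cmod[of w] by simp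
      moreover have "Re w \<ge> 0"
        using pos[of "2 ^ n"] by (simp add: w_def)
      ultimately have "1 - Re (w\<^sup>2) \<ge> 2 * (1 - Re w)"
        using mult_left_mono[of 1 "1 + Re w" "2 * (1 - Re w)"] by simp
      moreover have "w\<^sup>2 = z ^ (2 ^ Suc n)"
        by (simp add: w_def power_mult[symmetric] mult.commute)
      ultimately show ?case
        using Suc by (simp add: w_def)
    qed simp
    have "Re z < 1"
    proof -
      have "Re z \<noteq> 1"
      proof
        assume "Re z = 1"
        then have "Im z = 0"
          using assms(1) by (simp add: norm_complex_def)
        then show False
          using \<open>Re z = 1\<close> assms(2) by (simp add: complex_eq_iff)
      qed
      then show ?thesis
        using complex_Re_le_cmod[of z] assms(1) by simp
    qed
    then obtain n :: nat where "1 / (1 - Re z) < 2 ^ n"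
      using real_arch_pow[of 2 "1 / (1 - Re z)"] by auto
    then have "1 < 2 ^ n * (1 - Re z)"
      using \<open>Re z < 1\<close> by (simp add: field_simps)
    with grow[of n] pos[of "2 ^ n"] show False
      by linarith
  qed
  with that show thesis by blast
qed

text \<open>Tychonoff's theorem for the function type, whose topology is that of pointwise
  convergence.\<close>

lemma compact_fun:
  fixes K :: "'b::topological_space set"
  assumes "compact K"
  shows "compact {f :: 'a \<Rightarrow> 'b. \<forall>x. f x \<in> K}"
proof -
  have "compactin (product_topology (\<lambda>_. euclidean) UNIV) (PiE (UNIV :: 'a set) (\<lambda>_. K))"
    using assms by (subst compactin_PiE) simp
  moreover have "PiE (UNIV :: 'a set) (\<lambda>_. K) = {f. \<forall>x. f x \<in> K}"
    by auto
  ultimately show ?thesis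
    by (simp add: euclidean_product_topology)
qed

lemma tendsto_fun_nhds:
  fixes g :: "'a \<Rightarrow> 'b::topological_space"
  shows "((\<lambda>\<phi>. \<phi> x) \<longlongrightarrow> g x) (nhds g)"
  by (rule continuous_on_tendsto_compose[OF continuous_on_product_coordinates filterlim_ident]) auto

subsection \<open>The Haar functional\<close>

lemma compact_translates_cover:
  fixes U :: "'a::{topological_ab_group_add, t2_space} set"
  assumes "compact (UNIV :: 'a set)" "open U" "u \<in> U"
  obtains S :: "'a list" where "S \<noteq> []" "\<And>x. \<exists>a\<in>set S. x + a \<in> U"
proof -
  have opn: "open ((\<lambda>x. x + a) -` U)" for a :: 'a
    by (intro open_vimage \<open>open U\<close> continuous_intros)
  have "\<exists>D\<subseteq>UNIV. finite D \<and> (UNIV :: 'a set) \<subseteq> (\<Union>a\<in>D. (\<lambda>x. x + a) -` U)"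
  proof (rule compactE_image[OF assms(1), of UNIV "\<lambda>a. (\<lambda>x. x + a) -` U"])
    show "UNIV \<subseteq> (\<Union>a. (\<lambda>x. x + a) -` U)"
    proof
      fix x
      have "x + (u - x) \<in> U"
        using \<open>u \<in> U\<close> by simp
      then show "x \<in> (\<Union>a. (\<lambda>x. x + a) -` U)"
        by blast
    qed
  qed (use opn in auto)
  then obtain D where D: "finite D" "UNIV \<subseteq> (\<Union>a\<in>D. (\<lambda>x. x + a) -` U)"
    by blast
  obtain S where S: "set S = D"
    using finite_list[OF D(1)] by blast
  have "\<exists>a\<in>set S. x + a \<in> U" for x
    using D(2) S by blast
  moreover from this have "S \<noteq> []"
    by fastforce
  ultimately show thesis
    using that by blast
qed

text \<open>A tube argument: the open set \<open>W\<close> of good pairs contains all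
  \<open>(x, 0)\<close>, and finitely many boxes inside \<open>W\<close> cover them.\<close>

lemma compact_group_uniformly_continuous:
  fixes f :: "'a::{topological_ab_group_add, t2_space} \<Rightarrow> 'b::metric_space"
  assumes "compact (UNIV :: 'a set)" "continuous_on UNIV f" "\<epsilon> > 0"
  obtains U where "open U" "0 \<in> U" "\<And>x u. u \<in> U \<Longrightarrow> dist (f (x + u)) (f x) < \<epsilon>"
proof -
  define W where "W = {p. dist (f (fst p + snd p)) (f (fst p)) < \<epsilon>}"
  have "continuous_on UNIV (\<lambda>p. dist (f (fst p + snd p)) (f (fst p)))"
    by (intro continuous_on_dist continuous_on_compose2[OF assms(2)] continuous_intros) auto
  then have "open W"
    unfolding W_def by (rule open_Collect_less) (rule continuous_on_const)
  have "\<exists>A B. open A \<and> open B \<and> x \<in> A \<and> 0 \<in> B \<and> A \<times> B \<subseteq> W" for x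
  proof -
    have "(x, 0) \<in> W"
      using \<open>\<epsilon> > 0\<close> by (simp add: W_def)
    then show ?thesis
      using open_prod_elim[OF \<open>open W\<close>] by (metis mem_Sigma_iff)
  qed
  then obtain A B where AB: "\<And>x. open (A x)" "\<And>x. open (B x)" "\<And>x. x \<in> A x"
      "\<And>x. 0 \<in> B x" "\<And>x. A x \<times> B x \<subseteq> W"
    by metis
  obtain D where D: "finite D" "UNIV \<subseteq> (\<Union>x\<in>D. A x)"
    using compactE_image[OF assms(1), of UNIV A] AB(1,3) by (metis UNIV_I UN_I subsetI)
  show thesis
  proof
    show "open (\<Inter>x\<in>D. B x)"
      using D(1) AB(2) by blast
    show "0 \<in> (\<Inter>x\<in>D. B x)"
      using AB(4) by blast
    fix x u assume u: "u \<in> (\<Inter>x\<in>D. B x)"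
    obtain y where "y \<in> D" "x \<in> A y"
      using D(2) by blast
    then have "(x, u) \<in> W"
      using AB(5) u by blast
    then show "dist (f (x + u)) (f x) < \<epsilon>"
      by (simp add: W_def)
  qed
qed

text \<open>Lists instead of sets of translations: repetitions act as rational weights, and an
  average of averages is again such an average, taken over \<open>list_sums\<close>.\<close>

definition translate_avg :: "'a::ab_group_add list \<Rightarrow> ('a \<Rightarrow> real) \<Rightarrow> 'a \<Rightarrow> real"
  where "translate_avg S f x = (\<Sum>s\<leftarrow>S. f (x + s)) / real (length S)"

text \<open>Von Neumann's description of the invariant mean: a constant that finite averages of
  translates approach uniformly. It gives the Haar integral of continuous functions without a
  measure.\<close>

definition has_mean :: "('a::ab_group_add \<Rightarrow> real) \<Rightarrow> real \<Rightarrow> bool"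
  where "has_mean f c \<longleftrightarrow> (\<forall>\<epsilon>>0. \<exists>S. S \<noteq> [] \<and> (\<forall>x. \<bar>translate_avg S f x - c\<bar> \<le> \<epsilon>))"

definition haar :: "('a::ab_group_add \<Rightarrow> real) \<Rightarrow> real"
  where "haar f = (THE c. has_mean f c)"

lemma has_meanE:
  assumes "has_mean f c" "\<epsilon> > 0"
  obtains S where "S \<noteq> []" "\<And>x. \<bar>translate_avg S f x - c\<bar> \<le> \<epsilon>"
  using assms unfolding has_mean_def by blast

lemma translate_avg_mono:
  assumes "\<And>x. f x \<le> g x"
  shows "translate_avg S f x \<le> translate_avg S g x"
  unfolding translate_avg_def using assms by (intro divide_right_mono sum_list_mono) auto

lemma translate_avg_const: "S \<noteq> [] \<Longrightarrow> translate_avg S (\<lambda>_. c) x = c"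
  by (simp add: translate_avg_def sum_list_triv)

lemma translate_avg_add:
  "translate_avg S (\<lambda>x. f x + g x) x = translate_avg S f x + translate_avg S g x"
  by (simp add: translate_avg_def sum_list_addf add_divide_distrib)

lemma translate_avg_cmult: "translate_avg S (\<lambda>x. c * f x) x = c * translate_avg S f x"
  by (simp add: translate_avg_def sum_list_const_mult)

lemma translate_avg_close:
  assumes "S \<noteq> []" "\<And>x. \<bar>f x - c\<bar> \<le> \<epsilon>"
  shows "\<bar>translate_avg S f x - c\<bar> \<le> \<epsilon>"
proof -
  have "f x \<le> c + \<epsilon>" "c - \<epsilon> \<le> f x" for x
    using assms(2)[of x] by linarith+
  then have "translate_avg S f x \<le> translate_avg S (\<lambda>_. c + \<epsilon>) x"
    "translate_avg S (\<lambda>_. c - \<epsilon>) x \<le> translate_avg S f x"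
    by (auto intro: translate_avg_mono)
  then show ?thesis
    by (simp add: translate_avg_const[OF assms(1)])
qed

definition list_sums :: "'a::ab_group_add list \<Rightarrow> 'a list \<Rightarrow> 'a list"
  where "list_sums S T = concat (map (\<lambda>s. map (\<lambda>t. s + t) T) S)"

lemma list_sums_nonempty: "S \<noteq> [] \<Longrightarrow> T \<noteq> [] \<Longrightarrow> list_sums S T \<noteq> []"
  unfolding list_sums_def by (cases S) auto

lemma length_list_sums: "length (list_sums S T) = length S * length T"
  unfolding list_sums_def by (induction S) auto

lemma translate_avg_list_sums:
  fixes f :: "'a::ab_group_add \<Rightarrow> real"
  shows "translate_avg S (translate_avg T f) = translate_avg (list_sums S T) f"
proof -
  have "(\<Sum>r\<leftarrow>list_sums S T. f (x + r)) = (\<Sum>s\<leftarrow>S. \<Sum>t\<leftarrow>T. f (x + s + t))" for x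
    unfolding list_sums_def by (induction S) (auto simp: o_def add.assoc)
  then show ?thesis
    by (simp add: translate_avg_def fun_eq_iff length_list_sums divide_inverse sum_list_mult_const)
qed

lemma translate_avg_commute:
  fixes f :: "'a::ab_group_add \<Rightarrow> real"
  shows "translate_avg S (translate_avg T f) = translate_avg T (translate_avg S f)"
proof -
  have "(\<Sum>s\<leftarrow>S. \<Sum>t\<leftarrow>T. f (x + s + t)) = (\<Sum>t\<leftarrow>T. \<Sum>s\<leftarrow>S. f (x + t + s))" for x
    by (induction S) (auto simp: sum_list_addf ac_simps)
  then show ?thesis
    by (simp add: translate_avg_def fun_eq_iff divide_inverse sum_list_mult_const)
qed

text \<open>Averages over \<open>S\<close> and \<open>T\<close> commute because the group is
  abelian. Their composite is an average of a function close to \<open>c\<close> and also of one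
  close to \<open>d\<close>.\<close>

lemma has_mean_unique:
  assumes "has_mean f c" "has_mean f d"
  shows "c = d"
proof (rule ccontr)
  assume "c \<noteq> d"
  define \<epsilon> where "\<epsilon> = \<bar>c - d\<bar> / 4"
  have "\<epsilon> > 0"
    using \<open>c \<noteq> d\<close> by (simp add: \<epsilon>_def)
  obtain S where S: "S \<noteq> []" "\<And>x. \<bar>translate_avg S f x - c\<bar> \<le> \<epsilon>"
    using has_meanE[OF assms(1) \<open>\<epsilon> > 0\<close>] by blast
  obtain T where T: "T \<noteq> []" "\<And>x. \<bar>translate_avg T f x - d\<bar> \<le> \<epsilon>"
    using has_meanE[OF assms(2) \<open>\<epsilon> > 0\<close>] by blast
  define R where "R = list_sums S T"
  have R: "translate_avg S (translate_avg T f) = translate_avg R f"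
    "translate_avg T (translate_avg S f) = translate_avg R f"
    unfolding R_def using translate_avg_list_sums[of S T f] translate_avg_commute[of S T f]
    by simp_all
  have "\<bar>translate_avg R f 0 - c\<bar> \<le> \<epsilon>" "\<bar>translate_avg R f 0 - d\<bar> \<le> \<epsilon>"
    using translate_avg_close[OF T(1), of "translate_avg S f" c \<epsilon> 0, OF S(2)]
      translate_avg_close[OF S(1), of "translate_avg T f" d \<epsilon> 0, OF T(2)] R
    by simp_all
  moreover have "\<bar>c - d\<bar> = 4 * \<epsilon>"
    by (simp add: \<epsilon>_def)
  ultimately show False
    using \<open>\<epsilon> > 0\<close> by linarith
qed

lemma haar_eqI: "has_mean f c \<Longrightarrow> haar f = c"
  unfolding haar_def using has_mean_unique by blast

lemma has_mean_const: "has_mean (\<lambda>_. c) c"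
  unfolding has_mean_def
  by (intro allI impI exI[of _ "[0]"]) (simp add: translate_avg_const)

lemma has_mean_cmult:
  assumes "has_mean f c"
  shows "has_mean (\<lambda>x. k * f x) (k * c)"
  unfolding has_mean_def
proof (intro allI impI)
  fix \<epsilon> :: real assume "\<epsilon> > 0"
  then have "\<epsilon> / (\<bar>k\<bar> + 1) > 0"
    by simp
  then obtain S where S: "S \<noteq> []" "\<And>x. \<bar>translate_avg S f x - c\<bar> \<le> \<epsilon> / (\<bar>k\<bar> + 1)"
    using has_meanE[OF assms] by blast
  have "\<bar>translate_avg S (\<lambda>x. k * f x) x - k * c\<bar> \<le> \<epsilon>" for x
  proof -
    have "\<bar>translate_avg S (\<lambda>x. k * f x) x - k * c\<bar> = \<bar>k\<bar> * \<bar>translate_avg S f x - c\<bar>"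
      by (simp add: translate_avg_cmult right_diff_distrib[symmetric] abs_mult)
    also have "\<dots> \<le> (\<bar>k\<bar> + 1) * (\<epsilon> / (\<bar>k\<bar> + 1))"
      using S(2)[of x] by (intro mult_mono) auto
    finally show ?thesis
      by simp
  qed
  with S(1) show "\<exists>S. S \<noteq> [] \<and> (\<forall>x. \<bar>translate_avg S (\<lambda>x. k * f x) x - k * c\<bar> \<le> \<epsilon>)"
    by blast
qed

text \<open>One list must serve both functions: the composite of their lists does, since averaging
  once more never spoils closeness to a constant.\<close>

lemma has_mean_add:
  assumes "has_mean f c" "has_mean g d"
  shows "has_mean (\<lambda>x. f x + g x) (c + d)"
  unfolding has_mean_def
proof (intro allI impI)
  fix \<epsilon> :: real assume "\<epsilon> > 0"
  then have "\<epsilon> / 2 > 0"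
    by simp
  obtain S where S: "S \<noteq> []" "\<And>x. \<bar>translate_avg S f x - c\<bar> \<le> \<epsilon> / 2"
    using has_meanE[OF assms(1) \<open>\<epsilon> / 2 > 0\<close>] by blast
  obtain T where T: "T \<noteq> []" "\<And>x. \<bar>translate_avg T g x - d\<bar> \<le> \<epsilon> / 2"
    using has_meanE[OF assms(2) \<open>\<epsilon> / 2 > 0\<close>] by blast
  define R where "R = list_sums S T"
  have R: "R \<noteq> []" "translate_avg S (translate_avg T g) = translate_avg R g"
    "translate_avg T (translate_avg S f) = translate_avg R f"
    unfolding R_def
    using list_sums_nonempty[OF S(1) T(1)] translate_avg_list_sums[of S T]
      translate_avg_commute[of S T f] by simp_all
  have *: "\<bar>translate_avg R f x - c\<bar> \<le> \<epsilon> / 2" "\<bar>translate_avg R g x - d\<bar> \<le> \<epsilon> / 2" for x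
    using translate_avg_close[OF T(1), of "translate_avg S f" c "\<epsilon> / 2" x, OF S(2)]
      translate_avg_close[OF S(1), of "translate_avg T g" d "\<epsilon> / 2" x, OF T(2)] R(2,3)
    by simp_all
  have "\<bar>translate_avg R (\<lambda>x. f x + g x) x - (c + d)\<bar> \<le> \<epsilon>" for x
    using *[of x] unfolding translate_avg_add by linarith
  with R(1) show "\<exists>S. S \<noteq> [] \<and> (\<forall>x. \<bar>translate_avg S (\<lambda>x. f x + g x) x - (c + d)\<bar> \<le> \<epsilon>)"
    by blast
qed

lemma has_mean_translate:
  assumes "has_mean f c"
  shows "has_mean (\<lambda>x. f (x + a)) c"
proof -
  have *: "translate_avg S (\<lambda>x. f (x + a)) x = translate_avg S f (x + a)" for S x
    by (simp add: translate_avg_def ac_simps)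
  show ?thesis
    unfolding has_mean_def
  proof (intro allI impI)
    fix \<epsilon> :: real assume "\<epsilon> > 0"
    then obtain S where S: "S \<noteq> []" "\<And>x. \<bar>translate_avg S f x - c\<bar> \<le> \<epsilon>"
      using has_meanE[OF assms] by blast
    then show "\<exists>S. S \<noteq> [] \<and> (\<forall>x. \<bar>translate_avg S (\<lambda>x. f (x + a)) x - c\<bar> \<le> \<epsilon>)"
      by (intro exI[of _ S]) (simp add: *)
  qed
qed

lemma has_mean_nonneg:
  assumes "has_mean f c" "\<And>x. 0 \<le> f x"
  shows "0 \<le> c"
proof (rule ccontr)
  assume "\<not> 0 \<le> c"
  then have "- c / 2 > 0"
    by simp
  then obtain S where "\<bar>translate_avg S f 0 - c\<bar> \<le> - c / 2"
    using has_meanE[OF assms(1)] by blast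
  moreover have "0 \<le> translate_avg S f 0"
    unfolding translate_avg_def using assms(2) by (intro divide_nonneg_nonneg sum_list_nonneg) auto
  ultimately show False
    using \<open>- c / 2 > 0\<close> by linarith
qed

section \<open>The invariant mean on a compact abelian group\<close>

locale compact_group =
  fixes G_type :: "'a::{topological_ab_group_add, t2_space} itself"
  assumes compact_UNIV: "compact (UNIV :: 'a set)"
begin

lemma bounded_continuous:
  fixes f :: "'a \<Rightarrow> 'b::metric_space"
  assumes "continuous_on UNIV f"
  shows "bounded (range f)"
  using compact_continuous_image[OF assms compact_UNIV] by (rule compact_imp_bounded)

text \<open>The candidate \<open>m\<close> is the infimum of the suprema that averaging can reach.
  An average whose supremum is nearly \<open>m\<close> must be nearly constant: a further average
  would spread a deep dip over the whole group and push the supremum below \<open>m\<close>.\<close>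

lemma has_mean_exists:
  fixes f :: "'a \<Rightarrow> real"
  assumes "continuous_on UNIV f"
  shows "\<exists>c. has_mean f c"
proof -
  obtain B where B: "\<And>x. \<bar>f x\<bar> \<le> B"
    using bounded_continuous[OF assms] by (auto simp: bounded_iff)
  have avgB: "\<bar>translate_avg S f x\<bar> \<le> B" if "S \<noteq> []" for S x
    using translate_avg_close[of S f 0 B x] that B by simp
  define m where "m = (INF S\<in>{S. S \<noteq> []}. SUP x. translate_avg S f x)"
  have bdd: "bdd_above (range (translate_avg S f))" if "S \<noteq> []" for S
    using avgB[OF that] by (intro bdd_aboveI2[of _ _ B]) (simp add: abs_le_iff)
  have sup_ge: "- B \<le> (SUP x. translate_avg S f x)" if "S \<noteq> []" for S
    using avgB[OF that, of 0] cSUP_upper[OF UNIV_I bdd[OF that], of 0] by linarith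
  have bddI: "bdd_below ((\<lambda>S. SUP x. translate_avg S f x) ` {S. S \<noteq> []})"
    using sup_ge by (intro bdd_belowI2[of _ "- B"]) auto
  have m_le: "m \<le> c" if "S \<noteq> []" "\<And>x. translate_avg S f x \<le> c" for S c
    unfolding m_def using that
    by (intro cINF_lower2[of _ _ S] bddI cSUP_least) auto
  have m_approx: "\<exists>S. S \<noteq> [] \<and> (\<forall>x. translate_avg S f x \<le> m + \<delta>)" if "\<delta> > 0" for \<delta>
  proof -
    let ?X = "(\<lambda>S. SUP x. translate_avg S f x) ` {S :: 'a list. S \<noteq> []}"
    have "?X \<noteq> {}"
      by blast
    moreover have "Inf ?X < m + \<delta>"
      using that by (simp add: m_def)
    ultimately have "\<exists>y\<in>?X. y < m + \<delta>"
      by (rule cInf_lessD)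
    then obtain S where S: "S \<noteq> []" "(SUP x. translate_avg S f x) < m + \<delta>"
      by blast
    then have "translate_avg S f x \<le> m + \<delta>" for x
      using cSUP_upper[OF _ bdd[OF S(1)], of x] by auto
    with S(1) show ?thesis
      by blast
  qed
  have "has_mean f m"
    unfolding has_mean_def
  proof (intro allI impI)
    fix \<epsilon>' :: real assume "\<epsilon>' > 0"
    define \<epsilon> where "\<epsilon> = \<epsilon>' / 2"
    have "\<epsilon> > 0"
      using \<open>\<epsilon>' > 0\<close> by (simp add: \<epsilon>_def)
    obtain U where U: "open U" "0 \<in> U" "\<And>x u. u \<in> U \<Longrightarrow> dist (f (x + u)) (f x) < \<epsilon>"
      using compact_group_uniformly_continuous[OF compact_UNIV assms \<open>\<epsilon> > 0\<close>] by blast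
    obtain A where A: "A \<noteq> []" "\<And>x. \<exists>a\<in>set A. x + a \<in> U"
      using compact_translates_cover[OF compact_UNIV U(1,2)] by blast
    define n where "n = real (length A)"
    have "n \<ge> 1"
      using A(1) by (cases A) (auto simp: n_def)
    \<comment> \<open>One of \<open>n\<close> terms is low by \<open>\<epsilon>\<close>, the others
      are high by at most \<open>\<delta>\<close>; this choice makes
      \<open>n * (m + \<delta>) - \<epsilon> = n * (m - \<delta>)\<close>.\<close>
    define \<delta> where "\<delta> = \<epsilon> / (2 * n)"
    have "\<delta> > 0"
      using \<open>\<epsilon> > 0\<close> \<open>n \<ge> 1\<close> by (simp add: \<delta>_def)
    then obtain S where S: "S \<noteq> []" "\<And>x. translate_avg S f x \<le> m + \<delta>"
      using m_approx by blast
    define \<phi> where "\<phi> = translate_avg S f"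
    have \<phi>U: "\<phi> (x + u) \<le> \<phi> x + \<epsilon>" if "u \<in> U" for x u
    proof -
      have "f (y + u) \<le> f y + \<epsilon>" for y
        using U(3)[OF that, of y] unfolding dist_real_def by linarith
      then have "translate_avg S (\<lambda>y. f (y + u)) x \<le> translate_avg S (\<lambda>y. f y + \<epsilon>) x"
        by (rule translate_avg_mono)
      also have "translate_avg S (\<lambda>y. f (y + u)) x = \<phi> (x + u)"
        by (simp add: \<phi>_def translate_avg_def ac_simps)
      finally show ?thesis
        by (simp add: translate_avg_add translate_avg_const[OF S(1)] \<phi>_def)
    qed
    have low: "\<phi> y \<ge> m - 2 * \<epsilon>" for y
    proof (rule ccontr)
      assume "\<not> ?thesis"
      then have y: "\<phi> y < m - 2 * \<epsilon>"
        by simp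
      have "translate_avg A \<phi> x \<le> m - \<delta>" for x
      proof -
        \<comment> \<open>This \<open>a\<close> places \<open>x + a\<close> next to the dip
          \<open>y\<close>, so at least one term of the average over \<open>A\<close> is
          low.\<close>
        obtain a where a: "a \<in> set A" "x - y + a \<in> U"
          using A(2) by blast
        have "\<phi> (y + (x - y + a)) \<le> \<phi> y + \<epsilon>"
          using \<phi>U a(2) by blast
        then have small: "\<phi> (x + a) \<le> m - \<epsilon>"
          using y by (simp add: algebra_simps)
        obtain A1 A2 where split: "A = A1 @ a # A2"
          using a(1) by (meson split_list)
        have bound: "(\<Sum>b\<leftarrow>L. \<phi> (x + b)) \<le> real (length L) * (m + \<delta>)" for L
          using sum_list_mono[of L "\<lambda>b. \<phi> (x + b)" "\<lambda>_. m + \<delta>"] S(2)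
          by (simp add: \<phi>_def sum_list_triv)
        have "(\<Sum>b\<leftarrow>A. \<phi> (x + b)) \<le> real (length A1) * (m + \<delta>) + (m - \<epsilon>) + real (length A2) * (m + \<delta>)"
          unfolding split using bound[of A1] bound[of A2] small by simp
        also have "\<dots> = (n - 1) * (m + \<delta>) + (m - \<epsilon>)"
          by (simp add: n_def split algebra_simps)
        also have "\<dots> \<le> n * (m + \<delta>) - \<epsilon>"
          using \<open>\<delta> > 0\<close> by (simp add: algebra_simps)
        also have "\<dots> = n * (m - \<delta>)"
          using \<open>n \<ge> 1\<close> by (simp add: \<delta>_def field_simps)
        finally show ?thesis
          using \<open>n \<ge> 1\<close> by (simp add: translate_avg_def n_def[symmetric] divide_le_eq mult.commute)
      qed
      then have "m \<le> m - \<delta>"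
        using m_le[OF list_sums_nonempty[OF A(1) S(1)]]
        by (simp add: \<phi>_def translate_avg_list_sums)
      with \<open>\<delta> > 0\<close> show False
        by simp
    qed
    have "\<delta> \<le> \<epsilon>"
      using \<open>n \<ge> 1\<close> \<open>\<epsilon> > 0\<close> by (simp add: \<delta>_def field_simps)
    have "\<bar>translate_avg S f x - m\<bar> \<le> \<epsilon>'" for x
      using low[of x] S(2)[of x] \<open>\<delta> \<le> \<epsilon>\<close> \<open>\<epsilon> > 0\<close> unfolding \<phi>_def \<epsilon>_def by linarith
    with S(1) show "\<exists>S. S \<noteq> [] \<and> (\<forall>x. \<bar>translate_avg S f x - m\<bar> \<le> \<epsilon>')"
      by blast
  qed
  then show ?thesis
    by blast
qed

lemma has_mean_haar:
  fixes f :: "'a \<Rightarrow> real"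
  assumes "continuous_on UNIV f"
  shows "has_mean f (haar f)"
proof -
  obtain c where "has_mean f c"
    using has_mean_exists[OF assms] ..
  then show ?thesis
    using haar_eqI[of f c] by simp
qed

lemma haar_add:
  fixes f g :: "'a \<Rightarrow> real"
  assumes "continuous_on UNIV f" "continuous_on UNIV g"
  shows "haar (\<lambda>x. f x + g x) = haar f + haar g"
  using has_mean_add[OF assms[THEN has_mean_haar]] by (rule haar_eqI)

lemma haar_cmult:
  fixes f :: "'a \<Rightarrow> real"
  assumes "continuous_on UNIV f"
  shows "haar (\<lambda>x. c * f x) = c * haar f"
  using has_mean_cmult[OF assms[THEN has_mean_haar]] by (rule haar_eqI)

lemma haar_translate:
  fixes f :: "'a \<Rightarrow> real"
  assumes "continuous_on UNIV f"
  shows "haar (\<lambda>x. f (x + a)) = haar f"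
  using has_mean_translate[OF assms[THEN has_mean_haar]] by (rule haar_eqI)

lemma haar_nonneg:
  fixes f :: "'a \<Rightarrow> real"
  assumes "continuous_on UNIV f" "\<And>x. 0 \<le> f x"
  shows "0 \<le> haar f"
  using has_mean_nonneg[OF has_mean_haar[OF assms(1)] assms(2)] .

lemma haar_const: "haar (\<lambda>_::'a. c) = c"
  using has_mean_const by (rule haar_eqI)

lemma haar_diff:
  fixes f g :: "'a \<Rightarrow> real"
  assumes "continuous_on UNIV f" "continuous_on UNIV g"
  shows "haar (\<lambda>x. f x - g x) = haar f - haar g"
proof -
  have "haar (\<lambda>x. f x + (- 1) * g x) = haar f + (- 1) * haar g"
    using haar_add[OF assms(1) continuous_on_mult_left[OF assms(2)], of "- 1"]
      haar_cmult[OF assms(2), of "- 1"] by simp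
  then show ?thesis
    by simp
qed

lemma haar_mono:
  fixes f g :: "'a \<Rightarrow> real"
  assumes "continuous_on UNIV f" "continuous_on UNIV g" "\<And>x. f x \<le> g x"
  shows "haar f \<le> haar g"
proof -
  have "0 \<le> haar (\<lambda>x. g x - f x)"
    by (rule haar_nonneg[OF continuous_on_diff[OF assms(2,1)]]) (simp add: assms(3))
  then show ?thesis
    by (simp add: haar_diff[OF assms(2,1)])
qed

lemma haar_sum:
  fixes f :: "'i \<Rightarrow> 'a \<Rightarrow> real"
  assumes "\<And>i. i \<in> I \<Longrightarrow> continuous_on UNIV (f i)"
  shows "haar (\<lambda>x. \<Sum>i\<in>I. f i x) = (\<Sum>i\<in>I. haar (f i))"
  using assms
proof (induction I rule: infinite_finite_induct)
  case (insert i I)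
  then show ?case
    by (simp add: haar_add[OF _ continuous_on_sum])
qed (simp_all add: haar_const)

lemma haar_abs_le:
  fixes f :: "'a \<Rightarrow> real"
  assumes "continuous_on UNIV f" "\<And>x. \<bar>f x\<bar> \<le> c"
  shows "\<bar>haar f\<bar> \<le> c"
proof -
  have le: "f x \<le> c" "- c \<le> f x" for x
    using assms(2)[of x] by linarith+
  have "haar f \<le> haar (\<lambda>_::'a. c)" "haar (\<lambda>_::'a. - c) \<le> haar f"
    by (rule haar_mono[OF assms(1) continuous_on_const le(1)]
        haar_mono[OF continuous_on_const assms(1) le(2)])+
  then show ?thesis
    by (simp add: haar_const)
qed

text \<open>Finitely many translates of the open set where \<open>f\<close> exceeds
  \<open>f u / 2\<close> cover the group, so the sum of the corresponding translates of
  \<open>f\<close> is at least \<open>f u / 2\<close> everywhere; its mean is a multiple of that of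
  \<open>f\<close>.\<close>

lemma haar_pos:
  fixes f :: "'a \<Rightarrow> real"
  assumes f: "continuous_on UNIV f" and nonneg: "\<And>x. 0 \<le> f x" and "0 < f u"
  shows "0 < haar f"
proof -
  have "open {x. f u / 2 < f x}"
    by (rule open_Collect_less[OF continuous_on_const f])
  moreover have "u \<in> {x. f u / 2 < f x}"
    using \<open>0 < f u\<close> by simp
  ultimately obtain A where A: "A \<noteq> []" "\<And>x. \<exists>a\<in>set A. x + a \<in> {x. f u / 2 < f x}"
    using compact_translates_cover[OF compact_UNIV] by blast
  have cont: "continuous_on UNIV (\<lambda>x. f (x + a))" for a
    by (rule continuous_on_compose2[OF f]) (auto intro: continuous_intros)
  have csum: "continuous_on UNIV (\<lambda>x. \<Sum>a\<leftarrow>L. f (x + a))" for L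
    by (induction L) (auto intro!: continuous_intros cont)
  have "haar (\<lambda>x. \<Sum>a\<leftarrow>L. f (x + a)) = real (length L) * haar f" for L
  proof (induction L)
    case (Cons a L)
    then show ?case
      using haar_add[OF cont csum, of a L] by (simp add: haar_translate[OF f] distrib_right)
  qed (simp add: haar_const)
  moreover have "f u / 2 \<le> (\<Sum>a\<leftarrow>A. f (x + a))" for x
  proof -
    obtain a where a: "a \<in> set A" "f u / 2 < f (x + a)"
      using A(2)[of x] by auto
    obtain A1 A2 where "A = A1 @ a # A2"
      using a(1) by (meson split_list)
    moreover have "0 \<le> (\<Sum>a\<leftarrow>L. f (x + a))" for L
      using nonneg by (intro sum_list_nonneg) auto
    from this[of A1] this[of A2] have "0 \<le> (\<Sum>a\<leftarrow>A1. f (x + a)) + (\<Sum>a\<leftarrow>A2. f (x + a))"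
      by simp
    ultimately show ?thesis
      using a(2) by simp
  qed
  then have "haar (\<lambda>_::'a. f u / 2) \<le> haar (\<lambda>x. \<Sum>a\<leftarrow>A. f (x + a))"
    by (rule haar_mono[OF continuous_on_const csum])
  ultimately have "0 < real (length A) * haar f"
    using \<open>0 < f u\<close> by (simp add: haar_const)
  moreover have "0 < real (length A)"
    using A(1) by simp
  ultimately show ?thesis
    by (rule zero_less_mult_pos)
qed

end

subsection \<open>Positive definite functions\<close>

text \<open>The Hermitian symmetry is required separately because only the real part of the form is
  tested; together they say that the form is real and nonnegative.\<close>

definition pos_def :: "('a::ab_group_add \<Rightarrow> complex) \<Rightarrow> bool"
  where "pos_def \<phi> \<longleftrightarrow> (\<forall>x. \<phi> (- x) = cnj (\<phi> x)) \<and>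
    (\<forall>(n::nat) z x. 0 \<le> Re (\<Sum>i<n. \<Sum>j<n. z i * cnj (z j) * \<phi> (x i - x j)))"

lemma pos_def_minus: "pos_def \<phi> \<Longrightarrow> \<phi> (- x) = cnj (\<phi> x)"
  by (simp add: pos_def_def)

text \<open>Arbitrary finite index sets are wanted because the form is tested below on families
  indexed by truth values and by pairs.\<close>

lemma pos_def_sum_nonneg:
  assumes "pos_def \<phi>" "finite I"
  shows "0 \<le> Re (\<Sum>i\<in>I. \<Sum>j\<in>I. z i * cnj (z j) * \<phi> (x i - x j))"
proof -
  obtain h where h: "bij_betw h {0..<card I} I"
    using ex_bij_betw_nat_finite[OF \<open>finite I\<close>] by blast
  then have h: "bij_betw h {..<card I} I"
    by (simp add: atLeast0LessThan)
  have "(\<Sum>i\<in>I. \<Sum>j\<in>I. z i * cnj (z j) * \<phi> (x i - x j)) =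
      (\<Sum>i<card I. \<Sum>j<card I. z (h i) * cnj (z (h j)) * \<phi> (x (h i) - x (h j)))"
    by (simp add: sum.reindex_bij_betw[OF h, symmetric])
  also have "0 \<le> Re \<dots>"
    using assms(1)[unfolded pos_def_def, THEN conjunct2, rule_format,
      of "\<lambda>i. z (h i)" "\<lambda>i. x (h i)" "card I"] .
  finally show ?thesis .
qed

lemma pos_def_norm_le:
  assumes "pos_def \<phi>"
  shows "norm (\<phi> x) \<le> Re (\<phi> 0)"
proof (cases "\<phi> x = 0")
  case True
  then show ?thesis
    using pos_def_sum_nonneg[OF assms, of "{()}" "\<lambda>_. 1" "\<lambda>_. 0"] by simp
next
  case False
  \<comment> \<open>\<open>u\<close> is the phase of \<open>\<phi> x\<close>. The coefficients
    \<open>cnj u\<close> at \<open>x\<close> and \<open>- 1\<close> at 0 turn the form into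
    \<open>2 * \<phi> 0 - 2 * norm (\<phi> x)\<close>.\<close>
  define u where "u = \<phi> x / norm (\<phi> x)"
  have u: "u * cnj u = 1" "cnj u * \<phi> x = norm (\<phi> x)"
    using False by (simp_all add: u_def complex_norm_square[symmetric] power2_eq_square mult.commute)
  have "0 \<le> Re (\<Sum>i\<in>{True, False}. \<Sum>j\<in>{True, False}. (if i then cnj u else - 1) *
      cnj (if j then cnj u else - 1) * \<phi> ((if i then x else 0) - (if j then x else 0)))"
    by (rule pos_def_sum_nonneg[OF assms]) simp
  also have "(\<Sum>i\<in>{True, False}. \<Sum>j\<in>{True, False}. (if i then cnj u else - 1) *
      cnj (if j then cnj u else - 1) * \<phi> ((if i then x else 0) - (if j then x else 0))) =
      2 * \<phi> 0 - (cnj u * \<phi> x + cnj (cnj u * \<phi> x))"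
    using u(1) by (simp add: pos_def_minus[OF assms] mult.commute)
  finally show ?thesis
    unfolding u(2) by simp
qed

lemma pos_def_scale:
  assumes "pos_def \<phi>" "0 \<le> c"
  shows "pos_def (\<lambda>x. of_real c * \<phi> x)"
proof -
  have "(\<Sum>i<n. \<Sum>j<n. z i * cnj (z j) * (of_real c * \<phi> (x i - x j))) =
      of_real c * (\<Sum>i<n. \<Sum>j<n. z i * cnj (z j) * \<phi> (x i - x j))" for n :: nat and z x
    by (simp add: sum_distrib_left mult.left_commute)
  then show ?thesis
    using assms by (simp add: pos_def_def)
qed

text \<open>On the Fourier side this multiplies the coefficient at \<open>\<xi>\<close> by \<open>(1 + Re (c * \<xi> a)) / 2\<close>.\<close>

lemma pos_def_shift:
  assumes "pos_def \<phi>" "norm c = 1"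
  shows "pos_def (\<lambda>x. (\<phi> x + (c * \<phi> (x + a) + cnj c * \<phi> (x - a)) / 2) / 2)"
  unfolding pos_def_def
proof (intro conjI allI)
  fix x
  have "\<phi> (- x + a) = cnj (\<phi> (x - a))" "\<phi> (- x - a) = cnj (\<phi> (x + a))"
  proof -
    have "- x + a = - (x - a)" "- x - a = - (x + a)"
      by simp_all
    then show "\<phi> (- x + a) = cnj (\<phi> (x - a))" "\<phi> (- x - a) = cnj (\<phi> (x + a))"
      by (simp_all only: pos_def_minus[OF assms(1)])
  qed
  then show "(\<phi> (- x) + (c * \<phi> (- x + a) + cnj c * \<phi> (- x - a)) / 2) / 2 =
      cnj ((\<phi> x + (c * \<phi> (x + a) + cnj c * \<phi> (x - a)) / 2) / 2)"
    by (simp add: pos_def_minus[OF assms(1)] add.commute)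
next
  have "c * cnj c = 1"
    using assms(2) by (simp add: complex_norm_square[symmetric])
  then have cc: "c * (cnj c * w) = w" for w
    by (simp add: mult.assoc[symmetric])
  fix n :: nat and z :: "nat \<Rightarrow> complex" and x :: "nat \<Rightarrow> 'a"
  \<comment> \<open>Each point \<open>x i\<close> is doubled: coefficient \<open>z i / 2\<close> at
    \<open>x i\<close> and \<open>c * z i / 2\<close> at \<open>x i + a\<close>. The four
    combinations of the doubled indices add up to the shifted function.\<close>
  define w where "w u = (if u then c / 2 else 1 / 2)" for u
  define y where "y u = (if u then a else 0)" for u
  have "0 \<le> Re (\<Sum>p\<in>{..<n} \<times> {True, False}. \<Sum>q\<in>{..<n} \<times> {True, False}.
      (z (fst p) * w (snd p)) * cnj (z (fst q) * w (snd q)) *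
      \<phi> ((x (fst p) + y (snd p)) - (x (fst q) + y (snd q))))"
    by (rule pos_def_sum_nonneg[OF assms(1)]) simp
  also have "(\<Sum>p\<in>{..<n} \<times> {True, False}. \<Sum>q\<in>{..<n} \<times> {True, False}.
      (z (fst p) * w (snd p)) * cnj (z (fst q) * w (snd q)) *
      \<phi> ((x (fst p) + y (snd p)) - (x (fst q) + y (snd q)))) =
    (\<Sum>i<n. \<Sum>u\<in>{True, False}. \<Sum>j<n. \<Sum>v\<in>{True, False}.
      (z i * w u) * cnj (z j * w v) * \<phi> ((x i + y u) - (x j + y v)))"
    by (simp only: sum.cartesian_product' fst_conv snd_conv)
  also have "\<dots> = (\<Sum>i<n. \<Sum>j<n. \<Sum>u\<in>{True, False}. \<Sum>v\<in>{True, False}.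
      (z i * w u) * cnj (z j * w v) * \<phi> ((x i + y u) - (x j + y v)))"
    by (intro sum.cong refl sum.swap)
  also have "\<dots> = (\<Sum>i<n. \<Sum>j<n. z i * cnj (z j) *
      ((\<phi> (x i - x j) + (c * \<phi> (x i - x j + a) + cnj c * \<phi> (x i - x j - a)) / 2) / 2))"
  proof (intro sum.cong refl)
    fix i j
    have eqs: "x i + a - x j = x i - x j + a" "x i - (x j + a) = x i - x j - a"
      by (simp_all add: algebra_simps)
    show "(\<Sum>u\<in>{True, False}. \<Sum>v\<in>{True, False}.
        (z i * w u) * cnj (z j * w v) * \<phi> ((x i + y u) - (x j + y v))) =
      z i * cnj (z j) *
      ((\<phi> (x i - x j) + (c * \<phi> (x i - x j + a) + cnj c * \<phi> (x i - x j - a)) / 2) / 2)"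
      by (simp add: w_def y_def eqs field_simps cc)
  qed
  finally show "0 \<le> Re (\<Sum>i<n. \<Sum>j<n. z i * cnj (z j) *
      ((\<phi> (x i - x j) + (c * \<phi> (x i - x j + a) + cnj c * \<phi> (x i - x j - a)) / 2) / 2))" .
qed

lemma group_continuousI:
  fixes f :: "'a::{topological_ab_group_add, t2_space} \<Rightarrow> 'b::metric_space"
  assumes "\<And>\<epsilon>. \<epsilon> > 0 \<Longrightarrow> \<exists>U. open U \<and> 0 \<in> U \<and> (\<forall>x. \<forall>u\<in>U. dist (f (x + u)) (f x) \<le> \<epsilon>)"
  shows "continuous_on UNIV f"
  unfolding continuous_on_def
proof (intro ballI tendstoI)
  fix x :: 'a and \<epsilon> :: real assume "\<epsilon> > 0"
  then have "\<epsilon> / 2 > 0"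
    by simp
  then obtain U where U: "open U" "0 \<in> U" "\<And>x u. u \<in> U \<Longrightarrow> dist (f (x + u)) (f x) \<le> \<epsilon> / 2"
    using assms[of "\<epsilon> / 2"] by auto
  have "continuous_on UNIV (\<lambda>y. y - x)"
    by (intro continuous_intros)
  then have "open ((\<lambda>y. y - x) -` U)"
    using U(1) open_vimage by blast
  moreover have "dist (f y) (f x) < \<epsilon>" if "y - x \<in> U" for y
    using U(3)[OF that, of x] \<open>\<epsilon> > 0\<close> by simp
  ultimately show "\<forall>\<^sub>F y in at x within UNIV. dist (f y) (f x) < \<epsilon>"
    using U(2) unfolding eventually_at_topological
    by (intro exI[of _ "(\<lambda>y. y - x) -` U"]) auto
qed

text \<open>By Bochner's theorem these are the Fourier transforms of probability measures on the
  dual; characters correspond to point masses, the extreme points.\<close>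

definition states :: "('a::{topological_ab_group_add, t2_space} \<Rightarrow> complex) set"
  where "states = {\<phi>. continuous_on UNIV \<phi> \<and> pos_def \<phi> \<and> \<phi> 0 = 1}"

lemma states_norm_le: "\<phi> \<in> states \<Longrightarrow> norm (\<phi> x) \<le> 1"
  using pos_def_norm_le[of \<phi> x] by (simp add: states_def)

section \<open>The real inner product given by the mean\<close>

context compact_group
begin

text \<open>\<open>\<bullet>\<close> on the complex numbers is the real inner product, so this is
  the real part of the Hermitian one. Imaginary parts are recovered by varying the unimodular factor
  \<open>c\<close> in the shifts.\<close>

definition ip :: "('a \<Rightarrow> complex) \<Rightarrow> ('a \<Rightarrow> complex) \<Rightarrow> real"
  where "ip f g = haar (\<lambda>x. f x \<bullet> g x)"

lemma continuous_shift:
  fixes f :: "'a \<Rightarrow> 'b::topological_space"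
  assumes "continuous_on UNIV f"
  shows "continuous_on UNIV (\<lambda>x. f (x + a))" "continuous_on UNIV (\<lambda>x. f (x - a))"
  by (rule continuous_on_compose2[OF assms]; auto intro: continuous_intros)+

lemma ip_self_nonneg: "continuous_on UNIV f \<Longrightarrow> 0 \<le> ip f f"
  unfolding ip_def by (rule haar_nonneg) (auto intro: continuous_intros)

lemma ip_self_eq_0:
  assumes "continuous_on UNIV f" "ip f f \<le> 0"
  shows "f x = 0"
proof (rule ccontr)
  assume "f x \<noteq> 0"
  have "0 < haar (\<lambda>x. f x \<bullet> f x)"
    by (rule haar_pos[of _ x]) (use assms(1) \<open>f x \<noteq> 0\<close> in \<open>auto intro: continuous_intros\<close>)
  with assms(2) show False
    by (simp add: ip_def)
qed

text \<open>A substitute for Cauchy-Schwarz without square roots of means: pointwise,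
  \<open>\<bar>f x \<bullet> g x\<bar>\<close> is at most \<open>(\<epsilon> / 2) * (g x \<bullet> g
  x) + (1 / (2 * \<epsilon>)) * (f x \<bullet> f x)\<close>.\<close>

lemma ip_abs_le:
  assumes f: "continuous_on UNIV f" and g: "continuous_on UNIV g" and "0 < \<epsilon>" "ip f f \<le> \<epsilon>\<^sup>2"
  shows "\<bar>ip f g\<bar> \<le> \<epsilon> * ((ip g g + 1) / 2)"
proof -
  have cont: "continuous_on UNIV (\<lambda>x. f x \<bullet> f x)" "continuous_on UNIV (\<lambda>x. g x \<bullet> g x)"
    "continuous_on UNIV (\<lambda>x. f x \<bullet> g x)"
    using f g by (auto intro: continuous_intros)
  define h where "h x = (\<epsilon> / 2) * (g x \<bullet> g x) + (1 / (2 * \<epsilon>)) * (f x \<bullet> f x)" for x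
  have conth: "continuous_on UNIV h"
    unfolding h_def by (intro continuous_intros f g)
  have bound: "\<bar>f x \<bullet> g x\<bar> \<le> h x" for x
  proof -
    have "0 \<le> (f x - \<epsilon> *\<^sub>R g x) \<bullet> (f x - \<epsilon> *\<^sub>R g x)" "0 \<le> (f x + \<epsilon> *\<^sub>R g x) \<bullet> (f x + \<epsilon> *\<^sub>R g x)"
      by simp_all
    then have "2 * \<epsilon> * (f x \<bullet> g x) \<le> f x \<bullet> f x + \<epsilon>\<^sup>2 * (g x \<bullet> g x)"
      "- (f x \<bullet> f x + \<epsilon>\<^sup>2 * (g x \<bullet> g x)) \<le> 2 * \<epsilon> * (f x \<bullet> g x)"
      by (simp_all add: inner_diff inner_add inner_commute power2_eq_square algebra_simps)
    then have "2 * \<epsilon> * \<bar>f x \<bullet> g x\<bar> \<le> f x \<bullet> f x + \<epsilon>\<^sup>2 * (g x \<bullet> g x)"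
      by (cases "0 \<le> f x \<bullet> g x") auto
    then show ?thesis
      using \<open>0 < \<epsilon>\<close> by (simp add: h_def field_simps power2_eq_square)
  qed
  have "f x \<bullet> g x \<le> h x" "- h x \<le> f x \<bullet> g x" for x
    using bound[of x] by linarith+
  then have "haar (\<lambda>x. f x \<bullet> g x) \<le> haar h" "haar (\<lambda>x. (- 1) * h x) \<le> haar (\<lambda>x. f x \<bullet> g x)"
    using haar_mono[OF cont(3) conth] haar_mono[OF continuous_on_mult_left[OF conth] cont(3), of "- 1"]
    by simp_all
  moreover have "haar h = (\<epsilon> / 2) * ip g g + (1 / (2 * \<epsilon>)) * ip f f"
    unfolding h_def ip_def
    by (simp only: haar_add[OF continuous_on_mult_left[OF cont(2)] continuous_on_mult_left[OF cont(1)]]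
        haar_cmult[OF cont(1)] haar_cmult[OF cont(2)])
  moreover have "(1 / (2 * \<epsilon>)) * ip f f \<le> \<epsilon> / 2"
    using assms(3,4) by (simp add: field_simps power2_eq_square)
  ultimately show ?thesis
    unfolding ip_def[symmetric] haar_cmult[OF conth]
    by (simp add: abs_le_iff algebra_simps)
qed

end

subsection \<open>States of almost maximal energy\<close>

context compact_group
begin

lemma ip_algebra:
  assumes f: "continuous_on UNIV f" and g: "continuous_on UNIV g" and h: "continuous_on UNIV h"
  shows "ip (\<lambda>x. f x + g x) h = ip f h + ip g h"
    and "ip (\<lambda>x. f x - g x) h = ip f h - ip g h"
    and "ip (\<lambda>x. of_real r * f x) h = r * ip f h"
    and "ip h (\<lambda>x. of_real r * f x) = r * ip h f"
    and "ip f g = ip g f"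
proof -
  have c: "continuous_on UNIV (\<lambda>x. f x \<bullet> h x)" "continuous_on UNIV (\<lambda>x. g x \<bullet> h x)"
    using f g h by (auto intro: continuous_intros)
  show "ip (\<lambda>x. f x + g x) h = ip f h + ip g h" "ip (\<lambda>x. f x - g x) h = ip f h - ip g h"
    unfolding ip_def inner_add_left inner_diff_left by (simp_all only: haar_add[OF c] haar_diff[OF c])
  have "(of_real r * z) \<bullet> w = r * (z \<bullet> w)" for z w :: complex
    by (metis inner_scaleR_left scaleR_conv_of_real)
  then show *: "ip (\<lambda>x. of_real r * f x) h = r * ip f h"
    unfolding ip_def by (simp only: haar_cmult[OF c(1)])
  show "ip f g = ip g f" for f g
    by (simp add: ip_def inner_commute)
  then show "ip h (\<lambda>x. of_real r * f x) = r * ip h f"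
    using * by metis
qed

definition energy :: "('a \<Rightarrow> complex) \<Rightarrow> ('a \<Rightarrow> complex) \<Rightarrow> real"
  where "energy g \<phi> = ip (\<lambda>x. \<phi> x + g x) (\<lambda>x. \<phi> x + g x)"

lemma energy_expand:
  assumes "continuous_on UNIV \<phi>" "continuous_on UNIV g"
  shows "energy g \<phi> = ip \<phi> \<phi> + 2 * ip \<phi> g + ip g g"
proof -
  have c: "continuous_on UNIV (\<lambda>x. \<phi> x \<bullet> \<phi> x)" "continuous_on UNIV (\<lambda>x. \<phi> x \<bullet> g x)"
    "continuous_on UNIV (\<lambda>x. g x \<bullet> g x)"
    using assms by (auto intro: continuous_intros)
  have "(\<phi> x + g x) \<bullet> (\<phi> x + g x) = (\<phi> x \<bullet> \<phi> x + 2 * (\<phi> x \<bullet> g x)) + g x \<bullet> g x" for x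
    by (simp add: inner_add inner_commute)
  then have "energy g \<phi> = haar (\<lambda>x. (\<phi> x \<bullet> \<phi> x + 2 * (\<phi> x \<bullet> g x)) + g x \<bullet> g x)"
    by (simp add: energy_def ip_def)
  also have "\<dots> = ip \<phi> \<phi> + 2 * ip \<phi> g + ip g g"
    using haar_add[OF continuous_on_add[OF c(1) continuous_on_mult_left[OF c(2), of 2]] c(3)]
      haar_add[OF c(1) continuous_on_mult_left[OF c(2), of 2]] haar_cmult[OF c(2), of 2]
    by (simp add: ip_def)
  finally show ?thesis .
qed

text \<open>A character \<open>\<phi>\<close> is an eigenfunction of this operator with eigenvalue
  \<open>Re (c * \<phi> a)\<close>; the next lemma bounds the deviation of a state from
  that.\<close>

definition shift_mean :: "complex \<Rightarrow> 'a \<Rightarrow> ('a \<Rightarrow> complex) \<Rightarrow> 'a \<Rightarrow> complex"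
  where "shift_mean c a \<phi> x = (c * \<phi> (x + a) + cnj c * \<phi> (x - a)) / 2"

lemma continuous_shift_mean: "continuous_on UNIV \<phi> \<Longrightarrow> continuous_on UNIV (shift_mean c a \<phi>)"
  unfolding shift_mean_def by (intro continuous_intros continuous_shift) auto

text \<open>A state is a convex combination of two states obtained from \<open>pos_def_shift\<close>; strict
  convexity of the energy forces them to be close when the energy is almost maximal.\<close>

lemma almost_maximal_shift_mean:
  assumes g: "continuous_on UNIV g" and \<phi>: "\<phi> \<in> states" and c: "norm c = 1"
    and max: "\<And>\<psi>. \<psi> \<in> states \<Longrightarrow> energy g \<psi> \<le> energy g \<phi> + \<delta>"
  shows "ip (\<lambda>x. shift_mean c a \<phi> x - of_real (Re (c * \<phi> a)) * \<phi> x)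
            (\<lambda>x. shift_mean c a \<phi> x - of_real (Re (c * \<phi> a)) * \<phi> x) \<le> \<delta>"
proof -
  define A where "A = shift_mean c a \<phi>"
  define s where "s = Re (c * \<phi> a)"
  \<comment> \<open>This is \<open>P 0\<close> for the \<open>P\<close> below, hence the weight of
    its normalization in the convex combination \<open>\<phi> = P + Q\<close>.\<close>
  define t where "t = (1 + s) / 2"
  have cont: "continuous_on UNIV \<phi>" and pd: "pos_def \<phi>" and "\<phi> 0 = 1"
    using \<phi> by (simp_all add: states_def)
  have contA: "continuous_on UNIV A"
    unfolding A_def using cont by (rule continuous_shift_mean)
  have "\<delta> \<ge> 0"
    using max[OF \<phi>] by simp
  have "norm (c * \<phi> a) \<le> 1"
    using states_norm_le[OF \<phi>] c by (simp add: norm_mult)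
  then have "\<bar>s\<bar> \<le> 1"
    unfolding s_def using abs_Re_le_cmod[of "c * \<phi> a"] by linarith
  then have t: "0 \<le> t" "t \<le> 1"
    by (auto simp: t_def)
  define P where "P x = (\<phi> x + A x) / 2" for x
  define Q where "Q x = (\<phi> x - A x) / 2" for x
  have contPQ: "continuous_on UNIV P" "continuous_on UNIV Q"
    unfolding P_def Q_def by (intro continuous_intros cont contA; simp)+
  have "pos_def P"
    using pos_def_shift[OF pd c, of a] by (simp add: P_def[abs_def] A_def shift_mean_def)
  have "Q = (\<lambda>x. (\<phi> x + ((- c) * \<phi> (x + a) + cnj (- c) * \<phi> (x - a)) / 2) / 2)"
    by (simp add: fun_eq_iff Q_def A_def shift_mean_def field_simps)
  then have "pos_def Q"
    using pos_def_shift[OF pd, of "- c" a] c by (simp only: norm_minus_cancel)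
  have "A 0 = of_real s"
    using pos_def_minus[OF pd, of a] by (simp add: A_def shift_mean_def s_def complex_eq_iff)
  then have P0: "P 0 = of_real t" and Q0: "Q 0 = of_real (1 - t)"
    by (simp_all add: P_def Q_def t_def \<open>\<phi> 0 = 1\<close> field_simps)
  have PQ: "P x + Q x = \<phi> x" for x
    by (simp add: P_def Q_def field_simps)
  have A_eq: "A x - of_real s * \<phi> x = 2 * ((1 - t) * P x - t * Q x)" for x
    by (simp add: P_def Q_def t_def field_simps)
  define D where "D x = (1 - t) * P x - t * Q x" for x
  have contD: "continuous_on UNIV D"
    unfolding D_def by (intro continuous_intros contPQ)
  have "ip (\<lambda>x. A x - of_real s * \<phi> x) (\<lambda>x. A x - of_real s * \<phi> x) = 4 * ip D D"
    unfolding A_eq D_def[symmetric]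
    using ip_algebra(3,4)[where r=2] contD
    by (simp add: continuous_on_mult_left)
  also have "4 * ip D D \<le> \<delta>"
  proof (cases "t = 0 \<or> t = 1")
    \<comment> \<open>One part has value 0 at 0 and therefore vanishes identically; it cannot be
      normalized, but \<open>D\<close> is 0.\<close>
    case True
    then have "D x = 0" for x
    proof
      assume "t = 0"
      then have "P x = 0"
        using pos_def_norm_le[OF \<open>pos_def P\<close>, of x] P0 by simp
      with \<open>t = 0\<close> show "D x = 0"
        by (simp add: D_def)
    next
      assume "t = 1"
      then have "Q x = 0"
        using pos_def_norm_le[OF \<open>pos_def Q\<close>, of x] Q0 by simp
      with \<open>t = 1\<close> show "D x = 0"
        by (simp add: D_def)
    qed
    then have "ip D D = 0"
      by (simp add: ip_def haar_const)
    with \<open>\<delta> \<ge> 0\<close> show ?thesis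
      by simp
  next
    case False
    then have t': "0 < t" "t < 1"
      using t by auto
    define p where "p x = of_real (1 / t) * P x" for x
    define q where "q x = of_real (1 / (1 - t)) * Q x" for x
    have contpq: "continuous_on UNIV p" "continuous_on UNIV q"
      unfolding p_def q_def by (intro continuous_intros contPQ)+
    have "p \<in> states"
      using contpq(1) pos_def_scale[OF \<open>pos_def P\<close>, of "1 / t"] P0 t'
      by (simp add: states_def p_def[abs_def])
    have "q \<in> states"
      using contpq(2) pos_def_scale[OF \<open>pos_def Q\<close>, of "1 / (1 - t)"] Q0 t'
      by (simp add: states_def q_def[abs_def])
    have Pp: "P x = t *\<^sub>R p x" "Q x = (1 - t) *\<^sub>R q x" for x
      using t' by (simp_all add: p_def q_def scaleR_conv_of_real)
    have Dpq: "D x = (t * (1 - t)) *\<^sub>R (p x - q x)" for x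
      by (simp add: D_def Pp scaleR_conv_of_real algebra_simps)
    \<comment> \<open>The identity behind strict convexity, the square of a convex combination plus
      \<open>t * (1 - t)\<close> times the squared difference being the combination of the squares.
      It is multiplied by \<open>t * (1 - t)\<close> so that \<open>D x \<bullet> D x\<close>
      appears.\<close>
    have key: "t * (1 - t) * ((\<phi> x + g x) \<bullet> (\<phi> x + g x)) + D x \<bullet> D x =
        t * (1 - t) * (t * ((p x + g x) \<bullet> (p x + g x)) + (1 - t) * ((q x + g x) \<bullet> (q x + g x)))" for x
    proof -
      have "\<phi> x + g x = t *\<^sub>R (p x + g x) + (1 - t) *\<^sub>R (q x + g x)"
        unfolding PQ[symmetric] Pp by (simp add: algebra_simps)
      moreover have "D x = (t * (1 - t)) *\<^sub>R ((p x + g x) - (q x + g x))"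
        by (simp add: Dpq)
      moreover have "t * (1 - t) * ((t *\<^sub>R u + (1 - t) *\<^sub>R v) \<bullet> (t *\<^sub>R u + (1 - t) *\<^sub>R v)) +
          ((t * (1 - t)) *\<^sub>R (u - v)) \<bullet> ((t * (1 - t)) *\<^sub>R (u - v)) =
          t * (1 - t) * (t * (u \<bullet> u) + (1 - t) * (v \<bullet> v))" for u v :: complex
        by (simp add: inner_add inner_diff inner_commute) algebra
      ultimately show ?thesis
        by (simp only:)
    qed
    have ce: "continuous_on UNIV (\<lambda>x. (f x + g x) \<bullet> (f x + g x))"
      if "continuous_on UNIV f" for f
      by (intro continuous_intros that g)
    have cD: "continuous_on UNIV (\<lambda>x. D x \<bullet> D x)"
      by (intro continuous_intros contD)
    have "t * (1 - t) * energy g \<phi> + ip D D =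
        haar (\<lambda>x. t * (1 - t) * ((\<phi> x + g x) \<bullet> (\<phi> x + g x)) + D x \<bullet> D x)"
      unfolding energy_def ip_def
      by (simp only: haar_add[OF continuous_on_mult_left[OF ce[OF cont]] cD] haar_cmult[OF ce[OF cont]])
    also have "\<dots> = t * (1 - t) * (t * energy g p + (1 - t) * energy g q)"
      unfolding key energy_def ip_def
      by (simp only: haar_cmult[OF continuous_on_add[OF continuous_on_mult_left[OF ce[OF contpq(1)]]
              continuous_on_mult_left[OF ce[OF contpq(2)]]]]
          haar_add[OF continuous_on_mult_left[OF ce[OF contpq(1)]]
              continuous_on_mult_left[OF ce[OF contpq(2)]]]
          haar_cmult[OF ce[OF contpq(1)]] haar_cmult[OF ce[OF contpq(2)]])
    also have "\<dots> \<le> t * (1 - t) * (t * (energy g \<phi> + \<delta>) + (1 - t) * (energy g \<phi> + \<delta>))"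
      using t' max[OF \<open>p \<in> states\<close>] max[OF \<open>q \<in> states\<close>]
      by (intro mult_left_mono add_mono) auto
    also have "\<dots> = t * (1 - t) * energy g \<phi> + t * (1 - t) * \<delta>"
      by (simp add: algebra_simps)
    finally have "ip D D \<le> t * (1 - t) * \<delta>"
      by simp
    moreover have "4 * (t * (1 - t)) \<le> 1"
      using zero_le_power2[of "2 * t - 1"] by (simp add: power2_eq_square algebra_simps)
    then have "4 * (t * (1 - t)) * \<delta> \<le> 1 * \<delta>"
      using \<open>\<delta> \<ge> 0\<close> by (rule mult_right_mono)
    ultimately show ?thesis
      by simp
  qed
  finally show ?thesis
    by (simp add: A_def s_def)
qed

text \<open>Translation invariance moves the shifts from the state, about whose continuity nothing
  quantitative is known, onto \<open>g\<close>, which varies by at most \<open>\<eta>\<close>; the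
  state is bounded by 1.\<close>

lemma ip_shift_mean_diff_le:
  assumes \<phi>: "\<phi> \<in> states" and g: "continuous_on UNIV g" and c: "norm c = 1"
    and U: "\<And>x. dist (g (x + u)) (g x) \<le> \<eta>"
  shows "\<bar>ip (shift_mean c (a + u) \<phi>) g - ip (shift_mean c a \<phi>) g\<bar> \<le> \<eta>"
proof -
  have cont: "continuous_on UNIV \<phi>"
    using \<phi> by (simp add: states_def)
  define h where "h b x = ((c * \<phi> x) \<bullet> g (x - b) + (cnj c * \<phi> x) \<bullet> g (x + b)) / 2" for b x
  have ch: "continuous_on UNIV (h b)" for b
    unfolding h_def by (intro continuous_intros cont continuous_shift[OF g]) simp
  have ip_eq: "ip (shift_mean c b \<phi>) g = haar (h b)" for b
  proof -
    define k where "k x = (1 / 2) * ((c * \<phi> x) \<bullet> g (x - b))" for x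
    define l where "l x = (1 / 2) * ((cnj c * \<phi> x) \<bullet> g (x + b))" for x
    have ck: "continuous_on UNIV k" and cl: "continuous_on UNIV l"
      unfolding k_def l_def by (intro continuous_intros cont continuous_shift[OF g])+
    have "shift_mean c b \<phi> x = (1 / 2) *\<^sub>R (c * \<phi> (x + b) + cnj c * \<phi> (x - b))" for x
      by (simp add: shift_mean_def scaleR_conv_of_real)
    then have "ip (shift_mean c b \<phi>) g = haar (\<lambda>x. k (x + b) + l (x + (- b)))"
      by (simp add: ip_def k_def l_def inner_add_left distrib_left)
    also have "\<dots> = haar k + haar l"
      using haar_add[OF continuous_shift(1)[OF ck, of b] continuous_shift(1)[OF cl, of "- b"]]
        haar_translate[OF ck, of b] haar_translate[OF cl, of "- b"] by (simp only:)
    also have "\<dots> = haar (\<lambda>x. k x + l x)"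
      using haar_add[OF ck cl] by simp
    also have "(\<lambda>x. k x + l x) = h b"
      by (simp add: fun_eq_iff h_def k_def l_def field_simps)
    finally show ?thesis .
  qed
  have inner_le: "\<bar>w \<bullet> z - w \<bullet> z'\<bar> \<le> dist z z'" if "norm w \<le> 1" for w z z' :: complex
  proof -
    have "\<bar>w \<bullet> (z - z')\<bar> \<le> norm w * norm (z - z')"
      by (rule Cauchy_Schwarz_ineq2)
    also have "\<dots> \<le> 1 * norm (z - z')"
      using that by (intro mult_right_mono) auto
    finally show ?thesis
      by (simp add: inner_diff_right dist_norm)
  qed
  have "\<bar>h (a + u) x - h a x\<bar> \<le> \<eta>" for x
  proof -
    have "norm (\<phi> x) \<le> 1"
      using states_norm_le[OF \<phi>] .
    then have n: "norm (c * \<phi> x) \<le> 1" "norm (cnj c * \<phi> x) \<le> 1"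
      using c by (simp_all add: norm_mult)
    have "dist (g (x - (a + u))) (g (x - a)) \<le> \<eta>"
      using U[of "x - (a + u)"] by (simp add: dist_commute algebra_simps)
    then have 1: "\<bar>(c * \<phi> x) \<bullet> g (x - (a + u)) - (c * \<phi> x) \<bullet> g (x - a)\<bar> \<le> \<eta>"
      using inner_le[OF n(1)] by (meson order_trans)
    have "dist (g (x + (a + u))) (g (x + a)) \<le> \<eta>"
      using U[of "x + a"] by (simp add: add.assoc)
    then have 2: "\<bar>(cnj c * \<phi> x) \<bullet> g (x + (a + u)) - (cnj c * \<phi> x) \<bullet> g (x + a)\<bar> \<le> \<eta>"
      using inner_le[OF n(2)] by (meson order_trans)
    have "\<bar>(p + q) / 2 - (p' + q') / 2\<bar> \<le> \<eta>" if "\<bar>p - p'\<bar> \<le> \<eta>" "\<bar>q - q'\<bar> \<le> \<eta>" for p q p' q' :: real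
      using that by (auto simp: abs_le_iff field_simps)
    from this[OF 1 2] show ?thesis
      by (simp only: h_def)
  qed
  then have "\<bar>haar (\<lambda>x. h (a + u) x - h a x)\<bar> \<le> \<eta>"
    by (intro haar_abs_le continuous_on_diff ch)
  then show ?thesis
    by (simp add: ip_eq haar_diff[OF ch ch])
qed

text \<open>Pairing the near-eigenfunction relation with \<open>g\<close> shows that
  \<open>Re (c * \<phi> a) * ip \<phi> g\<close> is, up to a small error, a quantity varying slowly
  with \<open>a\<close>. Dividing by \<open>ip \<phi> g \<ge> 1\<close> gives a bound in terms of
  \<open>g\<close>, \<open>\<epsilon>\<close> and \<open>\<eta>\<close> that does not depend on
  \<open>\<phi>\<close>.\<close>

lemma almost_maximal_equicontinuous:
  assumes g: "continuous_on UNIV g" and \<phi>: "\<phi> \<in> states" and "0 < \<epsilon>"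
    and max: "\<And>\<psi>. \<psi> \<in> states \<Longrightarrow> energy g \<psi> \<le> energy g \<phi> + \<epsilon>\<^sup>2"
    and U: "\<And>x. dist (g (x + u)) (g x) \<le> \<eta>"
    and ge1: "1 \<le> ip \<phi> g"
  shows "dist (\<phi> (a + u)) (\<phi> a) \<le> 2 * (\<epsilon> * (ip g g + 1) + \<eta>)"
proof -
  have cont: "continuous_on UNIV \<phi>"
    using \<phi> by (simp add: states_def)
  have "ip g g \<ge> 0"
    using ip_self_nonneg[OF g] .
  have near: "\<bar>ip (shift_mean c b \<phi>) g - Re (c * \<phi> b) * ip \<phi> g\<bar> \<le> \<epsilon> * ((ip g g + 1) / 2)"
    if "norm c = 1" for c b
  proof -
    have cm: "continuous_on UNIV (\<lambda>x. of_real (Re (c * \<phi> b)) * \<phi> x)"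
      by (intro continuous_intros cont)
    have "\<bar>ip (\<lambda>x. shift_mean c b \<phi> x - of_real (Re (c * \<phi> b)) * \<phi> x) g\<bar> \<le> \<epsilon> * ((ip g g + 1) / 2)"
      using almost_maximal_shift_mean[OF g \<phi> that max]
      by (intro ip_abs_le continuous_on_diff continuous_shift_mean cont cm g \<open>0 < \<epsilon>\<close>)
    then show ?thesis
      by (simp only: ip_algebra(2)[OF continuous_shift_mean[OF cont] cm g] ip_algebra(3)[OF cont cont g])
  qed
  have Re_le: "\<bar>Re (c * \<phi> (a + u)) - Re (c * \<phi> a)\<bar> \<le> \<epsilon> * (ip g g + 1) + \<eta>" if "norm c = 1" for c
  proof -
    have "\<bar>Re (c * \<phi> (a + u)) - Re (c * \<phi> a)\<bar> * 1 \<le> \<bar>Re (c * \<phi> (a + u)) - Re (c * \<phi> a)\<bar> * ip \<phi> g"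
      using ge1 by (intro mult_left_mono) auto
    also have "\<dots> = \<bar>Re (c * \<phi> (a + u)) * ip \<phi> g - Re (c * \<phi> a) * ip \<phi> g\<bar>"
      using ge1 by (simp add: abs_mult left_diff_distrib[symmetric])
    also have "\<dots> \<le> 2 * (\<epsilon> * ((ip g g + 1) / 2)) + \<eta>"
    proof -
      have "\<bar>p' - p\<bar> \<le> 2 * e + \<eta>" if "\<bar>q' - p'\<bar> \<le> e" "\<bar>q - p\<bar> \<le> e" "\<bar>q' - q\<bar> \<le> \<eta>"
        for p q p' q' e :: real
        using that by linarith
      then show ?thesis
        using near[OF that, of "a + u"] near[OF that, of a]
          ip_shift_mean_diff_le[OF \<phi> g that U, of a] by blast
    qed
    finally show ?thesis
      by simp
  qed
  have "dist (\<phi> (a + u)) (\<phi> a) \<le> \<bar>Re (\<phi> (a + u)) - Re (\<phi> a)\<bar> + \<bar>Im (\<phi> (a + u)) - Im (\<phi> a)\<bar>"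
    using cmod_le[of "\<phi> (a + u) - \<phi> a"] by (simp add: dist_norm)
  \<comment> \<open>The factors \<open>1\<close> and \<open>- \<i>\<close> pick out the real and the
    imaginary part.\<close>
  also have "\<dots> \<le> 2 * (\<epsilon> * (ip g g + 1) + \<eta>)"
    using Re_le[of 1] Re_le[of "- \<i>"] by simp
  finally show ?thesis .
qed

lemma energy_diff_le:
  assumes g: "continuous_on UNIV g" and "\<And>x. norm (g x) \<le> B"
    and "\<phi> \<in> states" "\<psi> \<in> states" "\<And>x. dist (\<psi> x) (\<phi> x) \<le> \<eta>"
  shows "energy g \<psi> \<le> energy g \<phi> + \<eta> * (2 * (1 + B))"
proof -
  have c: "continuous_on UNIV (\<lambda>x. (\<theta> x + g x) \<bullet> (\<theta> x + g x))" if "\<theta> \<in> states" for \<theta>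
    using that g unfolding states_def by (auto intro: continuous_intros)
  have "\<eta> \<ge> 0"
    using assms(5)[of 0] zero_le_dist[of "\<psi> 0" "\<phi> 0"] by linarith
  have "(\<psi> x + g x) \<bullet> (\<psi> x + g x) - (\<phi> x + g x) \<bullet> (\<phi> x + g x) \<le> \<eta> * (2 * (1 + B))" for x
  proof -
    have "u \<bullet> u - v \<bullet> v = (u - v) \<bullet> (u + v)" for u v :: complex
      by (simp add: inner_add inner_diff inner_commute)
    then have "(\<psi> x + g x) \<bullet> (\<psi> x + g x) - (\<phi> x + g x) \<bullet> (\<phi> x + g x) =
        ((\<psi> x + g x) - (\<phi> x + g x)) \<bullet> ((\<psi> x + g x) + (\<phi> x + g x))" .
    also have "\<dots> \<le> norm ((\<psi> x + g x) - (\<phi> x + g x)) * norm ((\<psi> x + g x) + (\<phi> x + g x))"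
      by (rule norm_cauchy_schwarz)
    also have "\<dots> \<le> \<eta> * (2 * (1 + B))"
    proof (rule mult_mono)
      show "norm ((\<psi> x + g x) - (\<phi> x + g x)) \<le> \<eta>"
        using assms(5)[of x] by (simp add: dist_norm)
      have "norm ((\<psi> x + g x) + (\<phi> x + g x)) \<le> norm (\<psi> x) + norm (g x) + (norm (\<phi> x) + norm (g x))"
        by (intro norm_triangle_mono order_refl)
      then show "norm ((\<psi> x + g x) + (\<phi> x + g x)) \<le> 2 * (1 + B)"
        using states_norm_le[OF assms(3), of x] states_norm_le[OF assms(4), of x] assms(2)[of x]
        by simp
    qed (use \<open>\<eta> \<ge> 0\<close> in auto)
    finally show ?thesis .
  qed
  then have "haar (\<lambda>x. (\<psi> x + g x) \<bullet> (\<psi> x + g x) - (\<phi> x + g x) \<bullet> (\<phi> x + g x)) \<le> haar (\<lambda>_::'a. \<eta> * (2 * (1 + B)))"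
    by (rule haar_mono[OF continuous_on_diff[OF c[OF assms(4)] c[OF assms(3)]] continuous_on_const])
  then show ?thesis
    by (simp add: haar_const haar_diff[OF c[OF assms(4)] c[OF assms(3)]] energy_def ip_def)
qed

text \<open>The terms \<open>ip g g\<close> cancel, while \<open>ip \<phi> \<phi>\<close> and
  \<open>\<epsilon>\<^sup>2\<close> are at most 1 each, so
  \<open>2 * ip \<phi> g \<ge> 2 * 2 - 1 - 1\<close>. This is the origin of the threshold 2.\<close>

lemma energy_maximal_ip:
  assumes g: "continuous_on UNIV g" and \<phi>: "\<phi> \<in> states" and \<phi>1: "\<phi>1 \<in> states" "2 \<le> ip \<phi>1 g"
    and "energy g \<phi>1 \<le> energy g \<phi> + \<epsilon>\<^sup>2" "0 \<le> \<epsilon>" "\<epsilon> \<le> 1"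
  shows "1 \<le> ip \<phi> g"
proof -
  have c: "continuous_on UNIV \<phi>" "continuous_on UNIV \<phi>1"
    using \<phi> \<phi>1 by (simp_all add: states_def)
  have "ip \<phi> \<phi> \<le> haar (\<lambda>_::'a. 1)"
    unfolding ip_def
  proof (rule haar_mono)
    show "continuous_on UNIV (\<lambda>x. \<phi> x \<bullet> \<phi> x)"
      using c(1) by (intro continuous_intros)
    show "\<phi> x \<bullet> \<phi> x \<le> 1" for x
      using states_norm_le[OF \<phi>, of x] by (simp add: dot_square_norm power_le_one)
  qed simp
  then have "ip \<phi> \<phi> \<le> 1"
    by (simp add: haar_const)
  moreover have "\<epsilon>\<^sup>2 \<le> 1"
    using assms(6,7) by (simp add: power_le_one)
  moreover have "0 \<le> ip \<phi>1 \<phi>1"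
    using ip_self_nonneg[OF c(2)] .
  ultimately show ?thesis
    using energy_expand[OF c(1) g] energy_expand[OF c(2) g] assms(5) \<phi>1(2) by linarith
qed

text \<open>Positive definiteness and normalization involve finitely many values at a time and so
  survive pointwise limits. Continuity does not; equicontinuity has to supply it.\<close>

lemma states_closed:
  assumes "F \<noteq> bot" "\<And>x. ((\<lambda>\<psi>. \<psi> x) \<longlongrightarrow> \<phi> x) F" "\<forall>\<^sub>F \<psi> in F. \<psi> \<in> states"
    and "continuous_on UNIV \<phi>"
  shows "\<phi> \<in> states"
proof -
  have "\<phi> (- x) = cnj (\<phi> x)" for x
  proof -
    have "((\<lambda>\<psi>. cnj (\<psi> x)) \<longlongrightarrow> cnj (\<phi> x)) F"
      using assms(2) by (rule tendsto_cnj)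
    moreover have "\<forall>\<^sub>F \<psi> in F. cnj (\<psi> x) = \<psi> (- x)"
      using assms(3) by eventually_elim (simp add: states_def pos_def_minus)
    ultimately have "((\<lambda>\<psi>. \<psi> (- x)) \<longlongrightarrow> cnj (\<phi> x)) F"
      by (rule Lim_transform_eventually)
    then show ?thesis
      using tendsto_unique[OF assms(1) assms(2)[of "- x"]] by blast
  qed
  moreover have "0 \<le> Re (\<Sum>i<n. \<Sum>j<n. z i * cnj (z j) * \<phi> (x i - x j))" for n :: nat and z x
  proof (rule tendsto_lowerbound[OF _ _ assms(1)])
    show "((\<lambda>\<psi>. Re (\<Sum>i<n. \<Sum>j<n. z i * cnj (z j) * \<psi> (x i - x j))) \<longlongrightarrow>
        Re (\<Sum>i<n. \<Sum>j<n. z i * cnj (z j) * \<phi> (x i - x j))) F"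
      by (intro tendsto_Re tendsto_sum tendsto_mult_left assms(2))
    show "\<forall>\<^sub>F \<psi> in F. 0 \<le> Re (\<Sum>i<n. \<Sum>j<n. z i * cnj (z j) * \<psi> (x i - x j))"
      using assms(3) by eventually_elim (simp add: states_def pos_def_def)
  qed
  moreover have "\<phi> 0 = 1"
  proof -
    have "\<forall>\<^sub>F \<psi> in F. 1 = \<psi> 0"
      using assms(3) by eventually_elim (simp add: states_def)
    then have "((\<lambda>\<psi>. \<psi> 0) \<longlongrightarrow> 1) F"
      by (rule Lim_transform_eventually[OF tendsto_const])
    then show ?thesis
      using tendsto_unique[OF assms(1) assms(2)[of 0]] by blast
  qed
  ultimately show ?thesis
    using assms(4) by (simp add: states_def pos_def_def)
qed

text \<open>A maximizing sequence is asymptotically equicontinuous, so its pointwise cluster points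
  are uniform ones.\<close>

lemma energy_maximum_exists:
  assumes g: "continuous_on UNIV g" and \<phi>1: "\<phi>1 \<in> states" "2 \<le> ip \<phi>1 g"
  obtains \<phi> where "\<phi> \<in> states" "\<And>\<psi>. \<psi> \<in> states \<Longrightarrow> energy g \<psi> \<le> energy g \<phi>"
proof -
  obtain B where B: "\<And>x. norm (g x) \<le> B"
    using bounded_continuous[OF g] by (auto simp: bounded_iff)
  have "B \<ge> 0"
    using B[of 0] norm_ge_zero[of "g 0"] by linarith
  have "energy g \<psi> \<le> energy g \<phi>1 + 2 * (2 * (1 + B))" if "\<psi> \<in> states" for \<psi>
  proof (rule energy_diff_le[OF g B \<phi>1(1) that])
    show "dist (\<psi> x) (\<phi>1 x) \<le> 2" for x
      using states_norm_le[OF that, of x] states_norm_le[OF \<phi>1(1), of x]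
        norm_triangle_ineq4[of "\<psi> x" "\<phi>1 x"] by (simp add: dist_norm)
  qed
  then have bdd: "bdd_above (energy g ` states)"
    by (rule bdd_aboveI2)
  define S where "S = Sup (energy g ` states)"
  have S_ge: "energy g \<psi> \<le> S" if "\<psi> \<in> states" for \<psi>
    unfolding S_def using that bdd by (intro cSup_upper) auto
  have "\<exists>\<psi>. \<psi> \<in> states \<and> S \<le> energy g \<psi> + (1 / real (Suc n))\<^sup>2" for n
  proof -
    have "S - (1 / real (Suc n))\<^sup>2 < S"
      by simp
    moreover have "energy g ` states \<noteq> {}"
      using \<phi>1(1) by blast
    ultimately obtain e where "e \<in> energy g ` states" "S - (1 / real (Suc n))\<^sup>2 < e"
      unfolding S_def using less_cSupE by metis
    then show ?thesis
      by force
  qed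
  then obtain \<Phi> where \<Phi>: "\<And>n. \<Phi> n \<in> states" "\<And>n. S \<le> energy g (\<Phi> n) + (1 / real (Suc n))\<^sup>2"
    by metis
  define F where "F = filtermap \<Phi> sequentially"
  have "F \<noteq> bot"
    by (simp add: F_def filtermap_bot_iff)
  have "\<forall>\<^sub>F \<psi> in F. \<psi> \<in> states"
    by (simp add: F_def eventually_filtermap \<Phi>)
  then have "\<forall>\<^sub>F \<psi> in F. \<psi> \<in> {f. \<forall>x. f x \<in> cball 0 1}"
    by eventually_elim (simp add: states_norm_le)
  moreover have "compact {f :: 'a \<Rightarrow> complex. \<forall>x. f x \<in> cball 0 1}"
    by (intro compact_fun compact_cball)
  ultimately obtain \<phi> where ne: "inf (nhds \<phi>) F \<noteq> bot"
    using \<open>F \<noteq> bot\<close> unfolding compact_filter by blast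
  \<comment> \<open>A sequence in a product of this size need not have a convergent subsequence. It
    is replaced by a finer filter that converges to the cluster point.\<close>
  define E where "E = inf (nhds \<phi>) F"
  have "E \<noteq> bot"
    using ne by (simp add: E_def)
  have E_states: "\<forall>\<^sub>F \<psi> in E. \<psi> \<in> states"
    unfolding E_def using \<open>\<forall>\<^sub>F \<psi> in F. \<psi> \<in> states\<close> by (rule filter_leD[OF inf_le2])
  have E_lim: "((\<lambda>\<psi>. \<psi> x) \<longlongrightarrow> \<phi> x) E" for x
    unfolding E_def using tendsto_fun_nhds by (rule tendsto_mono[OF inf_le1])
  have E_energy: "\<forall>\<^sub>F \<psi> in E. S \<le> energy g \<psi> + \<epsilon>\<^sup>2" if "\<epsilon> > 0" for \<epsilon>
  proof -
    obtain N where N: "1 / real (Suc N) < \<epsilon>"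
      using nat_approx_posE[OF \<open>\<epsilon> > 0\<close>] .
    have "S \<le> energy g (\<Phi> n) + \<epsilon>\<^sup>2" if "n \<ge> N" for n
    proof -
      have "1 / real (Suc n) \<le> 1 / real (Suc N)"
        using that by (simp add: frac_le)
      then have "1 / real (Suc n) \<le> \<epsilon>"
        using N by linarith
      then have "(1 / real (Suc n))\<^sup>2 \<le> \<epsilon>\<^sup>2"
        by (intro power_mono) auto
      then show ?thesis
        using \<Phi>(2)[of n] by linarith
    qed
    then have "\<forall>\<^sub>F \<psi> in F. S \<le> energy g \<psi> + \<epsilon>\<^sup>2"
      unfolding F_def eventually_filtermap eventually_sequentially by blast
    then show ?thesis
      unfolding E_def by (rule filter_leD[OF inf_le2])
  qed
  define C where "C = ip g g + 1"
  have "C \<ge> 1"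
    using ip_self_nonneg[OF g] by (simp add: C_def)
  have E_equi: "\<exists>U. open U \<and> 0 \<in> U \<and>
      (\<forall>\<^sub>F \<psi> in E. \<forall>x. \<forall>u\<in>U. dist (\<psi> (x + u)) (\<psi> x) \<le> \<eta>)" if "\<eta> > 0" for \<eta>
  proof -
    have "\<eta> / 4 > 0"
      using that by simp
    then obtain U where U: "open U" "0 \<in> U" "\<And>x u. u \<in> U \<Longrightarrow> dist (g (x + u)) (g x) < \<eta> / 4"
      using compact_group_uniformly_continuous[OF compact_UNIV g] by blast
    \<comment> \<open>Chosen so that \<open>2 * (\<epsilon> * C + \<eta> / 4) \<le> \<eta>\<close>;
      the cap 1 is what \<open>energy_maximal_ip\<close> asks for.\<close>
    define \<epsilon> where "\<epsilon> = min 1 (\<eta> / (4 * C))"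
    have \<epsilon>: "0 < \<epsilon>" "\<epsilon> \<le> 1" "\<epsilon> * C \<le> \<eta> / 4"
      using that \<open>C \<ge> 1\<close> by (auto simp: \<epsilon>_def min_def field_simps)
    have "\<forall>\<^sub>F \<psi> in E. \<forall>x. \<forall>u\<in>U. dist (\<psi> (x + u)) (\<psi> x) \<le> \<eta>"
      using E_states E_energy[OF \<epsilon>(1)]
    proof eventually_elim
      case (elim \<psi>)
      have max: "energy g \<theta> \<le> energy g \<psi> + \<epsilon>\<^sup>2" if "\<theta> \<in> states" for \<theta>
        using S_ge[OF that] elim(2) by linarith
      have ge1: "1 \<le> ip \<psi> g"
        using energy_maximal_ip[OF g elim(1) \<phi>1 max[OF \<phi>1(1)]] \<epsilon>(1,2) by simp
      show ?case
      proof (intro allI ballI)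
        fix x u assume "u \<in> U"
        have "dist (\<psi> (x + u)) (\<psi> x) \<le> 2 * (\<epsilon> * (ip g g + 1) + \<eta> / 4)"
          using almost_maximal_equicontinuous[OF g elim(1) \<epsilon>(1) max _ ge1]
            U(3)[OF \<open>u \<in> U\<close>, THEN less_imp_le] by blast
        also have "\<dots> \<le> \<eta>"
          using \<epsilon>(3) by (simp add: C_def)
        finally show "dist (\<psi> (x + u)) (\<psi> x) \<le> \<eta>" .
      qed
    qed
    with U(1,2) show ?thesis
      by blast
  qed
  have \<phi>_equi: "dist (\<phi> (x + u)) (\<phi> x) \<le> \<eta>"
    if "\<forall>\<^sub>F \<psi> in E. \<forall>x. \<forall>u\<in>U. dist (\<psi> (x + u)) (\<psi> x) \<le> \<eta>" "u \<in> U" for \<eta> U x u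
  proof (rule tendsto_upperbound[OF _ _ \<open>E \<noteq> bot\<close>])
    show "((\<lambda>\<psi>. dist (\<psi> (x + u)) (\<psi> x)) \<longlongrightarrow> dist (\<phi> (x + u)) (\<phi> x)) E"
      by (intro tendsto_dist E_lim)
    show "\<forall>\<^sub>F \<psi> in E. dist (\<psi> (x + u)) (\<psi> x) \<le> \<eta>"
      using that(1) by eventually_elim (use that(2) in blast)
  qed
  have cont: "continuous_on UNIV \<phi>"
  proof (rule group_continuousI)
    fix \<eta> :: real assume "\<eta> > 0"
    then show "\<exists>U. open U \<and> 0 \<in> U \<and> (\<forall>x. \<forall>u\<in>U. dist (\<phi> (x + u)) (\<phi> x) \<le> \<eta>)"
      using E_equi \<phi>_equi by (meson ballI)
  qed
  have \<phi>: "\<phi> \<in> states"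
    using states_closed[OF \<open>E \<noteq> bot\<close> E_lim E_states cont] .
  \<comment> \<open>Every \<open>x\<close> is \<open>- a + (x + a)\<close> for one of finitely many
    \<open>a\<close>, with \<open>x + a\<close> in \<open>U\<close>: pointwise convergence at the
    points \<open>- a\<close> and equicontinuity of both sides contribute one \<open>\<eta>\<close>
    each.\<close>
  have uniform: "\<forall>\<^sub>F \<psi> in E. \<forall>x. dist (\<psi> x) (\<phi> x) \<le> 3 * \<eta>" if \<eta>: "\<eta> > 0" for \<eta>
  proof -
    obtain U where U: "open U" "0 \<in> U" and equi: "\<forall>\<^sub>F \<psi> in E. \<forall>x. \<forall>u\<in>U. dist (\<psi> (x + u)) (\<psi> x) \<le> \<eta>"
      using E_equi[OF \<eta>] by blast
    obtain A where A: "\<And>x. \<exists>a\<in>set A. x + a \<in> U"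
      using compact_translates_cover[OF compact_UNIV U] by blast
    have "\<forall>\<^sub>F \<psi> in E. \<forall>a\<in>set A. dist (\<psi> (- a)) (\<phi> (- a)) < \<eta>"
      using tendstoD[OF E_lim \<eta>] by (simp add: eventually_ball_finite)
    with equi show ?thesis
    proof eventually_elim
      case (elim \<psi>)
      show ?case
      proof
        fix x
        obtain a where a: "a \<in> set A" "x + a \<in> U"
          using A by blast
        have "dist (\<psi> (- a + (x + a))) (\<psi> (- a)) \<le> \<eta>"
          using elim(1) a(2) by blast
        moreover have "dist (\<phi> (- a + (x + a))) (\<phi> (- a)) \<le> \<eta>"
          using \<phi>_equi[OF equi a(2)] .
        moreover have "dist (\<psi> (- a)) (\<phi> (- a)) < \<eta>"
          using elim(2) a(1) by blast
        moreover have "- a + (x + a) = x"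
          by simp
        ultimately show "dist (\<psi> x) (\<phi> x) \<le> 3 * \<eta>"
          using dist_triangle[of "\<psi> x" "\<phi> x" "\<psi> (- a)"] dist_triangle2[of "\<psi> (- a)" "\<phi> x" "\<phi> (- a)"]
          by (simp add: dist_commute)
      qed
    qed
  qed
  have "S \<le> energy g \<phi> + \<delta>" if "\<delta> > 0" for \<delta>
  proof -
    define \<eta> where "\<eta> = \<delta> / (2 * (3 * (2 * (1 + B))))"
    have "\<eta> > 0"
      using that \<open>B \<ge> 0\<close> by (simp add: \<eta>_def)
    define \<epsilon> where "\<epsilon> = sqrt (\<delta> / 2)"
    have "\<epsilon> > 0"
      using that by (simp add: \<epsilon>_def)
    have "\<forall>\<^sub>F \<psi> in E. \<psi> \<in> states \<and> S \<le> energy g \<psi> + \<epsilon>\<^sup>2 \<and> (\<forall>x. dist (\<psi> x) (\<phi> x) \<le> 3 * \<eta>)"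
      using E_states E_energy[OF \<open>\<epsilon> > 0\<close>] uniform[OF \<open>\<eta> > 0\<close>] by (auto simp: eventually_conj_iff)
    then obtain \<psi> where \<psi>: "\<psi> \<in> states" "S \<le> energy g \<psi> + \<epsilon>\<^sup>2" "\<And>x. dist (\<psi> x) (\<phi> x) \<le> 3 * \<eta>"
      using eventually_happens'[OF \<open>E \<noteq> bot\<close>] by blast
    have "energy g \<psi> \<le> energy g \<phi> + 3 * \<eta> * (2 * (1 + B))"
      by (rule energy_diff_le[OF g B \<phi> \<psi>(1,3)])
    also have "3 * \<eta> * (2 * (1 + B)) = \<delta> / 2"
      using \<open>B \<ge> 0\<close> by (simp add: \<eta>_def field_simps)
    finally show ?thesis
      using \<psi>(2) that by (simp add: \<epsilon>_def)
  qed
  then have "S \<le> energy g \<phi>"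
    by (rule field_le_epsilon)
  then show thesis
    using that[OF \<phi>] S_ge by (meson order_trans)
qed

text \<open>At an exact maximum the eigenfunction relation holds without error. For
  \<open>c = 1\<close> and \<open>c = - \<i>\<close> it gives the sum and the difference of
  \<open>\<phi> (x + a)\<close> and \<open>\<phi> (x - a)\<close>, hence multiplicativity. The
  modulus is 1 because \<open>\<phi> x * \<phi> (- x) = 1\<close> and both factors have norm at most
  1.\<close>

lemma multiplicative_exists:
  assumes g: "continuous_on UNIV g" and \<phi>1: "\<phi>1 \<in> states" "2 \<le> ip \<phi>1 g"
  obtains \<phi> where "continuous_on UNIV \<phi>" "\<And>x y. \<phi> (x + y) = \<phi> x * \<phi> y" "\<And>x. norm (\<phi> x) = 1"
    "ip \<phi> g \<noteq> 0"
proof -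
  obtain \<phi> where \<phi>: "\<phi> \<in> states" "\<And>\<psi>. \<psi> \<in> states \<Longrightarrow> energy g \<psi> \<le> energy g \<phi>"
    using energy_maximum_exists[OF g \<phi>1] by blast
  have cont: "continuous_on UNIV \<phi>" and "\<phi> 0 = 1"
    using \<phi>(1) by (simp_all add: states_def)
  have shift: "shift_mean c a \<phi> x = of_real (Re (c * \<phi> a)) * \<phi> x" if "norm c = 1" for c a x
  proof -
    have "continuous_on UNIV (\<lambda>x. shift_mean c a \<phi> x - of_real (Re (c * \<phi> a)) * \<phi> x)"
      by (intro continuous_intros continuous_shift_mean cont)
    moreover have "ip (\<lambda>x. shift_mean c a \<phi> x - of_real (Re (c * \<phi> a)) * \<phi> x)
        (\<lambda>x. shift_mean c a \<phi> x - of_real (Re (c * \<phi> a)) * \<phi> x) \<le> 0"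
      using \<phi>(2) by (intro almost_maximal_shift_mean[OF g \<phi>(1) that]) simp
    ultimately have "shift_mean c a \<phi> x - of_real (Re (c * \<phi> a)) * \<phi> x = 0"
      by (rule ip_self_eq_0)
    then show ?thesis
      by simp
  qed
  have mult: "\<phi> (x + a) = \<phi> x * \<phi> a" for x a
  proof -
    have "\<phi> (x + a) + \<phi> (x - a) = 2 * of_real (Re (\<phi> a)) * \<phi> x"
      using shift[of 1 a x] by (simp add: shift_mean_def field_simps)
    moreover have "\<phi> (x + a) - \<phi> (x - a) = \<i> * (2 * of_real (Im (\<phi> a)) * \<phi> x)"
    proof -
      have "- \<i> * \<phi> (x + a) + \<i> * \<phi> (x - a) = 2 * of_real (Im (\<phi> a)) * \<phi> x"
        using shift[of "- \<i>" a x] by (simp add: shift_mean_def field_simps)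
      moreover have "\<phi> (x + a) - \<phi> (x - a) = \<i> * (- \<i> * \<phi> (x + a) + \<i> * \<phi> (x - a))"
        by (simp add: complex_eq_iff)
      ultimately show ?thesis
        by (simp only:)
    qed
    ultimately have "2 * \<phi> (x + a) = 2 * ((of_real (Re (\<phi> a)) + \<i> * of_real (Im (\<phi> a))) * \<phi> x)"
      by (simp add: algebra_simps)
    then show ?thesis
      by (simp add: complex_eq[symmetric] mult.commute)
  qed
  have "norm (\<phi> x) = 1" for x
  proof -
    have "\<phi> x * \<phi> (- x) = 1"
      using mult[of x "- x"] \<open>\<phi> 0 = 1\<close> by simp
    then have "norm (\<phi> x) * norm (\<phi> (- x)) = 1"
      by (metis norm_mult norm_one)
    moreover have "norm (\<phi> x) * norm (\<phi> (- x)) \<le> norm (\<phi> x) * 1"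
      using states_norm_le[OF \<phi>(1)] by (intro mult_left_mono) auto
    ultimately show ?thesis
      using states_norm_le[OF \<phi>(1), of x] by simp
  qed
  moreover have "1 \<le> ip \<phi> g"
    using energy_maximal_ip[OF g \<phi>(1) \<phi>1, of 0] \<phi>(2)[OF \<phi>1(1)] by simp
  ultimately show thesis
    using that[OF cont mult] by fastforce
qed

end

subsection \<open>Characters separate points\<close>

lemma power_averages_tendsto:
  fixes r :: complex
  assumes "norm r = 1"
  shows "(\<lambda>n. (\<Sum>j<n. r ^ j) / of_nat n) \<longlonglongrightarrow> (if r = 1 then 1 else 0)"
proof (cases "r = 1")
  case True
  have "\<forall>\<^sub>F n in sequentially. 1 = (\<Sum>j<n. r ^ j) / of_nat n"
    using eventually_gt_at_top[of 0] by eventually_elim (simp add: True)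
  then show ?thesis
    using True by (simp add: Lim_transform_eventually[OF tendsto_const])
next
  case False
  have "norm ((\<Sum>j<n. r ^ j) / of_nat n) \<le> (2 / norm (r - 1)) / real n" for n
  proof -
    have "norm ((\<Sum>j<n. r ^ j) / of_nat n) = norm (r ^ n - 1) / norm (r - 1) / real n"
      by (simp add: geometric_sum[OF False] norm_divide norm_mult)
    also have "norm (r ^ n - 1) \<le> 2"
      using norm_triangle_ineq4[of "r ^ n" 1] by (simp add: norm_power assms)
    finally show ?thesis
      by (simp add: divide_right_mono)
  qed
  then have "(\<lambda>n. (\<Sum>j<n. r ^ j) / of_nat n) \<longlonglongrightarrow> 0"
    by (intro Lim_null_comparison[OF always_eventually lim_const_over_n]) blast
  with False show ?thesis
    by simp
qed

text \<open>With \<open>y\<close> the \<open>k\<close>-th root of \<open>x\<close>, the expression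
  is the \<open>k\<close>-th power of \<open>(real p + 1) * y ^ p\<close>.\<close>

lemma power_times_geometric_tendsto_0:
  fixes x :: real
  assumes "0 \<le> x" "x < 1"
  shows "(\<lambda>p. (real p + 1) ^ k * x ^ p) \<longlonglongrightarrow> 0"
proof (cases "k = 0")
  case True
  then show ?thesis
    using LIMSEQ_realpow_zero[OF assms] by simp
next
  case False
  define y where "y = root k x"
  have y: "0 \<le> y" "y < 1" "y ^ k = x"
    using False assms by (simp_all add: y_def)
  have "(\<lambda>p. real p * y ^ p + y ^ p) \<longlonglongrightarrow> 0 + 0"
    using powser_times_n_limit_0[of y] y LIMSEQ_realpow_zero[of y] by (intro tendsto_add) auto
  then have "(\<lambda>p. ((real p + 1) * y ^ p) ^ k) \<longlonglongrightarrow> 0 ^ k"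
    by (intro tendsto_power) (simp add: distrib_right)
  then show ?thesis
    using False by (simp add: power_mult_distrib y(3)[symmetric] power_mult[symmetric] mult.commute zero_power)
qed

lemma hom_on_UNIV:
  assumes "hom_on UNIV g"
  shows "g (x + y) = g x + g y" "g 0 = 0" "g (- x) = - g x" "g (x - y) = g x - g y"
    and "g (\<Sum>i\<in>I. f i) = (\<Sum>i\<in>I. g (f i))"
proof -
  show add: "g (x + y) = g x + g y" for x y
    using assms by (simp add: hom_on_def)
  show zero: "g 0 = 0"
    using add[of 0 0] by simp
  show minus: "g (- x) = - g x" for x
    using add[of x "- x"] zero by (simp add: minus_unique)
  show "g (x - y) = g x - g y"
    using add[of x "- y"] minus[of y] by simp
  show "g (\<Sum>i\<in>I. f i) = (\<Sum>i\<in>I. g (f i))"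
    by (induction I rule: infinite_finite_induct) (simp_all add: zero add)
qed

lemma dual_hom: "\<xi> \<in> dual \<Longrightarrow> hom_on UNIV \<xi>"
  by (simp add: dual_def)

lemma dual_add: "\<xi> \<in> dual \<Longrightarrow> \<psi> \<in> dual \<Longrightarrow> (\<lambda>x. \<xi> x + \<psi> x) \<in> dual"
  unfolding dual_def hom_on_def by (auto intro: continuous_on_add)

lemma dual_diff: "\<xi> \<in> dual \<Longrightarrow> \<psi> \<in> dual \<Longrightarrow> (\<lambda>x. \<xi> x - \<psi> x) \<in> dual"
  unfolding dual_def hom_on_def by (auto intro: continuous_on_diff)

lemma dual_zero: "(\<lambda>_. 0) \<in> dual"
  by (simp add: dual_def hom_on_def)

lemma dual_exp_power:
  assumes "\<xi> \<in> dual" "\<psi> \<in> dual"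
  shows "\<exists>\<theta>\<in>dual. \<forall>x. circle_exp (\<theta> x) = circle_exp (\<xi> x) * circle_exp (\<psi> x) ^ j"
proof (induction j)
  case 0
  then show ?case
    using assms(1) by auto
next
  case (Suc j)
  then obtain \<theta> where "\<theta> \<in> dual" "\<And>x. circle_exp (\<theta> x) = circle_exp (\<xi> x) * circle_exp (\<psi> x) ^ j"
    by blast
  then show ?case
    using assms(2) by (intro bexI[of _ "\<lambda>x. \<theta> x + \<psi> x"]) (auto simp: circle_exp_add dual_add)
qed

lemma multiplicative_dual:
  assumes "continuous_on UNIV \<phi>" "\<And>x y. \<phi> (x + y) = \<phi> x * \<phi> y" "\<And>x. norm (\<phi> x) = 1"
  obtains \<xi> where "\<xi> \<in> dual" "\<And>x. circle_exp (\<xi> x) = \<phi> x"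
proof -
  have "\<exists>c. circle_exp c = \<phi> x" for x
    using circle_exp_surj[OF assms(3)] by metis
  then obtain \<xi> where \<xi>: "\<And>x. circle_exp (\<xi> x) = \<phi> x"
    by metis
  have "continuous_on UNIV (\<lambda>x. circle_exp (\<xi> x))"
    using assms(1) by (simp add: \<xi>)
  then have "continuous_on UNIV \<xi>"
    by (simp only: continuous_on_circle_exp_iff)
  moreover have "\<xi> (x + y) = \<xi> x + \<xi> y" for x y
    using assms(2) by (simp add: circle_exp_inj[symmetric] circle_exp_add \<xi>)
  ultimately have "\<xi> \<in> dual"
    by (simp add: dual_def hom_on_def)
  then show thesis
    using that \<xi> by blast
qed

section \<open>Autocorrelations and the separation of points\<close>

context compact_group
begin

definition correlation :: "('a \<Rightarrow> real) \<Rightarrow> ('a \<Rightarrow> real) \<Rightarrow> 'a \<Rightarrow> real"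
  where "correlation f k t = haar (\<lambda>x. f (x + t) * k x)"

lemma continuous_correlation:
  assumes f: "continuous_on UNIV f" and k: "continuous_on UNIV k"
  shows "continuous_on UNIV (correlation f k)"
proof (rule group_continuousI)
  fix \<epsilon> :: real assume "\<epsilon> > 0"
  obtain B where B: "\<And>x. norm (k x) \<le> B"
    using bounded_continuous[OF k] by (auto simp: bounded_iff)
  have "B \<ge> 0"
    using B[of 0] norm_ge_zero[of "k 0"] by linarith
  then have "\<epsilon> / (B + 1) > 0"
    using \<open>\<epsilon> > 0\<close> by simp
  then obtain U where U: "open U" "0 \<in> U" "\<And>x u. u \<in> U \<Longrightarrow> dist (f (x + u)) (f x) < \<epsilon> / (B + 1)"
    using compact_group_uniformly_continuous[OF compact_UNIV f] by blast
  have c: "continuous_on UNIV (\<lambda>x. f (x + t) * k x)" for t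
    by (intro continuous_intros continuous_shift[OF f] k)
  have "dist (correlation f k (t + u)) (correlation f k t) \<le> \<epsilon>" if "u \<in> U" for t u
  proof -
    have "\<bar>f (x + (t + u)) * k x - f (x + t) * k x\<bar> \<le> \<epsilon>" for x
    proof -
      have "\<bar>f (x + (t + u)) * k x - f (x + t) * k x\<bar> = dist (f (x + t + u)) (f (x + t)) * norm (k x)"
        by (simp add: dist_real_def abs_mult left_diff_distrib[symmetric] add.assoc)
      also have "\<dots> \<le> \<epsilon> / (B + 1) * (B + 1)"
        using U(3)[OF that, of "x + t"] B[of x] \<open>B \<ge> 0\<close> \<open>\<epsilon> > 0\<close> by (intro mult_mono) auto
      finally show ?thesis
        using \<open>B \<ge> 0\<close> by simp
    qed
    then have "\<bar>haar (\<lambda>x. f (x + (t + u)) * k x - f (x + t) * k x)\<bar> \<le> \<epsilon>"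
      by (rule haar_abs_le[OF continuous_on_diff[OF c c]])
    then show ?thesis
      by (simp add: correlation_def dist_real_def haar_diff[OF c c])
  qed
  with U(1,2) show "\<exists>U. open U \<and> 0 \<in> U \<and>
      (\<forall>t. \<forall>u\<in>U. dist (correlation f k (t + u)) (correlation f k t) \<le> \<epsilon>)"
    by blast
qed

text \<open>By translation invariance the form is the mean over \<open>y\<close> of the squared norm
  of the vector \<open>\<Sum>i<n. k (y + x i) *\<^sub>R z i\<close>.\<close>

lemma pos_def_autocorrelation:
  assumes k: "continuous_on UNIV k"
  shows "pos_def (\<lambda>t. of_real (correlation k k t))"
proof -
  have c: "continuous_on UNIV (\<lambda>x. k (x + s) * k (x + t))" for s t
    by (intro continuous_intros continuous_shift[OF k])
  have shift: "haar (\<lambda>x. k (x + s) * k (x + t)) = correlation k k (s - t)" for s t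
    using haar_translate[OF c[of s t], of "- t"] by (simp add: correlation_def algebra_simps)
  have "correlation k k (- t) = correlation k k t" for t
    using shift[of 0 t] shift[of t 0] by (simp add: mult.commute)
  moreover have "0 \<le> Re (\<Sum>i<n. \<Sum>j<n. z i * cnj (z j) * of_real (correlation k k (x i - x j)))"
    for n :: nat and z x
  proof -
    have c1: "continuous_on UNIV (\<lambda>y. (z i \<bullet> z j) * (k (y + x i) * k (y + x j)))" for i j
      by (rule continuous_on_mult_left[OF c])
    have c2: "continuous_on UNIV (\<lambda>y. \<Sum>j<n. (z i \<bullet> z j) * (k (y + x i) * k (y + x j)))" for i
      by (rule continuous_on_sum[OF c1])
    have "0 \<le> haar (\<lambda>y. \<Sum>i<n. \<Sum>j<n. (z i \<bullet> z j) * (k (y + x i) * k (y + x j)))"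
    proof (rule haar_nonneg[OF continuous_on_sum[OF c2]])
      fix y
      have "(\<Sum>i<n. \<Sum>j<n. (z i \<bullet> z j) * (k (y + x i) * k (y + x j))) =
          (\<Sum>i<n. k (y + x i) *\<^sub>R z i) \<bullet> (\<Sum>j<n. k (y + x j) *\<^sub>R z j)"
        by (subst sum.swap) (simp add: inner_sum_left inner_sum_right sum_distrib_left mult_ac)
      then show "0 \<le> (\<Sum>i<n. \<Sum>j<n. (z i \<bullet> z j) * (k (y + x i) * k (y + x j)))"
        by simp
    qed
    also have "haar (\<lambda>y. \<Sum>i<n. \<Sum>j<n. (z i \<bullet> z j) * (k (y + x i) * k (y + x j))) =
        (\<Sum>i<n. \<Sum>j<n. (z i \<bullet> z j) * correlation k k (x i - x j))"
      by (simp only: haar_sum[OF c2] haar_sum[OF c1] haar_cmult[OF c] shift)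
    also have "\<dots> = Re (\<Sum>i<n. \<Sum>j<n. z i * cnj (z j) * of_real (correlation k k (x i - x j)))"
      by (simp add: inner_complex_def)
    finally show ?thesis .
  qed
  ultimately show ?thesis
    by (simp add: pos_def_def)
qed

text \<open>The function \<open>k\<close> is a difference of \<open>h\<close> and its translate by
  \<open>a\<close>, so its autocorrelation is a difference of \<open>correlation h k\<close> and its
  translate by \<open>a\<close>. It is therefore orthogonal to every character that is 1 at
  \<open>a\<close>, whereas the maximizer is not orthogonal to it.\<close>

theorem dual_separates:
  assumes "a \<noteq> (0 :: 'a)"
  obtains \<xi> where "\<xi> \<in> dual" "\<xi> a \<noteq> 0"
proof -
  have "Hausdorff_space (euclidean :: 'a topology)"
    unfolding Hausdorff_space_def using hausdorff by (auto simp: disjnt_def)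
  then have "normal_space (euclidean :: 'a topology)"
    by (intro compact_Hausdorff_or_regular_imp_normal_space)
       (simp_all add: compact_space_def compact_UNIV)
  then obtain h :: "'a \<Rightarrow> real" where "continuous_map euclidean euclideanreal h" "h ` {0} \<subseteq> {1}" "h ` {a} \<subseteq> {0}"
    using Urysohn_lemma_alt[of "euclidean :: 'a topology" "{0}" "{a}" 1 0] assms by (auto simp: disjnt_def)
  then have h: "continuous_on UNIV h" "h 0 = 1" "h a = 0"
    by auto
  define k where "k x = h x - h (x + a)" for x
  have k: "continuous_on UNIV k"
    unfolding k_def by (intro continuous_intros h continuous_shift)
  have "k 0 \<noteq> 0"
    by (simp add: k_def h)
  define \<kappa> where "\<kappa> = correlation k k"
  have \<kappa>: "continuous_on UNIV \<kappa>"
    unfolding \<kappa>_def using k k by (rule continuous_correlation)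
  have "0 < haar (\<lambda>x. k x * k x)"
    by (rule haar_pos[of _ 0]) (use \<open>k 0 \<noteq> 0\<close> k in \<open>auto intro: continuous_intros simp: zero_less_mult_iff\<close>)
  then have "\<kappa> 0 > 0"
    by (simp add: \<kappa>_def correlation_def)
  define \<phi>1 where "\<phi>1 t = complex_of_real (1 / \<kappa> 0) * of_real (\<kappa> t)" for t
  have c1: "continuous_on UNIV \<phi>1"
    unfolding \<phi>1_def by (intro continuous_intros \<kappa>)
  have "pos_def \<phi>1"
    unfolding \<phi>1_def \<kappa>_def
    by (rule pos_def_scale[OF pos_def_autocorrelation[OF k]]) (use \<open>\<kappa> 0 > 0\<close> in \<open>simp add: \<kappa>_def\<close>)
  moreover have "\<phi>1 0 = 1"
    using \<open>\<kappa> 0 > 0\<close> by (simp add: \<phi>1_def)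
  ultimately have \<phi>1: "\<phi>1 \<in> states"
    using c1 by (simp add: states_def)
  have "ip \<phi>1 \<phi>1 > 0"
    using ip_self_eq_0[OF c1, of 0] \<open>\<phi>1 0 = 1\<close> by (metis linorder_not_le zero_neq_one)
  \<comment> \<open>Scaled so that \<open>ip \<phi>1 g\<close> is exactly 2, the threshold of
    \<open>energy_maximal_ip\<close>.\<close>
  define g where "g t = of_real (2 / ip \<phi>1 \<phi>1) * \<phi>1 t" for t
  have g: "continuous_on UNIV g"
    unfolding g_def by (intro continuous_intros c1)
  have ip_g: "ip \<phi> g = (2 / ip \<phi>1 \<phi>1) * ip \<phi> \<phi>1" if "continuous_on UNIV \<phi>" for \<phi>
    unfolding g_def by (rule ip_algebra(4)[OF c1 c1 that])
  have "2 \<le> ip \<phi>1 g"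
    using \<open>ip \<phi>1 \<phi>1 > 0\<close> by (simp add: ip_g[OF c1])
  then obtain \<phi> where \<phi>: "continuous_on UNIV \<phi>" "\<And>x y. \<phi> (x + y) = \<phi> x * \<phi> y" "\<And>x. norm (\<phi> x) = 1"
    "ip \<phi> g \<noteq> 0"
    using multiplicative_exists[OF g \<phi>1] by metis
  have "\<phi> a \<noteq> 1"
  proof
    assume "\<phi> a = 1"
    define m where "m t = correlation h k t * Re (\<phi> t)" for t
    have cm: "continuous_on UNIV m"
      unfolding m_def by (intro continuous_intros continuous_correlation h k \<phi>(1))
    have "\<kappa> t = correlation h k t - correlation h k (t + a)" for t
    proof -
      have "continuous_on UNIV (\<lambda>x. h (x + s) * k x)" for s
        by (intro continuous_intros continuous_shift h k)
      from haar_diff[OF this this, of t "t + a"] show ?thesis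
        by (simp add: \<kappa>_def correlation_def k_def[of "_ + _"] left_diff_distrib add.assoc)
    qed
    then have "\<kappa> t * Re (\<phi> t) = m t - m (t + a)" for t
      by (simp add: m_def \<phi>(2) \<open>\<phi> a = 1\<close> left_diff_distrib)
    then have *: "haar (\<lambda>t. \<kappa> t * Re (\<phi> t)) = 0"
      using haar_diff[OF cm continuous_shift(1)[OF cm, of a]] haar_translate[OF cm, of a] by simp
    have "ip \<phi> \<phi>1 = haar (\<lambda>t. (1 / \<kappa> 0) * (\<kappa> t * Re (\<phi> t)))"
      unfolding ip_def \<phi>1_def by (simp add: inner_complex_def mult.commute)
    also have "\<dots> = (1 / \<kappa> 0) * haar (\<lambda>t. \<kappa> t * Re (\<phi> t))"
      by (intro haar_cmult continuous_intros \<kappa> \<phi>(1))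
    finally have "ip \<phi> g = 0"
      using * by (simp add: ip_g[OF \<phi>(1)])
    with \<phi>(4) show False ..
  qed
  obtain \<xi> where "\<xi> \<in> dual" "\<And>x. circle_exp (\<xi> x) = \<phi> x"
    using multiplicative_dual[OF \<phi>(1-3)] by blast
  moreover from this(2)[of a] have "\<xi> a \<noteq> 0"
    using \<open>\<phi> a \<noteq> 1\<close> by (auto simp: circle_exp_0)
  ultimately show thesis
    using that by blast
qed

end

subsection \<open>Density of the dual\<close>

lemma circle_exp_ball:
  assumes "open U" "c \<in> U"
  obtains \<epsilon> where "\<epsilon> > 0" "\<And>d. dist (circle_exp d) (circle_exp c) < \<epsilon> \<Longrightarrow> d \<in> U"
proof -
  have "((\<lambda>d. d) \<longlongrightarrow> c) (filtercomap circle_exp (nhds (circle_exp c)))"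
    by (subst tendsto_circle_exp_iff[symmetric]) (rule filterlim_filtercomap)
  then have "\<forall>\<^sub>F d in filtercomap circle_exp (nhds (circle_exp c)). d \<in> U"
    using assms by (rule topological_tendstoD)
  then obtain Q where Q: "eventually Q (nhds (circle_exp c))" "\<And>d. Q (circle_exp d) \<Longrightarrow> d \<in> U"
    unfolding eventually_filtercomap by blast
  then obtain \<epsilon> where "\<epsilon> > 0" "\<And>z. dist z (circle_exp c) < \<epsilon> \<Longrightarrow> Q z"
    unfolding eventually_nhds_metric by blast
  then show thesis
    using that Q(2) by blast
qed

lemma sum_const_card: "finite J \<Longrightarrow> (\<Sum>j\<in>J. a) = (\<Sum>j<card J. a)"
  for a :: "'a::comm_monoid_add"
  by (induction J rule: finite_induct) (simp_all add: add.commute)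

text \<open>By commutativity the sum of a word depends only on how often each letter occurs, and
  each count lies between 0 and \<open>p\<close>.\<close>

lemma card_word_sums_le:
  fixes A :: "'a::comm_monoid_add set"
  assumes "finite A"
  shows "card ((\<lambda>w. \<Sum>j<p. w j) ` (PiE {..<p} (\<lambda>_. A))) \<le> (p + 1) ^ card A"
proof -
  let ?g = "\<lambda>c. \<Sum>a\<in>A. \<Sum>j<c a. a"
  have "(\<Sum>j<p. w j) \<in> ?g ` (PiE A (\<lambda>_. {..p}))" if "w \<in> PiE {..<p} (\<lambda>_. A)" for w
  proof -
    define c where "c = restrict (\<lambda>a. card {j\<in>{..<p}. w j = a}) A"
    have "(\<Sum>j<p. w j) = (\<Sum>a\<in>A. \<Sum>j\<in>{j\<in>{..<p}. w j = a}. w j)"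
      using that by (intro sum.group[symmetric] assms) auto
    also have "\<dots> = (\<Sum>a\<in>A. \<Sum>j\<in>{j\<in>{..<p}. w j = a}. a)"
      by (intro sum.cong) auto
    also have "\<dots> = ?g c"
    proof (rule sum.cong[OF refl])
      fix a assume "a \<in> A"
      then have "c a = card {j\<in>{..<p}. w j = a}"
        by (simp add: c_def)
      then show "(\<Sum>j\<in>{j\<in>{..<p}. w j = a}. a) = (\<Sum>j<c a. a)"
        using sum_const_card[of "{j\<in>{..<p}. w j = a}" a] by simp
    qed
    finally have "(\<Sum>j<p. w j) = ?g c" .
    moreover have "card {j\<in>{..<p}. w j = a} \<le> p" for a
      using card_mono[of "{..<p}" "{j\<in>{..<p}. w j = a}"] by auto
    then have "c \<in> PiE A (\<lambda>_. {..p})"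
      by (auto simp: c_def)
    ultimately show ?thesis
      by blast
  qed
  then have "card ((\<lambda>w. \<Sum>j<p. w j) ` (PiE {..<p} (\<lambda>_. A))) \<le> card (?g ` (PiE A (\<lambda>_. {..p})))"
    by (intro card_mono finite_imageI finite_PiE assms) auto
  also have "\<dots> \<le> card (PiE A (\<lambda>_. {..p}))"
    by (intro card_image_le finite_PiE assms) auto
  also have "\<dots> = (p + 1) ^ card A"
    by (simp add: card_PiE assms)
  finally show ?thesis .
qed

section \<open>Kronecker approximation by characters\<close>

context compact_group
begin

lemma dual_separates_points:
  assumes "a \<noteq> (b :: 'a)"
  obtains \<xi> where "\<xi> \<in> dual" "\<xi> a \<noteq> \<xi> b"
proof -
  obtain \<xi> where \<xi>: "\<xi> \<in> dual" "\<xi> (a - b) \<noteq> 0"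
    using dual_separates[of "a - b"] assms by auto
  then have "\<xi> a \<noteq> \<xi> b"
    using hom_on_UNIV(4)[OF dual_hom[OF \<xi>(1)], of a b] by simp
  with \<xi>(1) show thesis
    by (rule that)
qed

text \<open>Averaging over the translates by \<open>\<xi>\<^sub>1, 2\<xi>\<^sub>1, \<dots>\<close> kills every term
  on which \<open>\<xi>\<^sub>1\<close> differs from its value at \<open>h0\<close>.\<close>

lemma trig_coefficient_le:
  fixes X :: "'a set"
  assumes "finite X" "h0 \<in> X" "\<And>\<xi>. \<xi> \<in> dual \<Longrightarrow> norm (\<Sum>h\<in>X. b h * circle_exp (\<xi> h)) \<le> M"
  shows "norm (b h0) \<le> M"
  using assms
proof (induction X rule: finite_psubset_induct)
  case (psubset X)
  show ?case
  proof (cases "X = {h0}")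
    case True
    then show ?thesis
      using psubset.prems(2)[OF dual_zero] by simp
  next
    case False
    then obtain h1 where h1: "h1 \<in> X" "h1 \<noteq> h0"
      using psubset.prems(1) by blast
    obtain \<xi>1 where \<xi>1: "\<xi>1 \<in> dual" "\<xi>1 h1 \<noteq> \<xi>1 h0"
      using dual_separates_points[OF h1(2)] .
    \<comment> \<open>Dividing by the value at \<open>h0\<close> makes \<open>r h0 = 1\<close>: the
      averages keep the term at \<open>h0\<close> and kill the one at \<open>h1\<close>, so
      \<open>Y\<close> is strictly smaller than \<open>X\<close>.\<close>
    define r where "r h = circle_exp (\<xi>1 h - \<xi>1 h0)" for h
    have r_eq_1: "r h = 1 \<longleftrightarrow> \<xi>1 h = \<xi>1 h0" for h
      using circle_exp_inj[of "\<xi>1 h - \<xi>1 h0" 0] by (simp add: r_def)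
    have M: "0 \<le> M"
      using psubset.prems(2)[OF dual_zero] norm_ge_zero by (rule order_trans[rotated])
    define Y where "Y = {h \<in> X. r h = 1}"
    have "norm (\<Sum>h\<in>Y. b h * circle_exp (\<xi> h)) \<le> M" if \<xi>: "\<xi> \<in> dual" for \<xi>
    proof (rule tendsto_upperbound)
      have "(\<lambda>n. norm (\<Sum>h\<in>X. b h * circle_exp (\<xi> h) * ((\<Sum>j<n. r h ^ j) / of_nat n))) \<longlonglongrightarrow>
          norm (\<Sum>h\<in>X. b h * circle_exp (\<xi> h) * (if r h = 1 then 1 else 0))"
        by (intro tendsto_norm tendsto_sum tendsto_mult_left power_averages_tendsto) (simp add: r_def)
      also have "(\<Sum>h\<in>X. b h * circle_exp (\<xi> h) * (if r h = 1 then 1 else 0)) =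
          (\<Sum>h\<in>Y. b h * circle_exp (\<xi> h))"
        unfolding Y_def using psubset.hyps by (intro sum.mono_neutral_cong_right) auto
      finally show "(\<lambda>n. norm (\<Sum>h\<in>X. b h * circle_exp (\<xi> h) * ((\<Sum>j<n. r h ^ j) / of_nat n))) \<longlonglongrightarrow>
          norm (\<Sum>h\<in>Y. b h * circle_exp (\<xi> h))" .
      have "norm (\<Sum>h\<in>X. b h * circle_exp (\<xi> h) * ((\<Sum>j<n. r h ^ j) / of_nat n)) \<le> M" for n
      proof -
        have each: "norm (\<Sum>h\<in>X. b h * circle_exp (\<xi> h) * r h ^ j) \<le> M" for j
        proof -
          \<comment> \<open>Multiplying the terms by \<open>r h ^ j\<close> amounts to passing from
            \<open>\<xi>\<close> to another character, \<open>\<xi>\<close> plus \<open>j\<close>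
            times \<open>\<xi>1\<close>, up to a constant of modulus 1.\<close>
          obtain \<theta> where \<theta>: "\<theta> \<in> dual" "\<And>h. circle_exp (\<theta> h) = circle_exp (\<xi> h) * circle_exp (\<xi>1 h) ^ j"
            using dual_exp_power[OF \<xi> \<xi>1(1)] by blast
          have "(\<Sum>h\<in>X. b h * circle_exp (\<xi> h) * r h ^ j) =
              cnj (circle_exp (\<xi>1 h0)) ^ j * (\<Sum>h\<in>X. b h * circle_exp (\<theta> h))"
            by (simp add: \<theta>(2) r_def circle_exp_diff power_mult_distrib sum_distrib_left mult_ac)
          then show ?thesis
            using psubset.prems(2)[OF \<theta>(1)] by (simp add: norm_mult norm_power)
        qed
        have "(\<Sum>h\<in>X. b h * circle_exp (\<xi> h) * ((\<Sum>j<n. r h ^ j) / of_nat n)) =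
            (\<Sum>j<n. \<Sum>h\<in>X. b h * circle_exp (\<xi> h) * r h ^ j) / of_nat n"
          by (subst sum.swap) (simp add: sum_distrib_left sum_divide_distrib mult.assoc)
        also have "norm \<dots> \<le> (\<Sum>j<n. M) / real n"
          unfolding norm_divide norm_of_nat by (intro divide_right_mono sum_norm_le each) auto
        also have "\<dots> \<le> M"
          using M by simp
        finally show ?thesis .
      qed
      then show "\<forall>\<^sub>F n in sequentially.
          norm (\<Sum>h\<in>X. b h * circle_exp (\<xi> h) * ((\<Sum>j<n. r h ^ j) / of_nat n)) \<le> M"
        by simp
    qed simp
    moreover have "Y \<subset> X" "h0 \<in> Y"
      using h1 \<xi>1(2) psubset.prems(1) r_eq_1 by (auto simp: Y_def)
    ultimately show ?thesis
      using psubset.IH by blast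
  qed
qed

text \<open>Bohr's proof of Kronecker's theorem: the \<open>p\<close>-th power of
  \<open>\<Sum>a\<in>A. exp (\<xi> a - g a)\<close> has only polynomially many distinct frequencies, and no
  cancellation occurs when equal frequencies are collected because \<open>g\<close> is a homomorphism.\<close>

lemma trig_sum_bound_ge_card:
  fixes A :: "'a set"
  assumes g: "hom_on UNIV g" and "finite A" and "0 \<le> M"
    and M: "\<And>\<xi>. \<xi> \<in> dual \<Longrightarrow> norm (\<Sum>a\<in>A. cnj (circle_exp (g a)) * circle_exp (\<xi> a)) \<le> M"
  shows "real (card A) \<le> M"
proof (rule ccontr)
  assume "\<not> real (card A) \<le> M"
  then have less: "M < real (card A)"
    by simp
  define N where "N = card A"
  have power_le: "real N ^ p \<le> (real p + 1) ^ N * M ^ p" for p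
  proof -
    define W where "W = PiE {..<p} (\<lambda>_. A)"
    define s where "s w = (\<Sum>j<p. w j)" for w :: "nat \<Rightarrow> 'a"
    define X where "X = s ` W"
    have "finite W"
      unfolding W_def using assms(2) by (intro finite_PiE) auto
    then have "finite X"
      by (simp add: X_def)
    \<comment> \<open>The norms of the \<open>b h\<close> add up to the number \<open>N ^ p\<close>
      of words, while each is at most \<open>M ^ p\<close> by
      \<open>trig_coefficient_le\<close>.\<close>
    define b where "b h = of_nat (card {w \<in> W. s w = h}) * cnj (circle_exp (g h))" for h
    have bound: "norm (\<Sum>h\<in>X. b h * circle_exp (\<xi> h)) \<le> M ^ p" if "\<xi> \<in> dual" for \<xi>
    proof -
      have T: "(\<Prod>j<p. cnj (circle_exp (g (w j))) * circle_exp (\<xi> (w j))) =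
          cnj (circle_exp (g (s w))) * circle_exp (\<xi> (s w))" for w
        by (simp add: s_def hom_on_UNIV(5)[OF g] hom_on_UNIV(5)[OF dual_hom[OF that]]
            circle_exp_sum prod.distrib)
      have "(\<Sum>a\<in>A. cnj (circle_exp (g a)) * circle_exp (\<xi> a)) ^ p =
          (\<Prod>j<p. \<Sum>a\<in>A. cnj (circle_exp (g a)) * circle_exp (\<xi> a))"
        by simp
      also have "\<dots> = (\<Sum>w\<in>W. cnj (circle_exp (g (s w))) * circle_exp (\<xi> (s w)))"
        unfolding W_def using assms(2) by (subst prod_sum_PiE) (auto simp: T)
      also have "\<dots> = (\<Sum>h\<in>X. \<Sum>w\<in>{w \<in> W. s w = h}. cnj (circle_exp (g (s w))) * circle_exp (\<xi> (s w)))"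
        unfolding X_def by (rule sum.image_gen[OF \<open>finite W\<close>])
      also have "\<dots> = (\<Sum>h\<in>X. b h * circle_exp (\<xi> h))"
        by (intro sum.cong refl) (simp add: b_def)
      finally have "norm (\<Sum>h\<in>X. b h * circle_exp (\<xi> h)) =
          norm (\<Sum>a\<in>A. cnj (circle_exp (g a)) * circle_exp (\<xi> a)) ^ p"
        by (metis norm_power)
      also have "\<dots> \<le> M ^ p"
        by (intro power_mono M that) auto
      finally show ?thesis .
    qed
    have "real N ^ p = real (card W)"
      by (simp add: W_def N_def card_PiE)
    also have "\<dots> = (\<Sum>w\<in>W. 1)"
      by simp
    also have "\<dots> = (\<Sum>h\<in>X. \<Sum>w\<in>{w \<in> W. s w = h}. 1)"
      unfolding X_def by (rule sum.image_gen[OF \<open>finite W\<close>])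
    also have "\<dots> = (\<Sum>h\<in>X. norm (b h))"
      by (simp add: b_def norm_mult)
    also have "\<dots> \<le> (\<Sum>h\<in>X. M ^ p)"
      by (intro sum_mono trig_coefficient_le[OF \<open>finite X\<close> _ bound])
    also have "\<dots> = real (card X) * M ^ p"
      by simp
    also have "\<dots> \<le> (real p + 1) ^ N * M ^ p"
    proof (rule mult_right_mono)
      have "card X \<le> (p + 1) ^ N"
        unfolding X_def W_def s_def N_def by (rule card_word_sums_le[OF assms(2)])
      then have "real (card X) \<le> real ((p + 1) ^ N)"
        by (rule of_nat_mono)
      then show "real (card X) \<le> (real p + 1) ^ N"
        by (simp add: add.commute)
    qed (use \<open>0 \<le> M\<close> in simp)
    finally show ?thesis .
  qed
  have "0 < real N"
    using less \<open>0 \<le> M\<close> by (simp add: N_def)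
  have "(\<lambda>p. (real p + 1) ^ N * (M / real N) ^ p) \<longlonglongrightarrow> 0"
    using less \<open>0 \<le> M\<close> \<open>0 < real N\<close>
    by (intro power_times_geometric_tendsto_0) (simp_all add: N_def)
  then have "\<forall>\<^sub>F p in sequentially. (real p + 1) ^ N * (M / real N) ^ p < 1"
    by (rule order_tendstoD) simp
  then obtain p where p: "(real p + 1) ^ N * (M / real N) ^ p < 1"
    by (meson eventually_happens' sequentially_bot)
  have "real N ^ p > 0"
    using \<open>0 < real N\<close> by simp
  then have "(real p + 1) ^ N * M ^ p < real N ^ p"
    using p by (simp add: power_divide divide_less_eq)
  with power_le[of p] show False
    by simp
qed

text \<open>If every character missed \<open>g\<close> by \<open>\<epsilon>\<close> somewhere on
  \<open>A\<close>, the sums over \<open>A0\<close> would stay uniformly below their number of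
  terms, contrary to \<open>trig_sum_bound_ge_card\<close>. The point 0 is included because its term
  is always 1: a phase error elsewhere becomes a loss of modulus when the two terms are
  added.\<close>

lemma dual_dense_finite:
  fixes A :: "'a set"
  assumes g: "hom_on UNIV g" and "finite A" and "\<epsilon> > 0"
  obtains \<xi> where "\<xi> \<in> dual" "\<And>a. a \<in> A \<Longrightarrow> dist (circle_exp (\<xi> a)) (circle_exp (g a)) < \<epsilon>"
proof (rule ccontr)
  assume "\<not> thesis"
  then have far: "\<exists>a\<in>A. \<epsilon> \<le> dist (circle_exp (\<xi> a)) (circle_exp (g a))" if "\<xi> \<in> dual" for \<xi>
    using that \<open>\<And>\<xi>. \<lbrakk>\<xi> \<in> dual; \<And>a. a \<in> A \<Longrightarrow> dist (circle_exp (\<xi> a)) (circle_exp (g a)) < \<epsilon>\<rbrakk> \<Longrightarrow> thesis\<close>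
    by (meson not_le)
  define A0 where "A0 = insert 0 A"
  have "finite A0"
    using assms(2) by (simp add: A0_def)
  \<comment> \<open>By the parallelogram law, two unit vectors at distance at least
    \<open>\<epsilon>\<close> have a sum of norm at most
    \<open>sqrt (4 - \<epsilon>\<^sup>2)\<close>; the remaining terms contribute 1 each.\<close>
  define M where "M = real (card A0) - 2 + sqrt (4 - \<epsilon>\<^sup>2)"
  have bound: "norm (\<Sum>a\<in>A0. cnj (circle_exp (g a)) * circle_exp (\<xi> a)) \<le> M" if \<xi>: "\<xi> \<in> dual" for \<xi>
  proof -
    obtain a where a: "a \<in> A" "\<epsilon> \<le> dist (circle_exp (\<xi> a)) (circle_exp (g a))"
      using far[OF \<xi>] by blast
    have "a \<noteq> 0"
      using a(2) \<open>\<epsilon> > 0\<close> hom_on_UNIV(2)[OF g] hom_on_UNIV(2)[OF dual_hom[OF \<xi>]] by auto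
    define w where "w = cnj (circle_exp (g a)) * circle_exp (\<xi> a)"
    have "norm w = 1"
      by (simp add: w_def norm_mult)
    have "circle_exp (g a) * cnj (circle_exp (g a)) = 1"
      by (simp add: complex_norm_square[symmetric])
    then have "circle_exp (g a) * (w - 1) = circle_exp (\<xi> a) - circle_exp (g a)"
      by (simp add: w_def right_diff_distrib mult.assoc[symmetric])
    then have "norm (w - 1) = dist (circle_exp (\<xi> a)) (circle_exp (g a))"
      by (metis dist_norm mult_1 norm_circle_exp norm_mult)
    then have "\<epsilon>\<^sup>2 \<le> (norm (w - 1))\<^sup>2"
      using a(2) \<open>\<epsilon> > 0\<close> by (intro power_mono) auto
    moreover have "(norm (1 + w))\<^sup>2 + (norm (w - 1))\<^sup>2 = 2 + 2 * (norm w)\<^sup>2"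
      unfolding cmod_power2 by (simp add: power2_eq_square algebra_simps)
    ultimately have "(norm (1 + w))\<^sup>2 \<le> 4 - \<epsilon>\<^sup>2"
      using \<open>norm w = 1\<close> by simp
    then have w_le: "norm (1 + w) \<le> sqrt (4 - \<epsilon>\<^sup>2)"
      by (rule real_le_rsqrt)
    have "card (A0 - {0, a}) = card A0 - 2"
      using a(1) \<open>a \<noteq> 0\<close> \<open>finite A0\<close> by (subst card_Diff_subset) (auto simp: A0_def)
    moreover have "card {0, a} \<le> card A0"
      using a(1) by (intro card_mono \<open>finite A0\<close>) (auto simp: A0_def)
    ultimately have card: "real (card (A0 - {0, a})) = real (card A0) - 2"
      using \<open>a \<noteq> 0\<close> by simp
    have "(\<Sum>a\<in>A0. cnj (circle_exp (g a)) * circle_exp (\<xi> a)) =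
        (\<Sum>a\<in>A0 - {0, a}. cnj (circle_exp (g a)) * circle_exp (\<xi> a)) +
        (\<Sum>a\<in>{0, a}. cnj (circle_exp (g a)) * circle_exp (\<xi> a))"
      using a(1) by (intro sum.subset_diff \<open>finite A0\<close>) (auto simp: A0_def)
    also have "(\<Sum>a\<in>{0, a}. cnj (circle_exp (g a)) * circle_exp (\<xi> a)) = 1 + w"
      using \<open>a \<noteq> 0\<close> hom_on_UNIV(2)[OF g] hom_on_UNIV(2)[OF dual_hom[OF \<xi>]]
      by (simp add: w_def)
    finally have "norm (\<Sum>a\<in>A0. cnj (circle_exp (g a)) * circle_exp (\<xi> a)) \<le>
        norm (\<Sum>a\<in>A0 - {0, a}. cnj (circle_exp (g a)) * circle_exp (\<xi> a)) + norm (1 + w)"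
      by (metis norm_triangle_ineq)
    also have "\<dots> \<le> (\<Sum>a\<in>A0 - {0, a}. 1) + sqrt (4 - \<epsilon>\<^sup>2)"
      by (intro add_mono sum_norm_le w_le) (simp add: norm_mult)
    finally show ?thesis
      using card by (simp add: M_def)
  qed
  have "0 \<le> M"
    using bound[OF dual_zero] norm_ge_zero by (rule order_trans[rotated])
  then have "real (card A0) \<le> M"
    using trig_sum_bound_ge_card[OF g \<open>finite A0\<close>] bound by blast
  then have "2 \<le> sqrt (4 - \<epsilon>\<^sup>2)"
    by (simp add: M_def)
  then have "sqrt 4 \<le> sqrt (4 - \<epsilon>\<^sup>2)"
    by simp
  then show False
    using \<open>\<epsilon> > 0\<close> unfolding real_sqrt_le_iff by simp
qed

text \<open>A basic neighbourhood in the product topology restricts only finitely many coordinates.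
  Density is phrased as properness of the trace filter, the form needed for the filter of part
  2.\<close>

lemma dual_dense:
  assumes g: "hom_on UNIV (g :: 'a \<Rightarrow> circle)"
  shows "inf (nhds g) (principal dual) \<noteq> bot"
proof
  assume "inf (nhds g) (principal dual) = bot"
  then have "eventually (\<lambda>_. False) (inf (nhds g) (principal dual))"
    by simp
  then obtain U where U: "open U" "g \<in> U" "U \<inter> dual = {}"
    unfolding eventually_inf_principal eventually_nhds by blast
  then have "openin (product_topology (\<lambda>_. euclidean) UNIV) U"
    by (simp add: euclidean_product_topology)
  from product_topology_open_contains_basis[OF this U(2)]
  obtain V where V': "g \<in> (\<Pi>\<^sub>E i\<in>UNIV. V i)" "\<forall>i. openin euclidean (V i)"
      "finite {i. V i \<noteq> topspace euclidean}" "(\<Pi>\<^sub>E i\<in>UNIV. V i) \<subseteq> U"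
    by (elim exE conjE)
  then have V: "\<And>i. g i \<in> V i" "\<And>i. open (V i)" "finite {i. V i \<noteq> UNIV}"
      "(\<Pi>\<^sub>E i\<in>UNIV. V i) \<subseteq> U"
    by (simp_all add: PiE_iff)
  define A where "A = {i. V i \<noteq> UNIV}"
  have "\<exists>\<epsilon>>0. \<forall>d. dist (circle_exp d) (circle_exp (g i)) < \<epsilon> \<longrightarrow> d \<in> V i" for i
    using circle_exp_ball[OF V(2,1)] by metis
  then obtain \<epsilon> where \<epsilon>: "\<And>i. \<epsilon> i > 0"
      "\<And>i d. dist (circle_exp d) (circle_exp (g i)) < \<epsilon> i \<Longrightarrow> d \<in> V i"
    by metis
  have "finite A"
    using V(3) by (simp add: A_def)
  \<comment> \<open>The element 1 keeps the minimum meaningful when no coordinate is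
    restricted.\<close>
  define \<delta> where "\<delta> = Min (insert 1 (\<epsilon> ` A))"
  have "\<delta> > 0" "\<And>i. i \<in> A \<Longrightarrow> \<delta> \<le> \<epsilon> i"
    using \<open>finite A\<close> \<epsilon>(1) by (auto simp: \<delta>_def)
  obtain \<xi> where \<xi>: "\<xi> \<in> dual" "\<And>a. a \<in> A \<Longrightarrow> dist (circle_exp (\<xi> a)) (circle_exp (g a)) < \<delta>"
    using dual_dense_finite[OF g \<open>finite A\<close> \<open>\<delta> > 0\<close>] by blast
  have "\<xi> i \<in> V i" for i
  proof (cases "i \<in> A")
    case True
    then show ?thesis
      using \<epsilon>(2)[of "\<xi> i" i] \<xi>(2)[OF True] \<open>\<And>i. i \<in> A \<Longrightarrow> \<delta> \<le> \<epsilon> i\<close>[OF True] by linarith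
  qed (simp add: A_def)
  then have "\<xi> \<in> (\<Pi>\<^sub>E i\<in>UNIV. V i)"
    by (simp add: PiE_iff)
  with V(4) have "\<xi> \<in> U"
    by blast
  with \<xi>(1) U(3) show False
    by blast
qed

end

subsection \<open>Extension of homomorphisms into the circle\<close>

text \<open>\<open>nat\<close> sends negative integers to 0, so at most one of the two sums is
  nonempty.\<close>

definition zmul :: "int \<Rightarrow> 'a::ab_group_add \<Rightarrow> 'a"
  where "zmul n x = (\<Sum>j<nat n. x) - (\<Sum>j<nat (- n). x)"

lemma zmul_0 [simp]: "zmul 0 x = 0" and zmul_1 [simp]: "zmul 1 x = x"
  by (simp_all add: zmul_def)

lemma zmul_minus: "zmul (- n) x = - zmul n x"
  by (simp add: zmul_def)

lemma zmul_plus1: "zmul (n + 1) x = zmul n x + x"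
proof (cases "0 \<le> n")
  case True
  then have "nat (n + 1) = Suc (nat n)"
    by simp
  with True show ?thesis
    by (simp add: zmul_def)
next
  case False
  then have "nat (- n) = Suc (nat (- (n + 1)))"
    by simp
  with False show ?thesis
    by (simp add: zmul_def)
qed

lemma zmul_minus1: "zmul (n - 1) x = zmul n x - x"
  using zmul_plus1[of "n - 1" x] by simp

lemma zmul_add: "zmul (m + n) x = zmul m x + zmul n x"
proof (induction n rule: int_induct[where k=0])
  case (step1 i)
  then show ?case
    using zmul_plus1[of "m + i" x] zmul_plus1[of i x] by (simp add: add.assoc)
next
  case (step2 i)
  have "zmul (m + (i - 1)) x = zmul (m + i - 1) x"
    by (simp add: add_diff_eq)
  also have "\<dots> = zmul m x + zmul i x - x"
    unfolding zmul_minus1 step2 ..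
  finally show ?case
    by (simp add: zmul_minus1 add_diff_eq)
qed simp

lemma zmul_mult: "zmul (m * n) x = zmul m (zmul n x)"
proof (induction m rule: int_induct[where k=0])
  case (step1 i)
  then show ?case
    by (simp add: distrib_right zmul_add)
next
  case (step2 i)
  then show ?case
    by (simp add: left_diff_distrib zmul_minus1 zmul_add[of "i * n" "- n", simplified] zmul_minus)
qed simp

lemma zmul_add_right: "zmul n (x + y) = zmul n x + zmul n y"
  by (simp add: zmul_def sum.distrib)

lemma zmul_to_circle: "zmul n (to_circle r) = to_circle (of_int n * r)"
proof (induction n rule: int_induct[where k=0])
  case (step1 i)
  then show ?case
    by (simp add: zmul_plus1 plus_circle.abs_eq distrib_right)
next
  case (step2 i)
  then show ?case
    by (simp add: zmul_minus1 minus_circle.abs_eq left_diff_distrib)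
qed (simp add: zero_circle_def)

lemma subgroup_zmul:
  assumes "is_subgroup \<Gamma>" "(x, t) \<in> \<Gamma>"
  shows "(zmul n x, zmul n t) \<in> \<Gamma>"
proof -
  have add: "(a + b, s + r) \<in> \<Gamma>" if "(a, s) \<in> \<Gamma>" "(b, r) \<in> \<Gamma>" for a b s r
    using assms(1) that unfolding is_subgroup_def by (metis add_Pair)
  have minus: "(- a, - s) \<in> \<Gamma>" if "(a, s) \<in> \<Gamma>" for a s
    using assms(1) that unfolding is_subgroup_def by (metis uminus_Pair)
  show ?thesis
  proof (induction n rule: int_induct[where k=0])
    case base
    then show ?case
      using assms(1) by (simp add: is_subgroup_def zero_prod_def)
  next
    case (step1 i)
    then show ?case
      using add[OF step1(2) assms(2)] by (simp add: zmul_plus1)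
  next
    case (step2 i)
    then show ?case
      using add[OF step2(2) minus[OF assms(2)]] by (simp add: zmul_minus1)
  qed
qed

text \<open>Partial homomorphisms into the circle are represented by their graphs.\<close>

definition hom_graph :: "('a::ab_group_add \<times> circle) set \<Rightarrow> bool"
  where "hom_graph \<Gamma> \<longleftrightarrow> is_subgroup \<Gamma> \<and> (\<forall>t. (0, t) \<in> \<Gamma> \<longrightarrow> t = 0)"

lemma hom_graph_add: "hom_graph \<Gamma> \<Longrightarrow> (a, s) \<in> \<Gamma> \<Longrightarrow> (b, r) \<in> \<Gamma> \<Longrightarrow> (a + b, s + r) \<in> \<Gamma>"
  unfolding hom_graph_def is_subgroup_def by (metis add_Pair)

lemma hom_graph_minus: "hom_graph \<Gamma> \<Longrightarrow> (a, s) \<in> \<Gamma> \<Longrightarrow> (- a, - s) \<in> \<Gamma>"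
  unfolding hom_graph_def is_subgroup_def by (metis uminus_Pair)

lemma hom_graph_unique:
  assumes "hom_graph \<Gamma>" "(a, s) \<in> \<Gamma>" "(a, r) \<in> \<Gamma>"
  shows "s = r"
proof -
  have "(a + - a, s + - r) \<in> \<Gamma>"
    by (intro hom_graph_add hom_graph_minus assms)
  then have "s + - r = 0"
    using assms(1) unfolding hom_graph_def right_minus by blast
  then show ?thesis
    by simp
qed

lemma inverse_of_nat_Ints:
  assumes "0 < d" "1 / real d \<in> \<int>"
  shows "d = 1"
proof -
  obtain n :: int where n: "1 / real d = of_int n"
    using assms(2) by (rule Ints_cases)
  moreover have "0 < 1 / real d"
    using assms(1) by simp
  ultimately have "1 \<le> 1 / real d"
    by simp
  then show ?thesis
    using assms(1) by (simp add: field_simps)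
qed

text \<open>Precisely the condition under which \<open>v\<close> can be prescribed at
  \<open>b\<close> without contradicting \<open>\<Gamma>\<close>.\<close>

definition compatible :: "('a::ab_group_add \<times> circle) set \<Rightarrow> 'a \<Rightarrow> circle \<Rightarrow> bool"
  where "compatible \<Gamma> b v \<longleftrightarrow> (\<forall>n t. (zmul n b, t) \<in> \<Gamma> \<longrightarrow> t = zmul n v)"

text \<open>If no positive multiple of \<open>b\<close> lies in the domain, every value is allowed.
  Otherwise, with \<open>d\<close> the least such multiple and \<open>t0\<close> its value, the only
  condition is \<open>zmul (int d) v = t0\<close>; divisibility of the circle gives a solution, and
  adding \<open>1 / d\<close> gives another, distinct unless \<open>d = 1\<close>, which would put
  \<open>b\<close> in the domain.\<close>

lemma hom_graph_compatible:
  assumes \<Gamma>: "hom_graph \<Gamma>"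
  shows "\<exists>v w. compatible \<Gamma> b v \<and> compatible \<Gamma> b w \<and> (b \<notin> fst ` \<Gamma> \<longrightarrow> v \<noteq> w)"
proof (cases "\<exists>n::nat. 0 < n \<and> zmul (int n) b \<in> fst ` \<Gamma>")
  case False
  have zero: "n = 0" if "(zmul n b, t) \<in> \<Gamma>" for n t
  proof (rule ccontr)
    assume "n \<noteq> 0"
    have "(zmul (- n) b, - t) \<in> \<Gamma>"
      unfolding zmul_minus by (rule hom_graph_minus[OF \<Gamma> that])
    then have "zmul (int (nat \<bar>n\<bar>)) b \<in> fst ` \<Gamma>"
      using that by (cases "0 \<le> n") force+
    with False \<open>n \<noteq> 0\<close> show False
      by (metis nat_0_iff abs_le_zero_iff neq0_conv)
  qed
  have "t = zmul n v" if "(zmul n b, t) \<in> \<Gamma>" for n t v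
    using zero[OF that] that \<Gamma> by (simp add: hom_graph_def)
  then have "compatible \<Gamma> b v" for v
    by (simp add: compatible_def)
  moreover have "to_circle 0 \<noteq> to_circle (1 / 2)"
  proof
    assume "to_circle 0 = to_circle (1 / 2)"
    then have "1 / real 2 \<in> \<int>"
      by (simp add: to_circle_eq_iff[of "1 / 2" 0] eq_commute[of "to_circle 0"])
    from inverse_of_nat_Ints[OF _ this] show False
      by simp
  qed
  ultimately show ?thesis
    by blast
next
  case True
  define d where "d = (LEAST n::nat. 0 < n \<and> zmul (int n) b \<in> fst ` \<Gamma>)"
  have d: "0 < d" "zmul (int d) b \<in> fst ` \<Gamma>"
    using LeastI_ex[OF True] by (simp_all add: d_def)
  have least: "\<not> (0 < n \<and> n < d \<and> zmul (int n) b \<in> fst ` \<Gamma>)" for n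
    using not_less_Least[of n "\<lambda>n. 0 < n \<and> zmul (int n) b \<in> fst ` \<Gamma>"] by (auto simp: d_def)
  obtain t0 where t0: "(zmul (int d) b, t0) \<in> \<Gamma>"
    using d(2) by force
  obtain r where r: "t0 = to_circle r"
    using to_circle_surj by blast
  have compat: "t = zmul n v" if v: "zmul (int d) v = t0" and nt: "(zmul n b, t) \<in> \<Gamma>" for n t v
  proof -
    \<comment> \<open>The remainder of \<open>n\<close> modulo \<open>d\<close> is again a multiple
      in the domain; minimality of \<open>d\<close> makes it 0.\<close>
    define q where "q = n div int d"
    have n: "n = q * int d + n mod int d"
      by (simp add: q_def)
    have "(zmul (- q) (zmul (int d) b), zmul (- q) t0) \<in> \<Gamma>"
      using \<Gamma> t0 by (intro subgroup_zmul) (simp add: hom_graph_def)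
    then have "(zmul n b + zmul (- q) (zmul (int d) b), t + zmul (- q) t0) \<in> \<Gamma>"
      by (rule hom_graph_add[OF \<Gamma> nt])
    moreover have "zmul n b + zmul (- q) (zmul (int d) b) = zmul (n mod int d) b"
      by (subst n) (simp only: zmul_add zmul_minus zmul_mult, simp)
    ultimately have rem: "(zmul (n mod int d) b, t + zmul (- q) t0) \<in> \<Gamma>"
      by simp
    then have "zmul (int (nat (n mod int d))) b \<in> fst ` \<Gamma>"
      using d(1) by force
    then have "\<not> 0 < nat (n mod int d)"
      using least[of "nat (n mod int d)"] d(1) by (auto simp: nat_less_iff)
    moreover have "0 \<le> n mod int d"
      using d(1) by simp
    ultimately have mod: "n mod int d = 0"
      by linarith
    then have "t + zmul (- q) t0 = 0"
      using rem \<Gamma> by (simp add: hom_graph_def)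
    then have "t = zmul q t0"
      by (simp add: zmul_minus)
    also have "\<dots> = zmul n v"
      using n mod by (simp add: v[symmetric] zmul_mult[symmetric])
    finally show ?thesis .
  qed
  define v where "v = to_circle (r / real d)"
  have v: "zmul (int d) v = t0"
    using d(1) by (simp add: v_def zmul_to_circle r)
  define w where "w = v + to_circle (1 / real d)"
  have w: "zmul (int d) w = t0"
    using d(1) by (simp add: w_def zmul_add_right v zmul_to_circle zero_circle_def[symmetric] to_circle_eq_iff
        flip: zero_circle_def) (simp add: zero_circle_def plus_circle.abs_eq r to_circle_eq_iff)
  have "v \<noteq> w" if "b \<notin> fst ` \<Gamma>"
  proof
    assume "v = w"
    then have "to_circle (1 / real d) = to_circle 0"
      by (simp add: w_def zero_circle_def)
    then have "1 / real d \<in> \<int>"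
      by (simp add: to_circle_eq_iff)
    moreover have "d \<noteq> 1"
    proof
      assume "d = 1"
      with d(2) \<open>b \<notin> fst ` \<Gamma>\<close> show False
        by (simp only: of_nat_1 zmul_1)
    qed
    ultimately show False
      using inverse_of_nat_Ints[OF d(1)] by simp
  qed
  moreover have "compatible \<Gamma> b v" "compatible \<Gamma> b w"
    using compat v w unfolding compatible_def by blast+
  ultimately show ?thesis
    by blast
qed

text \<open>The subgroup generated by \<open>\<Gamma>\<close> and \<open>(b, v)\<close> works;
  compatibility is what keeps it single-valued at 0.\<close>

lemma hom_graph_extend:
  assumes \<Gamma>: "hom_graph \<Gamma>" and compat: "compatible \<Gamma> b v"
  obtains \<Delta> where "hom_graph \<Delta>" "\<Gamma> \<subseteq> \<Delta>" "(b, v) \<in> \<Delta>"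
proof
  define \<Delta> where "\<Delta> = {(x + zmul n b, t + zmul n v) | x t n. (x, t) \<in> \<Gamma>}"
  have I: "(x + zmul n b, t + zmul n v) \<in> \<Delta>" if "(x, t) \<in> \<Gamma>" for x t n
    using that by (auto simp: \<Delta>_def)
  have zero: "(0, 0) \<in> \<Gamma>"
    using \<Gamma> by (simp add: hom_graph_def is_subgroup_def zero_prod_def)
  show "\<Gamma> \<subseteq> \<Delta>"
    using I[of _ _ 0] by auto
  show "(b, v) \<in> \<Delta>"
    using I[OF zero, of 1] by simp
  have "0 \<in> \<Delta>"
    using I[OF zero, of 0] by (simp add: zero_prod_def)
  moreover have "p + q \<in> \<Delta>" if "p \<in> \<Delta>" "q \<in> \<Delta>" for p q
  proof -
    obtain x t n where p: "p = (x + zmul n b, t + zmul n v)" "(x, t) \<in> \<Gamma>"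
      using \<open>p \<in> \<Delta>\<close> unfolding \<Delta>_def by blast
    obtain y s m where q: "q = (y + zmul m b, s + zmul m v)" "(y, s) \<in> \<Gamma>"
      using \<open>q \<in> \<Delta>\<close> unfolding \<Delta>_def by blast
    have "(x + y + zmul (n + m) b, t + s + zmul (n + m) v) \<in> \<Delta>"
      by (intro I hom_graph_add[OF \<Gamma>] p q)
    then show ?thesis
      by (simp add: p q zmul_add ac_simps)
  qed
  moreover have "- p \<in> \<Delta>" if "p \<in> \<Delta>" for p
  proof -
    obtain x t n where p: "p = (x + zmul n b, t + zmul n v)" "(x, t) \<in> \<Gamma>"
      using \<open>p \<in> \<Delta>\<close> unfolding \<Delta>_def by blast
    have "(- x + zmul (- n) b, - t + zmul (- n) v) \<in> \<Delta>"
      by (intro I hom_graph_minus[OF \<Gamma>] p)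
    then show ?thesis
      by (simp add: p zmul_minus)
  qed
  moreover have "t = 0" if "(0, t) \<in> \<Delta>" for t
  proof -
    obtain x s n where p: "0 = x + zmul n b" "t = s + zmul n v" "(x, s) \<in> \<Gamma>"
      using \<open>(0, t) \<in> \<Delta>\<close> unfolding \<Delta>_def by blast
    have "x = zmul (- n) b"
      using p(1) by (simp add: zmul_minus eq_neg_iff_add_eq_0)
    then have "s = zmul (- n) v"
      using compat p(3) unfolding compatible_def by blast
    then show ?thesis
      by (simp add: p(2) zmul_minus)
  qed
  ultimately show "hom_graph \<Delta>"
    unfolding hom_graph_def is_subgroup_def by blast
qed

text \<open>Zorn's lemma for graphs under inclusion: unions of chains are graphs, and a maximal one
  is total because every \<open>b\<close> has a compatible value.\<close>

lemma hom_graph_total_extension: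
  assumes "hom_graph \<Gamma>"
  obtains g where "hom_on UNIV g" "\<And>x t. (x, t) \<in> \<Gamma> \<Longrightarrow> g x = t"
proof -
  define \<A> where "\<A> = {\<Delta>. hom_graph \<Delta> \<and> \<Gamma> \<subseteq> \<Delta>}"
  have "\<Gamma> \<in> \<A>"
    using assms by (simp add: \<A>_def)
  have "\<Union>C \<in> \<A>" if "C \<noteq> {}" "subset.chain \<A> C" for C
  proof -
    have C: "hom_graph \<Delta>" "\<Gamma> \<subseteq> \<Delta>" if "\<Delta> \<in> C" for \<Delta>
      using \<open>subset.chain \<A> C\<close> that by (auto simp: \<A>_def subset_chain_def)
    have zero: "0 \<in> \<Union>C"
      using C(1) \<open>C \<noteq> {}\<close> by (auto simp: hom_graph_def is_subgroup_def)
    have add: "p + q \<in> \<Union>C" if pq: "p \<in> \<Union>C" "q \<in> \<Union>C" for p q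
    proof -
      obtain \<Delta>1 \<Delta>2 where D: "\<Delta>1 \<in> C" "p \<in> \<Delta>1" "\<Delta>2 \<in> C" "q \<in> \<Delta>2"
        using pq by blast
      then have "\<Delta>1 \<subseteq> \<Delta>2 \<or> \<Delta>2 \<subseteq> \<Delta>1"
        using \<open>subset.chain \<A> C\<close> by (auto simp: subset_chain_def)
      then obtain \<Delta> where "\<Delta> \<in> C" "p \<in> \<Delta>" "q \<in> \<Delta>"
        using D by blast
      then show ?thesis
        using C(1)[of \<Delta>] by (auto simp: hom_graph_def is_subgroup_def)
    qed
    have minus: "- p \<in> \<Union>C" if "p \<in> \<Union>C" for p
      using C(1) that by (auto simp: hom_graph_def is_subgroup_def)
    have single: "t = 0" if "(0, t) \<in> \<Union>C" for t
      using C(1) that by (auto simp: hom_graph_def)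
    have "\<Gamma> \<subseteq> \<Union>C"
      using C(2) \<open>C \<noteq> {}\<close> by blast
    then show ?thesis
      using zero add minus single by (simp only: \<A>_def hom_graph_def is_subgroup_def mem_Collect_eq) simp
  qed
  then obtain \<Delta> where \<Delta>: "\<Delta> \<in> \<A>" "\<And>X. X \<in> \<A> \<Longrightarrow> \<Delta> \<subseteq> X \<Longrightarrow> X = \<Delta>"
    using subset_Zorn_nonempty[of \<A>] \<open>\<Gamma> \<in> \<A>\<close> by blast
  have graph: "hom_graph \<Delta>" "\<Gamma> \<subseteq> \<Delta>"
    using \<Delta>(1) by (simp_all add: \<A>_def)
  have "\<exists>t. (b, t) \<in> \<Delta>" for b
  proof -
    obtain v where v: "compatible \<Delta> b v"
      using hom_graph_compatible[OF graph(1)] by blast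
    obtain \<Theta> where \<Theta>: "hom_graph \<Theta>" "\<Delta> \<subseteq> \<Theta>" "(b, v) \<in> \<Theta>"
      using hom_graph_extend[OF graph(1) v] by blast
    then have "\<Theta> = \<Delta>"
      using \<Delta>(2)[of \<Theta>] graph(2) by (auto simp: \<A>_def)
    then show ?thesis
      using \<Theta>(3) by blast
  qed
  then obtain g where g: "\<And>b. (b, g b) \<in> \<Delta>"
    by metis
  have "hom_on UNIV g"
    unfolding hom_on_def
  proof (intro ballI)
    fix x y
    show "g (x + y) = g x + g y"
      by (rule hom_graph_unique[OF graph(1) g hom_graph_add[OF graph(1) g g]])
  qed
  moreover have "g x = t" if "(x, t) \<in> \<Gamma>" for x t
    using hom_graph_unique[OF graph(1) g] graph(2) that by blast
  ultimately show thesis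
    by (rule that)
qed

lemma hom_on_hom_graph:
  assumes "is_subgroup H" "hom_on H f"
  shows "hom_graph {(x, f x) | x. x \<in> H}"
proof -
  have H: "0 \<in> H" "\<And>x y. x \<in> H \<Longrightarrow> y \<in> H \<Longrightarrow> x + y \<in> H" "\<And>x. x \<in> H \<Longrightarrow> - x \<in> H"
    using assms(1) by (auto simp: is_subgroup_def)
  have f: "f (x + y) = f x + f y" if "x \<in> H" "y \<in> H" for x y
    using assms(2) that by (simp add: hom_on_def)
  have f0: "f 0 = 0"
    using f[OF H(1) H(1)] by simp
  have "f (- x) = - f x" if "x \<in> H" for x
    using f[OF that H(3)[OF that]] f0 by (simp add: minus_unique)
  then show ?thesis
    using H f f0 unfolding hom_graph_def is_subgroup_def by (auto simp: zero_prod_def)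
qed

lemma hom_extension:
  assumes "is_subgroup H" "hom_on H (f :: 'a::ab_group_add \<Rightarrow> circle)"
  obtains g where "hom_on UNIV g" "\<And>x. x \<in> H \<Longrightarrow> g x = f x"
proof -
  define \<Gamma> where "\<Gamma> = {(x, f x) | x. x \<in> H}"
  have "hom_graph \<Gamma>"
    unfolding \<Gamma>_def by (rule hom_on_hom_graph[OF assms])
  then obtain g where g: "hom_on UNIV g" "\<And>x t. (x, t) \<in> \<Gamma> \<Longrightarrow> g x = t"
    using hom_graph_total_extension by blast
  have "g x = f x" if "x \<in> H" for x
    by (rule g(2)) (use that in \<open>simp add: \<Gamma>_def\<close>)
  with g(1) show thesis
    by (rule that)
qed

lemma hom_extensions_distinct:
  assumes "is_subgroup H" "hom_on H (f :: 'a::ab_group_add \<Rightarrow> circle)" "b \<notin> H"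
  obtains g1 g2 where "hom_on UNIV g1" "hom_on UNIV g2" "\<And>x. x \<in> H \<Longrightarrow> g1 x = f x"
    "\<And>x. x \<in> H \<Longrightarrow> g2 x = f x" "g1 b \<noteq> g2 b"
proof -
  define \<Gamma> where "\<Gamma> = {(x, f x) | x. x \<in> H}"
  have \<Gamma>: "hom_graph \<Gamma>"
    unfolding \<Gamma>_def by (rule hom_on_hom_graph[OF assms(1,2)])
  have "b \<notin> fst ` \<Gamma>"
    using assms(3) by (auto simp: \<Gamma>_def)
  then obtain v w where vw: "compatible \<Gamma> b v" "compatible \<Gamma> b w" "v \<noteq> w"
    using hom_graph_compatible[OF \<Gamma>] by blast
  have ext: "\<exists>g. hom_on UNIV g \<and> (\<forall>x\<in>H. g x = f x) \<and> g b = u"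
    if u: "compatible \<Gamma> b u" for u
  proof -
    obtain \<Delta> where \<Delta>: "hom_graph \<Delta>" "\<Gamma> \<subseteq> \<Delta>" "(b, u) \<in> \<Delta>"
      using hom_graph_extend[OF \<Gamma> u] by blast
    obtain g where g: "hom_on UNIV g" "\<And>x t. (x, t) \<in> \<Delta> \<Longrightarrow> g x = t"
      using hom_graph_total_extension[OF \<Delta>(1)] by blast
    have "g x = f x" if "x \<in> H" for x
      using g(2) \<Delta>(2) that by (auto simp: \<Gamma>_def)
    then show ?thesis
      using g(1) g(2)[OF \<Delta>(3)] by blast
  qed
  from ext[OF vw(1)] ext[OF vw(2)] show thesis
    using that vw(3) by metis
qed

subsection \<open>Limits along filters and sequences\<close>

text \<open>The length of the chord from 0 to \<open>c\<close>, between 0 and 2. By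
  \<open>circle_norm_diff\<close> it turns the chord metric into a norm of differences.\<close>

definition circle_norm :: "circle \<Rightarrow> real"
  where "circle_norm c = dist (circle_exp c) 1"

lemma circle_norm_0 [simp]: "circle_norm 0 = 0"
  by (simp add: circle_norm_def)

lemma circle_norm_diff: "circle_norm (c - d) = dist (circle_exp c) (circle_exp d)"
proof -
  have "circle_exp (c - d) - 1 = cnj (circle_exp d) * (circle_exp c - circle_exp d)"
    using complex_norm_square[of "circle_exp d"] by (simp add: circle_exp_diff algebra_simps)
  then show ?thesis
    by (simp add: circle_norm_def dist_norm norm_mult)
qed

lemma circle_norm_minus: "circle_norm (- c) = circle_norm c"
  using circle_norm_diff[of 0 c] by (simp add: circle_norm_def dist_commute)

lemma circle_norm_add_le: "circle_norm (c + d) \<le> circle_norm c + circle_norm d"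
  using dist_triangle[of "circle_exp c" "circle_exp (- d)" 1] circle_norm_diff[of c "- d"]
    circle_norm_minus[of d]
  by (simp add: circle_norm_def dist_commute)

lemma continuous_circle_norm:
  "continuous_on UNIV f \<Longrightarrow> continuous_on UNIV (\<lambda>x. circle_norm (f x))"
  unfolding circle_norm_def
  by (intro continuous_on_dist continuous_on_const continuous_on_compose2[OF continuous_circle_exp]) auto

lemma tendsto_0_circle_norm: "(f \<longlongrightarrow> 0) F \<longleftrightarrow> ((\<lambda>x. circle_norm (f x)) \<longlongrightarrow> 0) F"
  using tendsto_circle_exp_iff[of f 0 F] by (simp add: circle_norm_def tendsto_dist_iff[of _ 1])

text \<open>A power with nonpositive real part has distance at least 1 from 1, the real part alone
  accounting for it.\<close>

lemma multiple_circle_norm_ge_1: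
  fixes g :: "'a::ab_group_add \<Rightarrow> circle"
  assumes "g x \<noteq> 0"
  obtains j :: nat where "1 \<le> circle_norm (\<Sum>i<j. g x)"
proof -
  have "circle_exp (g x) \<noteq> 1"
    using assms circle_exp_inj[of "g x" 0] by simp
  then obtain j :: nat where "Re (circle_exp (g x) ^ j) \<le> 0"
    using power_Re_nonpos[OF norm_circle_exp] by blast
  then have "1 \<le> circle_norm (\<Sum>i<j. g x)"
    using abs_Re_le_cmod[of "circle_exp (g x) ^ j - 1"]
    by (simp add: circle_norm_def circle_exp_sum dist_norm)
  then show thesis
    by (rule that)
qed

lemma hom_multiple: "hom_on UNIV g \<Longrightarrow> hom_on UNIV (\<lambda>x. \<Sum>i<(j::nat). g x)"
  by (simp add: hom_on_def sum.distrib)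

lemma dual_multiple:
  assumes "\<xi> \<in> dual"
  shows "(\<lambda>x. \<Sum>i<(j::nat). \<xi> x) \<in> dual"
  using assms hom_multiple[of \<xi>] by (auto simp: dual_def intro: continuous_on_sum)

text \<open>Indexed families cover both filters on the dual and sequences. \<open>Lim\<close> is
  unspecified where no limit exists, but \<open>hom_on\<close> evaluates it only at points with a
  limit, sums included.\<close>

lemma limit_subgroup_hom:
  fixes \<phi> :: "'i \<Rightarrow> 'a::ab_group_add \<Rightarrow> circle"
  assumes "F \<noteq> bot" "\<forall>\<^sub>F i in F. hom_on UNIV (\<phi> i)"
  shows "is_subgroup {a. \<exists>y. ((\<lambda>i. \<phi> i a) \<longlongrightarrow> y) F}"
    and "hom_on {a. \<exists>y. ((\<lambda>i. \<phi> i a) \<longlongrightarrow> y) F} (\<lambda>a. Lim F (\<lambda>i. \<phi> i a))"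
proof -
  have add: "((\<lambda>i. \<phi> i (a + b)) \<longlongrightarrow> y + z) F"
    if "((\<lambda>i. \<phi> i a) \<longlongrightarrow> y) F" "((\<lambda>i. \<phi> i b) \<longlongrightarrow> z) F" for a b y z
  proof -
    have "\<forall>\<^sub>F i in F. \<phi> i a + \<phi> i b = \<phi> i (a + b)"
      using assms(2) by eventually_elim (simp add: hom_on_UNIV)
    with tendsto_add[OF that] show ?thesis
      by (rule Lim_transform_eventually)
  qed
  have minus: "((\<lambda>i. \<phi> i (- a)) \<longlongrightarrow> - y) F" if "((\<lambda>i. \<phi> i a) \<longlongrightarrow> y) F" for a y
  proof -
    have "\<forall>\<^sub>F i in F. - \<phi> i a = \<phi> i (- a)"
      using assms(2) by eventually_elim (simp add: hom_on_UNIV)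
    with tendsto_minus[OF that] show ?thesis
      by (rule Lim_transform_eventually)
  qed
  have "\<forall>\<^sub>F i in F. 0 = \<phi> i 0"
    using assms(2) by eventually_elim (simp add: hom_on_UNIV)
  then have "((\<lambda>i. \<phi> i 0) \<longlongrightarrow> 0) F"
    by (rule Lim_transform_eventually[OF tendsto_const])
  then show "is_subgroup {a. \<exists>y. ((\<lambda>i. \<phi> i a) \<longlongrightarrow> y) F}"
    unfolding is_subgroup_def using add minus by blast
  show "hom_on {a. \<exists>y. ((\<lambda>i. \<phi> i a) \<longlongrightarrow> y) F} (\<lambda>a. Lim F (\<lambda>i. \<phi> i a))"
    unfolding hom_on_def
  proof (intro ballI)
    fix a b assume "a \<in> {a. \<exists>y. ((\<lambda>i. \<phi> i a) \<longlongrightarrow> y) F}" "b \<in> {a. \<exists>y. ((\<lambda>i. \<phi> i a) \<longlongrightarrow> y) F}"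
    then obtain y z where yz: "((\<lambda>i. \<phi> i a) \<longlongrightarrow> y) F" "((\<lambda>i. \<phi> i b) \<longlongrightarrow> z) F"
      by blast
    show "Lim F (\<lambda>i. \<phi> i (a + b)) = Lim F (\<lambda>i. \<phi> i a) + Lim F (\<lambda>i. \<phi> i b)"
      using tendsto_Lim[OF assms(1)] yz add[OF yz] by metis
  qed
qed

section \<open>Filters and sequences converging to a given homomorphism\<close>

context compact_group
begin

lemma filter_exists:
  fixes H :: "'a set" and f :: "'a \<Rightarrow> circle"
  assumes "is_subgroup H" "hom_on H f"
  obtains F where "proper_filter_on dual F" "\<And>a. a \<in> H \<Longrightarrow> ((\<lambda>\<xi>. \<xi> a) \<longlongrightarrow> f a) F"
    "\<And>b y. b \<notin> H \<Longrightarrow> \<not> ((\<lambda>\<xi>. \<xi> b) \<longlongrightarrow> y) F"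
proof -
  define E where "E = {g. hom_on UNIV g \<and> (\<forall>a\<in>H. g a = f a)}"
  \<comment> \<open>A supremum of filters keeps exactly the properties shared by all members. Limits
    common to all extensions survive, as on \<open>H\<close>; conversely a limit along
    \<open>F\<close> is one along each member, which forces \<open>g b\<close> to be the same for
    all \<open>g\<close> in \<open>E\<close>.\<close>
  define F where "F = (SUP g\<in>E. inf (nhds g) (principal dual))"
  have le: "inf (nhds g) (principal dual) \<le> F" if "g \<in> E" for g
    unfolding F_def using that by (rule SUP_upper)
  have lim: "((\<lambda>\<xi>. \<xi> a) \<longlongrightarrow> g a) (inf (nhds g) (principal dual))" for g :: "'a \<Rightarrow> circle" and a
    using tendsto_fun_nhds by (rule tendsto_mono[OF inf_le1])
  have dense: "inf (nhds g) (principal dual) \<noteq> bot" if "g \<in> E" for g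
    using that dual_dense by (simp add: E_def)
  show thesis
  proof
    obtain g where "hom_on UNIV g" "\<And>x. x \<in> H \<Longrightarrow> g x = f x"
      using hom_extension[OF assms] by blast
    then have "g \<in> E"
      by (simp add: E_def)
    then have "F \<noteq> bot"
      using le dense by (metis bot.extremum_unique)
    moreover have "\<forall>\<^sub>F \<xi> in F. \<xi> \<in> dual"
      unfolding F_def eventually_Sup by (auto simp: eventually_inf_principal)
    ultimately show "proper_filter_on dual F"
      by (simp add: proper_filter_on_def)
  next
    fix a assume "a \<in> H"
    show "((\<lambda>\<xi>. \<xi> a) \<longlongrightarrow> f a) F"
    proof (rule topological_tendstoI)
      fix S assume "open S" "f a \<in> S"
      then have "\<forall>\<^sub>F \<xi> in inf (nhds g) (principal dual). \<xi> a \<in> S" if "g \<in> E" for g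
        using that \<open>a \<in> H\<close> by (intro topological_tendstoD[OF lim]) (auto simp: E_def)
      then show "\<forall>\<^sub>F \<xi> in F. \<xi> a \<in> S"
        unfolding F_def eventually_Sup by blast
    qed
  next
    fix b y assume "b \<notin> H"
    obtain g1 g2 where "hom_on UNIV g1" "hom_on UNIV g2" "\<And>x. x \<in> H \<Longrightarrow> g1 x = f x"
        "\<And>x. x \<in> H \<Longrightarrow> g2 x = f x" and neq: "g1 b \<noteq> g2 b"
      using hom_extensions_distinct[OF assms \<open>b \<notin> H\<close>] by blast
    then have g: "g1 \<in> E" "g2 \<in> E"
      by (simp_all add: E_def)
    show "\<not> ((\<lambda>\<xi>. \<xi> b) \<longlongrightarrow> y) F"
    proof
      assume "((\<lambda>\<xi>. \<xi> b) \<longlongrightarrow> y) F"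
      then have "g b = y" if "g \<in> E" for g
        using tendsto_unique[OF dense[OF that] lim tendsto_mono[OF le[OF that]]] by blast
      with g neq show False
        by blast
    qed
  qed
qed

lemma dual_close:
  fixes A :: "'a set"
  assumes "hom_on UNIV g" "finite A" "\<epsilon> > 0"
  obtains \<xi> where "\<xi> \<in> dual" "\<And>a. a \<in> A \<Longrightarrow> circle_norm (\<xi> a - g a) < \<epsilon>"
  using dual_dense_finite[OF assms] unfolding circle_norm_diff by blast

lemma sequence_exists:
  fixes H :: "'a set" and f :: "'a \<Rightarrow> circle"
  assumes "is_subgroup H" "hom_on H f" "countable H"
  obtains \<xi> where "\<And>n. \<xi> n \<in> dual" "\<And>a. a \<in> H \<Longrightarrow> (\<lambda>n. \<xi> n a) \<longlonglongrightarrow> f a"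
proof -
  obtain g where g: "hom_on UNIV g" "\<And>x. x \<in> H \<Longrightarrow> g x = f x"
    using hom_extension[OF assms(1,2)] by blast
  have "H \<noteq> {}"
    using assms(1) by (auto simp: is_subgroup_def)
  \<comment> \<open>For finite \<open>H\<close> this enumeration repeats elements, which is
    harmless: what matters is \<open>range h = H\<close>.\<close>
  define h where "h = from_nat_into H"
  have h: "range h = H"
    unfolding h_def by (rule range_from_nat_into[OF \<open>H \<noteq> {}\<close> assms(3)])
  have "\<exists>\<xi>. \<xi> \<in> dual \<and> (\<forall>i\<le>n. circle_norm (\<xi> (h i) - g (h i)) < 1 / real (Suc n))" for n
  proof -
    have "finite (h ` {..n})" "0 < 1 / real (Suc n)"
      by simp_all
    then obtain \<xi> where "\<xi> \<in> dual" "\<And>a. a \<in> h ` {..n} \<Longrightarrow> circle_norm (\<xi> a - g a) < 1 / real (Suc n)"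
      using dual_close[OF g(1)] by blast
    then show ?thesis
      by blast
  qed
  then obtain \<xi> where \<xi>: "\<And>n. \<xi> n \<in> dual"
    "\<And>n i. i \<le> n \<Longrightarrow> circle_norm (\<xi> n (h i) - g (h i)) < 1 / real (Suc n)"
    by metis
  have "(\<lambda>n. \<xi> n a) \<longlonglongrightarrow> f a" if a: "a \<in> H" for a
  proof -
    obtain i where i: "a = h i"
      using a h by blast
    have "(\<lambda>n. circle_norm (\<xi> n a - f a)) \<longlonglongrightarrow> 0"
    proof (rule tendsto_sandwich[OF _ _ tendsto_const LIMSEQ_inverse_real_of_nat])
      show "\<forall>\<^sub>F n in sequentially. 0 \<le> circle_norm (\<xi> n a - f a)"
        by (simp add: circle_norm_def)
      show "\<forall>\<^sub>F n in sequentially. circle_norm (\<xi> n a - f a) \<le> inverse (real (Suc n))"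
        using eventually_ge_at_top[of i]
      proof eventually_elim
        case (elim n)
        then show ?case
          using \<xi>(2)[OF elim] g(2)[OF a] by (simp add: i inverse_eq_divide less_imp_le)
      qed
    qed
    then have "(\<lambda>n. \<xi> n a - f a) \<longlonglongrightarrow> 0"
      by (simp only: tendsto_0_circle_norm)
    from tendsto_add[OF this tendsto_const[of "f a"]] show ?thesis
      by simp
  qed
  with \<xi>(1) show thesis
    by (rule that)
qed

end

subsection \<open>Characterizing sequences\<close>

context compact_group
begin

lemma open_circle_norm_less:
  fixes f :: "'b::topological_space \<Rightarrow> circle"
  assumes "continuous_on UNIV f"
  shows "open {x. circle_norm (f x) < c}" "open {x. c < circle_norm (f x)}"
  using continuous_circle_norm[OF assms]
  by (auto intro: open_Collect_less continuous_on_const)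

text \<open>The closure of the dual is compact in the product of circles. Subtracting one of
  finitely many characters thus brings any character into the Bohr set of \<open>A\<close> and
  \<open>\<epsilon>\<close>.\<close>

lemma dual_totally_bounded:
  fixes A :: "'a set"
  assumes "finite A" "\<epsilon> > 0"
  obtains D where "finite D" "D \<subseteq> dual"
    "\<And>\<xi>. \<xi> \<in> dual \<Longrightarrow> \<exists>\<theta>\<in>D. \<forall>a\<in>A. circle_norm (\<xi> a - \<theta> a) < \<epsilon>"
proof -
  have opn: "open {\<psi> :: 'a \<Rightarrow> circle. \<forall>a\<in>A. circle_norm (\<psi> a - \<theta> a) < \<epsilon>}" for \<theta>
  proof -
    have "open {\<psi> :: 'a \<Rightarrow> circle. circle_norm (\<psi> a - \<theta> a) < \<epsilon>}" for a
      by (intro open_circle_norm_less continuous_on_diff continuous_on_const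
          continuous_on_product_coordinates)
    then have "open (\<Inter>a\<in>A. {\<psi> :: 'a \<Rightarrow> circle. circle_norm (\<psi> a - \<theta> a) < \<epsilon>})"
      using assms(1) by (intro open_INT) auto
    moreover have "(\<Inter>a\<in>A. {\<psi> :: 'a \<Rightarrow> circle. circle_norm (\<psi> a - \<theta> a) < \<epsilon>}) =
        {\<psi>. \<forall>a\<in>A. circle_norm (\<psi> a - \<theta> a) < \<epsilon>}"
      by auto
    ultimately show ?thesis
      by simp
  qed
  have "compact (UNIV :: ('a \<Rightarrow> circle) set)"
    using compact_fun[OF compact_UNIV_circle] by simp
  then have "compact (UNIV \<inter> closure (dual :: ('a \<Rightarrow> circle) set))"
    by (rule compact_Int_closed) simp
  then have comp: "compact (closure (dual :: ('a \<Rightarrow> circle) set))"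
    by simp
  have cover: "closure dual \<subseteq> (\<Union>\<theta>\<in>dual. {\<psi>. \<forall>a\<in>A. circle_norm (\<psi> a - \<theta> a) < \<epsilon>})"
  proof
    fix \<psi> :: "'a \<Rightarrow> circle" assume "\<psi> \<in> closure dual"
    moreover have "\<psi> \<in> {\<psi>'. \<forall>a\<in>A. circle_norm (\<psi>' a - \<psi> a) < \<epsilon>}"
      using assms(2) by simp
    ultimately obtain \<theta> where \<theta>: "\<theta> \<in> dual" "\<forall>a\<in>A. circle_norm (\<theta> a - \<psi> a) < \<epsilon>"
      using opn[of \<psi>] open_Int_closure_eq_empty[OF opn[of \<psi>], of dual] by blast
    then have "\<forall>a\<in>A. circle_norm (\<psi> a - \<theta> a) < \<epsilon>"
      using circle_norm_minus[of "\<theta> _ - \<psi> _"] by simp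
    with \<theta>(1) show "\<psi> \<in> (\<Union>\<theta>\<in>dual. {\<psi>. \<forall>a\<in>A. circle_norm (\<psi> a - \<theta> a) < \<epsilon>})"
      by blast
  qed
  obtain D where D: "D \<subseteq> dual" "finite D"
      "closure dual \<subseteq> (\<Union>\<theta>\<in>D. {\<psi>. \<forall>a\<in>A. circle_norm (\<psi> a - \<theta> a) < \<epsilon>})"
    by (rule compactE_image[OF comp opn cover])
  show thesis
  proof (rule that[OF D(2,1)])
    fix \<xi> :: "'a \<Rightarrow> circle" assume "\<xi> \<in> dual"
    then have "\<xi> \<in> closure dual"
      using closure_subset by blast
    then show "\<exists>\<theta>\<in>D. \<forall>a\<in>A. circle_norm (\<xi> a - \<theta> a) < \<epsilon>"
      using D(3) by blast
  qed
qed

definition bohr_set :: "'a set \<Rightarrow> real \<Rightarrow> ('a \<Rightarrow> circle) set"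
  where "bohr_set A \<epsilon> = {\<xi> \<in> dual. \<forall>a\<in>A. circle_norm (\<xi> a) < \<epsilon>}"

text \<open>The bound 1/4 leaves room for both estimates below: three errors of at most 1/4 stay
  below 1, and so does 1/4 plus any \<open>\<epsilon> < 3 / 4\<close>.\<close>

definition polar :: "('a \<Rightarrow> circle) set \<Rightarrow> 'a set"
  where "polar B = {b. \<forall>\<xi>\<in>B. circle_norm (\<xi> b) \<le> 1 / 4}"

lemma closed_polar:
  assumes "B \<subseteq> dual"
  shows "closed (polar B)"
proof -
  have "open (\<Union>\<xi>\<in>B. {b. 1 / 4 < circle_norm (\<xi> b)})"
    using assms by (intro open_UN ballI open_circle_norm_less) (auto simp: dual_def)
  moreover have "- polar B = (\<Union>\<xi>\<in>B. {b. 1 / 4 < circle_norm (\<xi> b)})"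
    by (auto simp: polar_def)
  ultimately show ?thesis
    by (simp add: closed_def)
qed

text \<open>For \<open>b\<close> outside \<open>H\<close>, two extensions of the zero homomorphism
  differ at \<open>b\<close>. A multiple of their difference vanishes on \<open>H\<close> and has
  size at least 1 at \<open>b\<close>; a character close to it lies in the Bohr set but exceeds 1/4
  at \<open>b\<close>.\<close>

lemma polar_bohr_set_subset:
  fixes H A :: "'a set"
  assumes H: "is_subgroup H" and A: "finite A" "A \<subseteq> H" and "0 < \<epsilon>" "\<epsilon> < 3 / 4"
  shows "polar (bohr_set A \<epsilon>) \<subseteq> H"
proof
  fix b assume b: "b \<in> polar (bohr_set A \<epsilon>)"
  show "b \<in> H"
  proof (rule ccontr)
    assume "b \<notin> H"
    have "hom_on H (\<lambda>_. 0 :: circle)"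
      by (simp add: hom_on_def)
    then obtain g1 g2 :: "'a \<Rightarrow> circle" where g12: "hom_on UNIV g1" "hom_on UNIV g2"
      "\<And>x. x \<in> H \<Longrightarrow> g1 x = 0" "\<And>x. x \<in> H \<Longrightarrow> g2 x = 0" "g1 b \<noteq> g2 b"
      using hom_extensions_distinct[OF H _ \<open>b \<notin> H\<close>] by blast
    define g where "g x = g1 x - g2 x" for x
    have "hom_on UNIV g"
      using g12(1,2) by (simp add: g_def hom_on_def)
    moreover have "g b \<noteq> 0"
      using g12(5) by (simp add: g_def)
    then obtain j :: nat where j: "1 \<le> circle_norm (\<Sum>i<j. g b)"
      by (rule multiple_circle_norm_ge_1)
    define k where "k x = (\<Sum>i<j. g x)" for x
    have "hom_on UNIV k"
      unfolding k_def using \<open>hom_on UNIV g\<close> by (rule hom_multiple)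
    moreover have "finite (insert b A)"
      using A(1) by simp
    ultimately obtain \<xi> where \<xi>: "\<xi> \<in> dual" "\<And>a. a \<in> insert b A \<Longrightarrow> circle_norm (\<xi> a - k a) < \<epsilon>"
      using dual_close[OF _ _ \<open>0 < \<epsilon>\<close>] by blast
    have "circle_norm (\<xi> a) < \<epsilon>" if "a \<in> A" for a
    proof -
      have "k a = 0"
        using that A(2) g12(3,4) by (auto simp: k_def g_def)
      then show ?thesis
        using \<xi>(2)[of a] that by simp
    qed
    then have "\<xi> \<in> bohr_set A \<epsilon>"
      using \<xi>(1) by (simp add: bohr_set_def)
    then have "circle_norm (\<xi> b) \<le> 1 / 4"
      using b by (simp add: polar_def)
    moreover have "circle_norm (k b - \<xi> b) < \<epsilon>"
      using \<xi>(2)[of b] circle_norm_minus[of "\<xi> b - k b"] by simp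
    moreover have "circle_norm (k b) \<le> circle_norm (k b - \<xi> b) + circle_norm (\<xi> b)"
      using circle_norm_add_le[of "k b - \<xi> b" "\<xi> b"] by simp
    ultimately show False
      using j \<open>\<epsilon> < 3 / 4\<close> by (simp add: k_def)
  qed
qed

text \<open>The bound applies to all multiples of a character as well, and a nonzero value has a
  multiple of size at least 1.\<close>

lemma eq_if_dual_close:
  fixes a b :: 'a
  assumes "\<And>\<xi>. \<xi> \<in> dual \<Longrightarrow> circle_norm (\<xi> a - \<xi> b) < 1"
  shows "a = b"
proof (rule ccontr)
  assume "a \<noteq> b"
  then obtain \<xi> where \<xi>: "\<xi> \<in> dual" "\<xi> a \<noteq> \<xi> b"
    by (rule dual_separates_points)
  then have "\<xi> (a - b) \<noteq> 0"
    by (simp add: hom_on_UNIV(4)[OF dual_hom])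
  then obtain j :: nat where "1 \<le> circle_norm (\<Sum>i<j. \<xi> (a - b))"
    by (rule multiple_circle_norm_ge_1)
  moreover have "(\<Sum>i<j. \<xi> (a - b)) = (\<Sum>i<j. \<xi> a) - (\<Sum>i<j. \<xi> b)"
    by (simp add: hom_on_UNIV(4)[OF dual_hom[OF \<xi>(1)]] sum_subtractf)
  ultimately show False
    using assms[OF dual_multiple[OF \<xi>(1), of j]] by simp
qed

text \<open>The polar is compact, and two of its points on which the finitely many characters of
  \<open>D\<close> nearly agree coincide: every character is an element of \<open>D\<close> plus one
  of the Bohr set, so its values differ by less than 1/4 + 1/4 + 1/4. A finite subcover therefore
  has one point per member.\<close>

lemma finite_polar_bohr_set:
  fixes A :: "'a set"
  assumes "finite A" "\<epsilon> > 0"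
  shows "finite (polar (bohr_set A \<epsilon>))"
proof -
  obtain D where D: "finite D" "D \<subseteq> dual"
    "\<And>\<xi>. \<xi> \<in> dual \<Longrightarrow> \<exists>\<theta>\<in>D. \<forall>a\<in>A. circle_norm (\<xi> a - \<theta> a) < \<epsilon>"
    using dual_totally_bounded[OF assms] by blast
  define S where "S = polar (bohr_set A \<epsilon>)"
  define V where "V b = (\<Inter>\<theta>\<in>D. {x. circle_norm (\<theta> x - \<theta> b) < 1 / 4})" for b
  have "closed S"
    unfolding S_def by (rule closed_polar) (auto simp: bohr_set_def)
  then have "compact (UNIV \<inter> S)"
    by (intro compact_Int_closed compact_UNIV)
  then have "compact S"
    by simp
  moreover have "open (V b)" for b
    unfolding V_def
  proof (intro open_INT ballI open_circle_norm_less continuous_on_diff continuous_on_const)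
    show "continuous_on UNIV \<theta>" if "\<theta> \<in> D" for \<theta>
      using that D(2) by (auto simp: dual_def)
  qed (rule D(1))
  moreover have "S \<subseteq> (\<Union>b\<in>S. V b)"
    by (auto simp: V_def)
  ultimately obtain T where T: "T \<subseteq> S" "finite T" "S \<subseteq> (\<Union>b\<in>T. V b)"
    by (rule compactE_image)
  have "x = b" if "x \<in> S" "b \<in> S" "x \<in> V b" for x b
  proof (rule eq_if_dual_close)
    fix \<xi> :: "'a \<Rightarrow> circle" assume "\<xi> \<in> dual"
    then obtain \<theta> where \<theta>: "\<theta> \<in> D" "\<forall>a\<in>A. circle_norm (\<xi> a - \<theta> a) < \<epsilon>"
      using D(3) by blast
    define \<rho> where "\<rho> y = \<xi> y - \<theta> y" for y
    have "\<rho> \<in> bohr_set A \<epsilon>"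
      using \<theta> D(2) dual_diff[OF \<open>\<xi> \<in> dual\<close>, of \<theta>] by (auto simp: bohr_set_def \<rho>_def[abs_def])
    then have "circle_norm (\<rho> x) \<le> 1 / 4" "circle_norm (\<rho> b) \<le> 1 / 4"
      using that(1,2) by (simp_all add: S_def polar_def)
    moreover have "circle_norm (\<theta> x - \<theta> b) < 1 / 4"
      using that(3) \<theta>(1) by (simp add: V_def)
    moreover have "\<xi> x - \<xi> b = (\<rho> x + - \<rho> b) + (\<theta> x - \<theta> b)"
      by (simp add: \<rho>_def)
    then have "circle_norm (\<xi> x - \<xi> b) \<le> (circle_norm (\<rho> x) + circle_norm (- \<rho> b)) + circle_norm (\<theta> x - \<theta> b)"
      by (metis add_mono_thms_linordered_semiring(3) circle_norm_add_le order_trans)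
    ultimately show "circle_norm (\<xi> x - \<xi> b) < 1"
      by (simp add: circle_norm_minus)
  qed
  then have "S \<subseteq> T"
    using T by blast
  then show ?thesis
    using T(2) finite_subset by (auto simp: S_def)
qed

text \<open>The complement of \<open>U\<close> is compact and covered by the open sets on which a
  single character of \<open>B\<close> exceeds 1/4.\<close>

lemma polar_finite_subset:
  assumes "B \<subseteq> dual" "open U" "polar B \<subseteq> U"
  obtains C where "finite C" "C \<subseteq> B" "polar C \<subseteq> U"
proof -
  have "compact (UNIV \<inter> - U)"
    using assms(2) by (intro compact_Int_closed compact_UNIV) (simp add: closed_def)
  then have "compact (- U)"
    by simp
  moreover have "open {b. 1 / 4 < circle_norm (\<xi> b)}" if "\<xi> \<in> B" for \<xi>
    using that assms(1) by (intro open_circle_norm_less) (auto simp: dual_def)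
  moreover have "- U \<subseteq> (\<Union>\<xi>\<in>B. {b. 1 / 4 < circle_norm (\<xi> b)})"
    using assms(3) by (force simp: polar_def)
  ultimately obtain C where C: "C \<subseteq> B" "finite C" "- U \<subseteq> (\<Union>\<xi>\<in>C. {b. 1 / 4 < circle_norm (\<xi> b)})"
    by (rule compactE_image)
  have "polar C \<subseteq> U"
    using C(3) by (force simp: polar_def)
  with C show thesis
    by (intro that)
qed

end

lemma (in Metric_space) finite_separated:
  assumes "finite S" "S \<subseteq> M"
  obtains \<rho> where "\<rho> > 0" "\<And>x y. x \<in> S \<Longrightarrow> y \<in> S \<Longrightarrow> d x y < \<rho> \<Longrightarrow> x = y"
proof -
  \<comment> \<open>The element 1 covers sets with at most one point, which have no pairs to
    separate.\<close>
  define P where "P = insert 1 ((\<lambda>(x, y). d x y) ` {p \<in> S \<times> S. fst p \<noteq> snd p})"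
  have "finite P"
    using assms(1) by (simp add: P_def)
  show thesis
  proof
    show "Min P > 0"
      using \<open>finite P\<close> assms(2) by (auto simp: P_def Min_gr_iff intro!: mdist_pos_less)
    show "x = y" if "x \<in> S" "y \<in> S" "d x y < Min P" for x y
    proof (rule ccontr)
      assume "x \<noteq> y"
      then have "d x y \<in> P"
        using that(1,2) by (force simp: P_def)
      then show False
        using Min_le[OF \<open>finite P\<close>] that(3) by fastforce
    qed
  qed
qed

section \<open>Finite blocks of characters, their enumeration and interleaving\<close>

context compact_group
begin

text \<open>The radius \<open>r n\<close> of the neighbourhoods of the finite set \<open>S n\<close> is adapted
  to the next set \<open>S (Suc n)\<close>, so that a point in almost all of these neighbourhoods
  belongs to some \<open>S n\<close>.\<close>

lemma characterizing_blocks: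
  fixes H :: "'a set"
  assumes H: "is_subgroup H" "countable H" and "metrizable_space (euclidean :: 'a topology)"
  obtains C :: "nat \<Rightarrow> ('a \<Rightarrow> circle) set"
  where "\<And>n. finite (C n)" "\<And>n. C n \<subseteq> dual"
    "\<And>a \<epsilon>. a \<in> H \<Longrightarrow> \<epsilon> > 0 \<Longrightarrow> \<exists>N. \<forall>n\<ge>N. \<forall>\<xi>\<in>C n. circle_norm (\<xi> a) < \<epsilon>"
    "\<And>b N. (\<And>n. n \<ge> N \<Longrightarrow> b \<in> polar (C n)) \<Longrightarrow> b \<in> H"
proof -
  obtain M d where "Metric_space M d" and top: "euclidean = Metric_space.mtopology M (d :: 'a \<Rightarrow> 'a \<Rightarrow> real)"
    using assms(3) unfolding metrizable_space_def by blast
  then interpret Metric_space M d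
    by simp
  have M: "M = UNIV"
    using topspace_mtopology by (simp add: top[symmetric])
  have "H \<noteq> {}"
    using H(1) by (auto simp: is_subgroup_def)
  define h where "h = from_nat_into H"
  have h: "range h = H"
    unfolding h_def by (rule range_from_nat_into[OF \<open>H \<noteq> {}\<close> H(2)])
  \<comment> \<open>The tolerance tends to 0, which gives convergence on \<open>H\<close>, and
    starts at 1/2, below the 3/4 required by \<open>polar_bohr_set_subset\<close>.\<close>
  define B where "B n = bohr_set (h ` {..n}) (1 / (real n + 2))" for n
  define S where "S n = polar (B n)" for n
  have B_dual: "B n \<subseteq> dual" for n
    by (auto simp: B_def bohr_set_def)
  have S_H: "S n \<subseteq> H" for n
    unfolding S_def B_def using h by (intro polar_bohr_set_subset H(1)) (auto simp: field_simps)
  have S_fin: "finite (S n)" for n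
    unfolding S_def B_def by (intro finite_polar_bohr_set) auto
  have "B (Suc n) \<subseteq> B n" for n
  proof -
    have "1 / (real (Suc n) + 2) \<le> 1 / (real n + 2)"
      by (simp add: frac_le)
    then show ?thesis
      unfolding B_def bohr_set_def by (auto simp: le_SucI dest!: spec intro: less_le_trans)
  qed
  then have S_mono: "S n \<subseteq> S (Suc n)" for n
    unfolding S_def polar_def by blast
  have "\<exists>\<rho>>0. \<forall>x\<in>S n. \<forall>y\<in>S n. d x y < \<rho> \<longrightarrow> x = y" for n
    using finite_separated[OF S_fin[of n]] by (metis M subset_UNIV)
  then obtain \<rho> where \<rho>: "\<And>n. \<rho> n > 0" "\<And>n x y. x \<in> S n \<Longrightarrow> y \<in> S n \<Longrightarrow> d x y < \<rho> n \<Longrightarrow> x = y"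
    by metis
  define e where "e n = 1 / real (Suc n)" for n
  have "e n > 0" for n
    by (simp add: e_def)
  \<comment> \<open>Centres in \<open>S n\<close> and \<open>S (Suc n)\<close> within
    \<open>r n\<close> and \<open>r (Suc n)\<close> of one point are closer than
    \<open>\<rho> (Suc n)\<close>, and both lie in \<open>S (Suc n)\<close>, so they are equal. The
    bound \<open>e n\<close> makes the radii tend to 0, which identifies the point with the common
    centre.\<close>
  define r where "r n = min (min (\<rho> n) (\<rho> (Suc n))) (e n) / 2" for n
  have r: "r n > 0" "r n \<le> \<rho> n / 2" "r n \<le> \<rho> (Suc n) / 2" "r n \<le> e n" for n
    using \<rho>(1)[of n] \<rho>(1)[of "Suc n"] \<open>e n > 0\<close> by (auto simp: r_def min_def)
  define U where "U n = (\<Union>s\<in>S n. mball s (r n))" for n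
  have "openin mtopology (U n)" for n
    unfolding U_def by (intro openin_Union) auto
  then have U_open: "open (U n)" for n
    by (simp add: top[symmetric])
  have "x \<in> mball x (r n)" for x n
    using r(1)[of n] M by (metis UNIV_I centre_in_mball_iff)
  then have "polar (B n) \<subseteq> U n" for n
    unfolding U_def S_def[symmetric] by blast
  then have "\<exists>C. finite C \<and> C \<subseteq> B n \<and> polar C \<subseteq> U n" for n
    using polar_finite_subset[OF B_dual U_open] by metis
  then obtain C where C: "\<And>n. finite (C n)" "\<And>n. C n \<subseteq> B n" "\<And>n. polar (C n) \<subseteq> U n"
    by metis
  show thesis
  proof (rule that[of C])
    show "finite (C n)" "C n \<subseteq> dual" for n
      using C(1,2) B_dual by blast+
  next
    fix a and \<epsilon> :: real assume "a \<in> H" "\<epsilon> > 0"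
    obtain i where i: "a = h i"
      using \<open>a \<in> H\<close> h by blast
    obtain m where m: "1 / real (Suc m) < \<epsilon>"
      using nat_approx_posE[OF \<open>\<epsilon> > 0\<close>] .
    have "circle_norm (\<xi> a) < \<epsilon>" if "n \<ge> max i m" "\<xi> \<in> C n" for n \<xi>
    proof -
      have "\<xi> \<in> B n"
        using C(2) that(2) by blast
      then have "circle_norm (\<xi> a) < 1 / (real n + 2)"
        using that(1) by (auto simp: B_def bohr_set_def i)
      also have "\<dots> \<le> 1 / real (Suc m)"
        using that(1) by (intro divide_left_mono) auto
      finally show ?thesis
        using m by linarith
    qed
    then show "\<exists>N. \<forall>n\<ge>N. \<forall>\<xi>\<in>C n. circle_norm (\<xi> a) < \<epsilon>"
      by blast
  next
    fix b N assume "\<And>n. n \<ge> N \<Longrightarrow> b \<in> polar (C n)"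
    then have "\<exists>s. s \<in> S n \<and> d s b < r n" if "n \<ge> N" for n
      using C(3)[of n] that by (fastforce simp: U_def)
    then obtain s where s: "\<And>n. n \<ge> N \<Longrightarrow> s n \<in> S n" "\<And>n. n \<ge> N \<Longrightarrow> d (s n) b < r n"
      by metis
    have step: "s (Suc n) = s n" if "n \<ge> N" for n
    proof -
      have "d (s (Suc n)) (s n) \<le> d (s (Suc n)) b + d (s n) b"
        using triangle''[of "s (Suc n)" b "s n"] commute[of b] by (simp add: M)
      also have "\<dots> < \<rho> (Suc n)"
        using s(2)[of n] s(2)[of "Suc n"] that r(3)[of n] r(2)[of "Suc n"] by simp
      finally show ?thesis
        using \<rho>(2)[of "s (Suc n)" "Suc n" "s n"] s(1)[of n] s(1)[of "Suc n"] that S_mono[of n] by auto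
    qed
    have const: "s n = s N" if "n \<ge> N" for n
      using that by (induction n rule: dec_induct) (simp_all add: step)
    have "d (s N) b \<le> \<epsilon>" if \<epsilon>: "\<epsilon> > 0" for \<epsilon>
    proof -
      obtain m where m: "1 / real (Suc m) < \<epsilon>"
        using nat_approx_posE[OF \<epsilon>] .
      have "d (s N) b < r (max m N)"
        using s(2)[of "max m N"] const[of "max m N"] by simp
      also have "\<dots> \<le> 1 / real (Suc (max m N))"
        using r(4)[of "max m N"] by (simp only: e_def)
      also have "\<dots> \<le> 1 / real (Suc m)"
        by (intro divide_left_mono) auto
      finally show ?thesis
        using m by linarith
    qed
    then have "d (s N) b \<le> 0"
      using field_le_epsilon[of "d (s N) b" 0] by simp
    then have "s N = b"
      using nonneg[of "s N" b] zero[of "s N" b] by (simp add: M)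
    then show "b \<in> H"
      using s(1)[of N] S_H by blast
  qed
qed

lemma characterizing_sequence:
  fixes H :: "'a set"
  assumes "is_subgroup H" "countable H" "metrizable_space (euclidean :: 'a topology)"
  obtains \<psi> :: "nat \<Rightarrow> 'a \<Rightarrow> circle" where "\<And>n. \<psi> n \<in> dual"
    "\<And>a. a \<in> H \<Longrightarrow> (\<lambda>n. \<psi> n a) \<longlonglongrightarrow> 0" "\<And>b. b \<notin> H \<Longrightarrow> \<not> (\<lambda>n. \<psi> n b) \<longlonglongrightarrow> 0"
proof -
  obtain C :: "nat \<Rightarrow> ('a \<Rightarrow> circle) set" where C: "\<And>n. finite (C n)" "\<And>n. C n \<subseteq> dual"
    "\<And>a \<epsilon>. a \<in> H \<Longrightarrow> \<epsilon> > 0 \<Longrightarrow> \<exists>N. \<forall>n\<ge>N. \<forall>\<xi>\<in>C n. circle_norm (\<xi> a) < \<epsilon>"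
    "\<And>b N. (\<And>n. n \<ge> N \<Longrightarrow> b \<in> polar (C n)) \<Longrightarrow> b \<in> H"
    by (rule characterizing_blocks[OF assms]) (assumption | blast)+
  \<comment> \<open>Adding the zero character to each block makes the disjoint union infinite even
    if blocks are empty, so that it can be enumerated bijectively; zero terms do not disturb
    convergence to 0.\<close>
  define P where "P = (SIGMA n:UNIV. insert (\<lambda>_. 0) (C n))"
  have "countable P"
    unfolding P_def using C(1) by (intro countable_SIGMA) (auto intro: countable_finite)
  have "infinite P"
  proof
    assume "finite P"
    then have "finite (fst ` P)"
      by simp
    moreover have "fst ` P = UNIV"
      by (force simp: P_def)
    ultimately show False
      by simp
  qed
  define p where "p = from_nat_into P"
  have p: "bij_betw p UNIV P"
    unfolding p_def by (rule bij_betw_from_nat_into[OF \<open>countable P\<close> \<open>infinite P\<close>])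
  have p_in: "p k \<in> P" for k
    using p by (auto simp: bij_betw_def)
  define \<psi> where "\<psi> k = snd (p k)" for k
  have \<psi>_in: "\<psi> k = (\<lambda>_. 0) \<or> \<psi> k \<in> C (fst (p k))" for k
    using p_in[of k] by (auto simp: P_def \<psi>_def)
  have late: "\<forall>\<^sub>F k in sequentially. N \<le> fst (p k)" for N
  proof -
    have "finite (SIGMA n:{..<N}. insert (\<lambda>_. 0) (C n))"
      using C(1) by auto
    then have "finite (p -` (SIGMA n:{..<N}. insert (\<lambda>_. 0) (C n)))"
      using p by (intro finite_vimageI) (auto simp: bij_betw_def)
    moreover have "p k \<in> (SIGMA n:{..<N}. insert (\<lambda>_. 0) (C n))" if "\<not> N \<le> fst (p k)" for k
      using p_in[of k] that by (cases "p k") (auto simp: P_def)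
    then have "{k. \<not> N \<le> fst (p k)} \<subseteq> p -` (SIGMA n:{..<N}. insert (\<lambda>_. 0) (C n))"
      by blast
    ultimately show ?thesis
      unfolding cofinite_eq_sequentially[symmetric] eventually_cofinite by (rule finite_subset[rotated])
  qed
  show thesis
  proof (rule that[of \<psi>])
    show "\<psi> k \<in> dual" for k
      using \<psi>_in[of k] C(2) dual_zero by auto
  next
    fix a assume "a \<in> H"
    show "(\<lambda>k. \<psi> k a) \<longlonglongrightarrow> 0"
      unfolding tendsto_0_circle_norm
    proof (rule tendstoI)
      fix \<epsilon> :: real assume "\<epsilon> > 0"
      then obtain N where N: "\<And>n \<xi>. n \<ge> N \<Longrightarrow> \<xi> \<in> C n \<Longrightarrow> circle_norm (\<xi> a) < \<epsilon>"
        using C(3)[OF \<open>a \<in> H\<close>] by blast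
      show "\<forall>\<^sub>F k in sequentially. dist (circle_norm (\<psi> k a)) 0 < \<epsilon>"
        using late[of N]
      proof eventually_elim
        case (elim k)
        have "circle_norm (\<psi> k a) < \<epsilon>"
          using \<psi>_in[of k] N[OF elim, of "\<psi> k"] \<open>\<epsilon> > 0\<close> by auto
        then show ?case
          by (simp add: circle_norm_def)
      qed
    qed
  next
    fix b assume "b \<notin> H"
    show "\<not> (\<lambda>k. \<psi> k b) \<longlonglongrightarrow> 0"
    proof
      assume "(\<lambda>k. \<psi> k b) \<longlonglongrightarrow> 0"
      then have "(\<lambda>k. circle_norm (\<psi> k b)) \<longlonglongrightarrow> 0"
        by (simp only: tendsto_0_circle_norm)
      then have "\<forall>\<^sub>F k in sequentially. circle_norm (\<psi> k b) < 1 / 4"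
        by (rule order_tendstoD) simp
      then obtain K where K: "\<And>k. k \<ge> K \<Longrightarrow> circle_norm (\<psi> k b) < 1 / 4"
        unfolding eventually_sequentially by blast
      \<comment> \<open>The enumeration need not respect the order of the blocks. This
        \<open>N\<close> exceeds the block numbers of the first \<open>K\<close> terms, so every
        member of a block from \<open>N\<close> on is enumerated at \<open>K\<close> or
        later.\<close>
      define N where "N = Suc (\<Sum>k<K. fst (p k))"
      have "b \<in> polar (C n)" if "n \<ge> N" for n
        unfolding polar_def
      proof (intro CollectI ballI)
        fix \<xi> assume "\<xi> \<in> C n"
        then have "(n, \<xi>) \<in> P"
          by (simp add: P_def)
        then obtain k where k: "p k = (n, \<xi>)"
          using p by (metis bij_betw_imp_surj_on imageE)
        have "k \<ge> K"
        proof (rule ccontr)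
          assume "\<not> k \<ge> K"
          then have "fst (p k) \<le> (\<Sum>k<K. fst (p k))"
            by (intro member_le_sum) auto
          then show False
            using \<open>n \<ge> N\<close> k by (simp add: N_def)
        qed
        then show "circle_norm (\<xi> b) \<le> 1 / 4"
          using K[of k] k by (simp add: \<psi>_def)
      qed
      then show False
        using C(4) \<open>b \<notin> H\<close> by blast
    qed
  qed
qed

lemma sequence_exists_exact:
  fixes H :: "'a set" and f :: "'a \<Rightarrow> circle"
  assumes "is_subgroup H" "hom_on H f" "countable H" "metrizable_space (euclidean :: 'a topology)"
  obtains \<xi> where "\<And>n. \<xi> n \<in> dual" "\<And>a. a \<in> H \<Longrightarrow> (\<lambda>n. \<xi> n a) \<longlonglongrightarrow> f a"
    "\<And>b. b \<notin> H \<Longrightarrow> \<not> convergent (\<lambda>n. \<xi> n b)"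
proof -
  obtain \<theta> where \<theta>: "\<And>n. \<theta> n \<in> dual" "\<And>a. a \<in> H \<Longrightarrow> (\<lambda>n. \<theta> n a) \<longlonglongrightarrow> f a"
    using sequence_exists[OF assms(1-3)] by blast
  obtain \<psi> :: "nat \<Rightarrow> 'a \<Rightarrow> circle" where \<psi>: "\<And>n. \<psi> n \<in> dual"
    "\<And>a. a \<in> H \<Longrightarrow> (\<lambda>n. \<psi> n a) \<longlonglongrightarrow> 0" "\<And>b. b \<notin> H \<Longrightarrow> \<not> (\<lambda>n. \<psi> n b) \<longlonglongrightarrow> 0"
    using characterizing_sequence[OF assms(1,3,4)] by blast
  \<comment> \<open>Adding \<open>\<psi>\<close> to every term could cancel a divergence of
    \<open>\<theta>\<close> outside \<open>H\<close>. Since the even terms keep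
    \<open>\<theta>\<close> and the odd ones pair the same \<open>\<theta>\<close> with
    \<open>\<psi>\<close>, a limit at \<open>b\<close> would make the difference
    \<open>\<psi> n b\<close> tend to 0.\<close>
  define \<xi> where "\<xi> n = (\<lambda>x. \<theta> (n div 2) x + (if even n then 0 else \<psi> (n div 2) x))" for n
  have half: "filterlim (\<lambda>n::nat. n div 2) sequentially sequentially"
    unfolding filterlim_at_top
  proof
    fix Z :: nat
    show "\<forall>\<^sub>F n in sequentially. Z \<le> n div 2"
      using eventually_ge_at_top[of "2 * Z"] by eventually_elim simp
  qed
  show thesis
  proof (rule that[of \<xi>])
    show "\<xi> n \<in> dual" for n
      using dual_add[OF \<theta>(1) \<psi>(1)] \<theta>(1) by (cases "even n") (simp_all add: \<xi>_def)
  next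
    fix a assume "a \<in> H"
    have "(\<lambda>n. if even n then 0 else \<psi> (n div 2) a) \<longlonglongrightarrow> 0"
    proof (rule topological_tendstoI)
      fix S :: "circle set" assume S: "open S" "0 \<in> S"
      have "(\<lambda>n. \<psi> (n div 2) a) \<longlonglongrightarrow> 0"
        using \<psi>(2)[OF \<open>a \<in> H\<close>] half by (rule filterlim_compose)
      from topological_tendstoD[OF this S]
      show "\<forall>\<^sub>F n in sequentially. (if even n then 0 else \<psi> (n div 2) a) \<in> S"
        by eventually_elim (simp add: S(2))
    qed
    moreover have "(\<lambda>n. \<theta> (n div 2) a) \<longlonglongrightarrow> f a"
      using \<theta>(2)[OF \<open>a \<in> H\<close>] half by (rule filterlim_compose)
    ultimately show "(\<lambda>n. \<xi> n a) \<longlonglongrightarrow> f a"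
      unfolding \<xi>_def using tendsto_add by fastforce
  next
    fix b assume "b \<notin> H"
    show "\<not> convergent (\<lambda>n. \<xi> n b)"
    proof
      assume "convergent (\<lambda>n. \<xi> n b)"
      then obtain y where y: "(\<lambda>n. \<xi> n b) \<longlonglongrightarrow> y"
        by (auto simp: convergent_def)
      have "strict_mono (\<lambda>n::nat. 2 * n)" "strict_mono (\<lambda>n::nat. 2 * n + 1)"
        by (auto simp: strict_mono_def)
      from LIMSEQ_subseq_LIMSEQ[OF y this(1)] LIMSEQ_subseq_LIMSEQ[OF y this(2)]
      have "(\<lambda>n. \<theta> n b) \<longlonglongrightarrow> y" "(\<lambda>n. \<theta> n b + \<psi> n b) \<longlonglongrightarrow> y"
        by (simp_all add: \<xi>_def o_def)
      from tendsto_diff[OF this(2,1)] have "(\<lambda>n. \<psi> n b) \<longlonglongrightarrow> 0"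
        by simp
      with \<psi>(3)[OF \<open>b \<notin> H\<close>] show False ..
    qed
  qed
qed

end

theorem theorem5p1:
  assumes "compact (UNIV :: 'a::{topological_ab_group_add, t2_space} set)"
    and "infinite (UNIV :: 'a set)"
  shows
    "(\<forall>F :: ('a \<Rightarrow> circle) filter. proper_filter_on dual F \<longrightarrow>
        is_subgroup {\<alpha>. \<exists>y. ((\<lambda>\<phi>. \<phi> \<alpha>) \<longlongrightarrow> y) F} \<and>
        hom_on {\<alpha>. \<exists>y. ((\<lambda>\<phi>. \<phi> \<alpha>) \<longlongrightarrow> y) F} (\<lambda>\<alpha>. Lim F (\<lambda>\<phi>. \<phi> \<alpha>)))
     \<and>
     (\<forall>\<phi> :: nat \<Rightarrow> 'a \<Rightarrow> circle. (\<forall>n. \<phi> n \<in> dual) \<longrightarrow>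
        is_subgroup {\<alpha>. convergent (\<lambda>n. \<phi> n \<alpha>)} \<and>
        hom_on {\<alpha>. convergent (\<lambda>n. \<phi> n \<alpha>)} (\<lambda>\<alpha>. lim (\<lambda>n. \<phi> n \<alpha>)))
     \<and>
     (\<forall>(H :: 'a set) (f :: 'a \<Rightarrow> circle). is_subgroup H \<and> hom_on H f \<longrightarrow>
       (\<exists>F. proper_filter_on dual F \<and>
          (\<forall>\<alpha>\<in>H. ((\<lambda>\<phi>. \<phi> \<alpha>) \<longlongrightarrow> f \<alpha>) F) \<and>
          (\<forall>\<beta>. \<beta> \<notin> H \<longrightarrow> \<not> (\<exists>y. ((\<lambda>\<phi>. \<phi> \<beta>) \<longlongrightarrow> y) F))))
     \<and>
     (\<forall>(H :: 'a set) (f :: 'a \<Rightarrow> circle). is_subgroup H \<and> hom_on H f \<and> countable H \<longrightarrow>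
       (\<exists>\<phi> :: nat \<Rightarrow> 'a \<Rightarrow> circle. (\<forall>n. \<phi> n \<in> dual) \<and>
          (\<forall>\<alpha>\<in>H. (\<lambda>n. \<phi> n \<alpha>) \<longlonglongrightarrow> f \<alpha>)))
     \<and>
     (\<forall>(H :: 'a set) (f :: 'a \<Rightarrow> circle).
       is_subgroup H \<and> hom_on H f \<and> metrizable_space (euclidean :: 'a topology) \<and> countable H \<longrightarrow>
       (\<exists>\<phi> :: nat \<Rightarrow> 'a \<Rightarrow> circle. (\<forall>n. \<phi> n \<in> dual) \<and>
          (\<forall>\<alpha>\<in>H. (\<lambda>n. \<phi> n \<alpha>) \<longlonglongrightarrow> f \<alpha>) \<and>
          (\<forall>\<beta>. \<beta> \<notin> H \<longrightarrow> \<not> convergent (\<lambda>n. \<phi> n \<beta>))))"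
proof -
  interpret compact_group "TYPE('a)"
    by standard (rule assms(1))
  show ?thesis
  proof (intro conjI allI impI; (elim conjE)?)
    fix F :: "('a \<Rightarrow> circle) filter" assume "proper_filter_on dual F"
    then have F: "F \<noteq> bot" "\<forall>\<^sub>F \<phi> in F. hom_on UNIV \<phi>"
      by (auto simp: proper_filter_on_def dual_def elim: eventually_mono)
    show "is_subgroup {\<alpha>. \<exists>y. ((\<lambda>\<phi>. \<phi> \<alpha>) \<longlongrightarrow> y) F}"
      "hom_on {\<alpha>. \<exists>y. ((\<lambda>\<phi>. \<phi> \<alpha>) \<longlongrightarrow> y) F} (\<lambda>\<alpha>. Lim F (\<lambda>\<phi>. \<phi> \<alpha>))"
      by (rule limit_subgroup_hom[OF F])+
  next
    fix \<phi> :: "nat \<Rightarrow> 'a \<Rightarrow> circle" assume "\<forall>n. \<phi> n \<in> dual"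
    then have "\<forall>\<^sub>F n in sequentially. hom_on UNIV (\<phi> n)"
      by (simp add: dual_def)
    from limit_subgroup_hom[OF sequentially_bot this]
    show "is_subgroup {\<alpha>. convergent (\<lambda>n. \<phi> n \<alpha>)}"
      "hom_on {\<alpha>. convergent (\<lambda>n. \<phi> n \<alpha>)} (\<lambda>\<alpha>. lim (\<lambda>n. \<phi> n \<alpha>))"
      by (simp_all only: convergent_def)
  next
    fix H :: "'a set" and f :: "'a \<Rightarrow> circle" assume "is_subgroup H" "hom_on H f"
    then obtain F where "proper_filter_on dual F" "\<And>a. a \<in> H \<Longrightarrow> ((\<lambda>\<xi>. \<xi> a) \<longlongrightarrow> f a) F"
      "\<And>b y. b \<notin> H \<Longrightarrow> \<not> ((\<lambda>\<xi>. \<xi> b) \<longlongrightarrow> y) F"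
      using filter_exists by blast
    then show "\<exists>F. proper_filter_on dual F \<and> (\<forall>\<alpha>\<in>H. ((\<lambda>\<phi>. \<phi> \<alpha>) \<longlongrightarrow> f \<alpha>) F) \<and>
        (\<forall>\<beta>. \<beta> \<notin> H \<longrightarrow> \<not> (\<exists>y. ((\<lambda>\<phi>. \<phi> \<beta>) \<longlongrightarrow> y) F))"
      by (intro exI[of _ F] conjI ballI allI impI) simp_all
  next
    fix H :: "'a set" and f :: "'a \<Rightarrow> circle" assume "is_subgroup H" "hom_on H f" "countable H"
    then obtain \<xi> where "\<And>n. \<xi> n \<in> dual" "\<And>a. a \<in> H \<Longrightarrow> (\<lambda>n. \<xi> n a) \<longlonglongrightarrow> f a"
      using sequence_exists by blast
    then show "\<exists>\<phi>. (\<forall>n. \<phi> n \<in> dual) \<and> (\<forall>\<alpha>\<in>H. (\<lambda>n. \<phi> n \<alpha>) \<longlonglongrightarrow> f \<alpha>)"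
      by (intro exI[of _ \<xi>] conjI ballI allI) simp_all
  next
    fix H :: "'a set" and f :: "'a \<Rightarrow> circle"
    assume "is_subgroup H" "hom_on H f" "metrizable_space (euclidean :: 'a topology)" "countable H"
    then obtain \<xi> where "\<And>n. \<xi> n \<in> dual" "\<And>a. a \<in> H \<Longrightarrow> (\<lambda>n. \<xi> n a) \<longlonglongrightarrow> f a"
      "\<And>b. b \<notin> H \<Longrightarrow> \<not> convergent (\<lambda>n. \<xi> n b)"
      using sequence_exists_exact by blast
    then show "\<exists>\<phi>. (\<forall>n. \<phi> n \<in> dual) \<and> (\<forall>\<alpha>\<in>H. (\<lambda>n. \<phi> n \<alpha>) \<longlonglongrightarrow> f \<alpha>) \<and>
        (\<forall>\<beta>. \<beta> \<notin> H \<longrightarrow> \<not> convergent (\<lambda>n. \<phi> n \<beta>))"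
      by (intro exI[of _ \<xi>] conjI ballI allI impI) simp_all
  qed
qed

end
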